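(* Let $s\in(0,1)$, $p\in(1,\infty)$ and $w\in A_p$. If $\Omega\subset\mathbb{R}^n$ is open and bounded, then $$W^{1,p}_{w,0}(\Omega)\hookrightarrow W^{s,p}_{w,0}(\Omega)\hookrightarrow L^p_w(\Omega),$$ where $\hookrightarrow$ denotes continuous embedding.
   Context: Throughout $n\ge2$. A weight is a function $w\in L^1_{\mathrm{loc}}(\mathbb{R}^n)$ with $w>0$ a.e.; $w(U)=\int_U w\,dx$; $L^p_w(\Omega)$ has norm $(\int_\Omega|v|^pw\,dx)^{1/p}$. For $1<p<\infty$, $w\in A_p$ means $$[w]_{A_p}:=\sup_{B}\Big(\frac1{|B|}\int_B w\,dx\Big)\Big(\frac1{|B|}\int_B w^{\frac1{1-p}}dx\Big)^{p-1}<\infty,$$ the supremum being over all balls in $\mathbb{R}^n$. For $x,y\in\mathbb{R}^n$ let $B_{x,y}$ be the ball with center $\frac{x+y}2$ and radius $\frac12|x-y|$. Let $0<\lambda\le\Lambda<\infty$ and let $k:\mathbb{R}^n\times\mathbb{R}^n\to[0,\infty)$ be a measurable kernel with $\lambda\frac{w(x)w(y)}{w(B_{x,y})}\le k(x,y)\le\Lambda\frac{w(x)w(y)}{w(B_{x,y})}$. Set $$\mathcal{J}^s_{p,w}(v)=s(1-s)\int_{\mathbb{R}^n}\int_{\mathbb{R}^n}\Big(\frac{|v(x)-v(y)|}{|x-y|^s}\Big)^p k(x,y)\,dx\,dy,$$ $W^{s,p}_w(\mathbb{R}^n)=\{v\in L^1_{\mathrm{loc}}(\mathbb{R}^n):\mathcal{J}^s_{p,w}(v)<\infty\}$,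 $|v|_{W^{s,p}_w(\mathbb{R}^n)}=(\mathcal{J}^s_{p,w}(v))^{1/p}$, and $W^{s,p}_{w,0}(\Omega)=\{v\in W^{s,p}_w(\mathbb{R}^n): v=0 \text{ a.e. on }\Omega^c\}$, normed by $|\cdot|_{W^{s,p}_w(\mathbb{R}^n)}$. $W^{1,p}_{w}(\mathbb{R}^n)$ is the weighted Sobolev space of weakly differentiable functions with norm $(\int_{\mathbb{R}^n}(|v|^p+|\nabla v|^p)w\,dx)^{1/p}<\infty$, and $W^{1,p}_{w,0}(\Omega)=\{v\in W^{1,p}_w(\mathbb{R}^n): v=0\text{ a.e. on }\Omega^c\}$ with the same norm. *)

theory Defs
  imports "HOL-Analysis.Analysis"
begin

text \<open>Functions are total real-valued representatives and measurability is with respect to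
  \<^const>\<open>lebesgue\<close>. Integrals whose finiteness is part of a definition are extended
  nonnegative integrals.\<close>

definition locally_integrable ::
    "('a::euclidean_space \<Rightarrow> 'b::{banach, second_countable_topology}) \<Rightarrow> bool" where
  "locally_integrable f \<longleftrightarrow> (\<forall>K. compact K \<longrightarrow> set_integrable lebesgue K f)"

definition weight :: "(real^'n \<Rightarrow> real) \<Rightarrow> bool" where
  "weight w \<longleftrightarrow> locally_integrable w \<and> (AE x in lebesgue. 0 < w x)"

definition weight_of :: "(real^'n \<Rightarrow> real) \<Rightarrow> (real^'n) set \<Rightarrow> real" where
  "weight_of w U = (LINT x:U|lebesgue. w x)"

text \<open>Only used for a positive exponent \<open>a\<close>, so that infinity to the power \<open>a\<close> is infinity.\<close>

definition ennreal_powr :: "ennreal \<Rightarrow> real \<Rightarrow> ennreal" where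
  "ennreal_powr t a = (if t = \<infinity> then \<infinity> else ennreal (enn2real t powr a))"

definition ball_average :: "(real^'n \<Rightarrow> real) \<Rightarrow> (real^'n) set \<Rightarrow> ennreal" where
  "ball_average f B = (\<integral>\<^sup>+x\<in>B. ennreal (f x) \<partial>lebesgue) / emeasure lebesgue B"

definition Ap_constant :: "real \<Rightarrow> (real^'n \<Rightarrow> real) \<Rightarrow> ennreal" where
  "Ap_constant p w =
     (SUP (c, r) \<in> UNIV \<times> {0<..}.
        ball_average w (ball c r) *
        ennreal_powr (ball_average (\<lambda>x. w x powr (1 / (1 - p))) (ball c r)) (p - 1))"

definition Ap_weights :: "real \<Rightarrow> (real^'n \<Rightarrow> real) set" where
  "Ap_weights p = {w. weight w \<and> Ap_constant p w < \<infinity>}"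

definition ball_between :: "real^'n \<Rightarrow> real^'n \<Rightarrow> (real^'n) set" where
  "ball_between x y = ball (midpoint x y) (dist x y / 2)"

text \<open>Since \<open>w\<close> is only determined almost everywhere, the two-sided bound is required for almost
  every pair \<open>(x, y)\<close>. In particular it says nothing on the diagonal, where the ball is
  degenerate.\<close>

definition comparable_kernel ::
    "real \<Rightarrow> real \<Rightarrow> (real^'n \<Rightarrow> real) \<Rightarrow> ((real^'n) \<times> (real^'n) \<Rightarrow> real) \<Rightarrow> bool" where
  "comparable_kernel l L w k \<longleftrightarrow>
     k \<in> borel_measurable lebesgue \<and> (\<forall>z. 0 \<le> k z) \<and>
     (AE (x, y) in lebesgue.
        l * (w x * w y / weight_of w (ball_between x y)) \<le> k (x, y) \<and>
        k (x, y) \<le> L * (w x * w y / weight_of w (ball_between x y)))"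

text \<open>The weight enters the fractional energy and the fractional spaces only through the
  kernel \<open>k\<close>. Division by zero on the diagonal makes the integrand vanish there, which is
  harmless because the diagonal is a null set.\<close>

definition frac_energy ::
    "((real^'n) \<times> (real^'n) \<Rightarrow> real) \<Rightarrow> real \<Rightarrow> real \<Rightarrow> (real^'n \<Rightarrow> real) \<Rightarrow> ennreal" where
  "frac_energy k s p v = ennreal (s * (1 - s)) *
     (\<integral>\<^sup>+y. (\<integral>\<^sup>+x. ennreal ((\<bar>v x - v y\<bar> / norm (x - y) powr s) powr p * k (x, y))
        \<partial>lebesgue) \<partial>lebesgue)"

definition frac_sobolev ::
    "((real^'n) \<times> (real^'n) \<Rightarrow> real) \<Rightarrow> real \<Rightarrow> real \<Rightarrow> (real^'n \<Rightarrow> real) set" where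
  "frac_sobolev k s p = {v. locally_integrable v \<and> frac_energy k s p v < \<infinity>}"

definition frac_norm ::
    "((real^'n) \<times> (real^'n) \<Rightarrow> real) \<Rightarrow> real \<Rightarrow> real \<Rightarrow> (real^'n \<Rightarrow> real) \<Rightarrow> real" where
  "frac_norm k s p v = enn2real (frac_energy k s p v) powr (1 / p)"

definition frac_sobolev0 ::
    "((real^'n) \<times> (real^'n) \<Rightarrow> real) \<Rightarrow> real \<Rightarrow> real \<Rightarrow> (real^'n) set \<Rightarrow> (real^'n \<Rightarrow> real) set" where
  "frac_sobolev0 k s p \<Omega> =
     {v \<in> frac_sobolev k s p. AE x in lebesgue. x \<notin> \<Omega> \<longrightarrow> v x = 0}"

definition partial_deriv :: "'n \<Rightarrow> (real^'n \<Rightarrow> real) \<Rightarrow> real^'n \<Rightarrow> real" where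
  "partial_deriv i f x = frechet_derivative f (at x) (axis i 1)"

primrec cont_diff :: "nat \<Rightarrow> (real^'n \<Rightarrow> real) \<Rightarrow> bool" where
  "cont_diff 0 f \<longleftrightarrow> continuous_on UNIV f"
| "cont_diff (Suc m) f \<longleftrightarrow>
     (\<forall>x. f differentiable (at x)) \<and> (\<forall>i. cont_diff m (partial_deriv i f))"

definition test_functions :: "(real^'n \<Rightarrow> real) set" where
  "test_functions = {\<phi>. (\<forall>m. cont_diff m \<phi>) \<and> compact (closure {x. \<phi> x \<noteq> 0})}"

definition has_weak_gradient :: "(real^'n \<Rightarrow> real) \<Rightarrow> (real^'n \<Rightarrow> real^'n) \<Rightarrow> bool" where
  "has_weak_gradient v g \<longleftrightarrow>
     locally_integrable v \<and> locally_integrable g \<and>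
     (\<forall>\<phi>\<in>test_functions. \<forall>i.
        (LINT x|lebesgue. v x * partial_deriv i \<phi> x) = - (LINT x|lebesgue. g x $ i * \<phi> x))"

text \<open>The weak gradient is unique up to null sets, so the choice below does not affect the
  integrals formed from it.\<close>

definition weak_gradient :: "(real^'n \<Rightarrow> real) \<Rightarrow> real^'n \<Rightarrow> real^'n" where
  "weak_gradient v = (SOME g. has_weak_gradient v g)"

definition sobolev_energy ::
    "(real^'n \<Rightarrow> real) \<Rightarrow> real \<Rightarrow> (real^'n \<Rightarrow> real) \<Rightarrow> ennreal" where
  "sobolev_energy w p v =
     (\<integral>\<^sup>+x. ennreal ((\<bar>v x\<bar> powr p + norm (weak_gradient v x) powr p) * w x) \<partial>lebesgue)"

definition sobolev ::
    "(real^'n \<Rightarrow> real) \<Rightarrow> real \<Rightarrow> (real^'n \<Rightarrow> real) set" where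
  "sobolev w p = {v. (\<exists>g. has_weak_gradient v g) \<and> sobolev_energy w p v < \<infinity>}"

definition sobolev_norm ::
    "(real^'n \<Rightarrow> real) \<Rightarrow> real \<Rightarrow> (real^'n \<Rightarrow> real) \<Rightarrow> real" where
  "sobolev_norm w p v = enn2real (sobolev_energy w p v) powr (1 / p)"

definition sobolev0 ::
    "(real^'n \<Rightarrow> real) \<Rightarrow> real \<Rightarrow> (real^'n) set \<Rightarrow> (real^'n \<Rightarrow> real) set" where
  "sobolev0 w p \<Omega> = {v \<in> sobolev w p. AE x in lebesgue. x \<notin> \<Omega> \<longrightarrow> v x = 0}"

text \<open>A function on \<open>\<Omega>\<close> is represented by any total function restricting to it; the values
  outside \<open>\<Omega>\<close> are immaterial for the following space and its norm.\<close>

definition Lp_weighted ::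
    "(real^'n \<Rightarrow> real) \<Rightarrow> real \<Rightarrow> (real^'n) set \<Rightarrow> (real^'n \<Rightarrow> real) set" where
  "Lp_weighted w p \<Omega> =
     {v \<in> borel_measurable (lebesgue_on \<Omega>).
        (\<integral>\<^sup>+x\<in>\<Omega>. ennreal (\<bar>v x\<bar> powr p * w x) \<partial>lebesgue) < \<infinity>}"

definition Lp_norm ::
    "(real^'n \<Rightarrow> real) \<Rightarrow> real \<Rightarrow> (real^'n) set \<Rightarrow> (real^'n \<Rightarrow> real) \<Rightarrow> real" where
  "Lp_norm w p \<Omega> v =
     enn2real (\<integral>\<^sup>+x\<in>\<Omega>. ennreal (\<bar>v x\<bar> powr p * w x) \<partial>lebesgue) powr (1 / p)"

text \<open>Elements of the spaces are equivalence classes given by representatives. The clause on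
  vanishing norms says that the bounded linear map induced on classes by \<open>v \<mapsto> v\<close> is injective;
  it is not implied by the inclusion of sets of representatives when \<open>Y\<close> consists of functions
  on a smaller domain.\<close>

definition continuously_embedded ::
    "'a set \<Rightarrow> ('a \<Rightarrow> real) \<Rightarrow> 'a set \<Rightarrow> ('a \<Rightarrow> real) \<Rightarrow> bool" where
  "continuously_embedded X normX Y normY \<longleftrightarrow>
     X \<subseteq> Y \<and> (\<exists>C\<ge>0. \<forall>v\<in>X. normY v \<le> C * normX v) \<and>
     (\<forall>v\<in>X. normY v = 0 \<longrightarrow> normX v = 0)"

end

theory Submission
  imports Defs
begin

text \<open>
  Both embeddings come from inequalities between energies, and an energy inequality
  \<open>E\<^sub>Y v \<le> C * E\<^sub>X v\<close> gives the inequality of norms by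
  taking \<open>p\<close>-th roots.

  \<^emph>\<open>The Sobolev energy controls the fractional energy.\<close> The \<open>A\<^sub>p\<close> condition and Hoelder's
  inequality give \<open>(avg\<^bsub>B\<^esub> f)^p \<le> C / w(B) * \<integral>\<^bsub>B\<^esub> f^p w\<close> for every ball \<open>B\<close>. Taking for \<open>f\<close> the
  indicator of a smaller ball shows that \<open>w\<close> is doubling; integrating the inequality over the
  centre of \<open>B\<close> then shows that averaging over balls of a fixed radius \<open>r\<close> is bounded on the
  weighted \<open>L^p\<close> space, uniformly in \<open>r\<close> (\<open>avg_bounded\<close>). The maximal function is avoided:
  averages at one radius at a time suffice, because the fractional energy can be cut into the
  dyadic annuli \<open>|x - y| \<approx> t\<close>. Doubling gives \<open>\<integral> w(x) / w(B\<^bsub>x,y\<^esub>) dx \<le> C\<close> on every annulus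
  (\<open>kern_annulus_mass\<close>), so an annulus of size \<open>t\<close> contributes at most \<open>C t^(-s p)\<close> times the
  weighted \<open>p\<close>-th power integral of whatever bounds \<open>|v x - v y|\<close> there.
  For \<open>t \<ge> 1\<close> the bound \<open>|v x| + |v y|\<close> is enough. For \<open>t < 1\<close> both values are compared with the
  values on the ball of radius \<open>t / 2\<close> around the midpoint; the mean oscillation of \<open>v\<close> on a ball
  of radius \<open>t\<close> is at most \<open>t\<close> times an average of averages of \<open>|\<nabla>v|\<close> at radii up to \<open>t\<close>
  (\<open>osc_le\<close>), which gains the factor \<open>t^p\<close>. The exponents \<open>p (1 - s)\<close> for small \<open>t\<close> and \<open>- s p\<close>
  for large \<open>t\<close> make both sums geometric series.

  The oscillation bound integrates a gradient along segments. A weakly differentiable \<open>v\<close> is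
  therefore mollified: the difference of two values of a mollification is a segment integral of
  the mollified weak gradient (\<open>mollify_line_dominated\<close>), and the latter is dominated by an
  average of \<open>|\<nabla>v|\<close> over a ball, hence again controlled by \<open>avg_bounded\<close>. Mollifications converge
  almost everywhere by Lebesgue's differentiation theorem, and Fatou's lemma returns to \<open>v\<close>.

  \<^emph>\<open>The fractional energy controls the weighted Lebesgue norm.\<close> Since \<open>\<Omega>\<close> is bounded, there is a ball \<open>E\<close>
  near \<open>\<Omega>\<close> but outside it. For \<open>y\<close> in \<open>E\<close> and \<open>x\<close> in \<open>\<Omega>\<close> one has \<open>|v x - v y| = |v x|\<close> and the kernel
  is at least a constant times \<open>w x * w y\<close>, so this part of the double integral is already at
  least a positive multiple of \<open>\<integral>\<^bsub>\<Omega>\<^esub> |v|^p w\<close> (\<open>fractional_poincare\<close>).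

  \<^emph>\<open>Injectivity.\<close> If the fractional energy vanishes, the last inequality gives \<open>v = 0\<close> almost
  everywhere; then its weak gradient vanishes too, because all mollifications of the gradient do.
\<close>

section \<open>Powers of extended nonnegative reals\<close>

lemma ennreal_powr_ennreal:
  assumes "0 \<le> r"
  shows "ennreal_powr (ennreal r) a = ennreal (r powr a)"
  using assms by (simp add: ennreal_powr_def)

lemma ennreal_powr_top [simp]: "ennreal_powr top a = top"
  by (simp add: ennreal_powr_def)

lemma ennreal_powr_0 [simp]: "ennreal_powr 0 a = 0"
  by (simp add: ennreal_powr_def)

lemma ennreal_powr_mono:
  assumes "0 < a" "s \<le> t"
  shows "ennreal_powr s a \<le> ennreal_powr t a"
  using assms
  by (cases s; cases t)
    (auto simp: ennreal_powr_ennreal top_unique intro!: ennreal_leI powr_mono2)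

lemma ennreal_powr_mult:
  assumes "0 < a"
  shows "ennreal_powr (s * t) a = ennreal_powr s a * ennreal_powr t a"
  using assms
  by (cases s; cases t)
    (auto simp: ennreal_powr_ennreal ennreal_mult[symmetric] powr_mult ennreal_top_mult
      ennreal_mult_top)

lemma ennreal_powr_cmult:
  assumes "0 < a" "0 \<le> c"
  shows "ennreal_powr (ennreal c * t) a = ennreal (c powr a) * ennreal_powr t a"
  using assms by (simp add: ennreal_powr_mult ennreal_powr_ennreal)

lemma ennreal_powr_add_le:
  assumes "0 < a"
  shows "ennreal_powr (s + t) a \<le> ennreal (2 powr a) * (ennreal_powr s a + ennreal_powr t a)"
proof -
  have "s + t \<le> ennreal 2 * max s t"
    using add_mono[of s "max s t" t "max s t"] by (simp add: mult_2)
  hence "ennreal_powr (s + t) a \<le> ennreal (2 powr a) * ennreal_powr (max s t) a"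
    using ennreal_powr_mono[OF assms] ennreal_powr_cmult[OF assms, of 2] by fastforce
  also have "ennreal_powr (max s t) a \<le> ennreal_powr s a + ennreal_powr t a"
    by (simp add: max_def)
  finally show ?thesis by (simp add: mult_left_mono)
qed

lemma measurable_ennreal_powr [measurable]:
  assumes [measurable]: "f \<in> borel_measurable M"
  shows "(\<lambda>x. ennreal_powr (f x) a) \<in> borel_measurable M"
  unfolding ennreal_powr_def by measurable

section \<open>Hoelder's inequality with a weight\<close>

text \<open>The second weight in the \<open>A\<^sub>p\<close> condition: \<open>(dual_weight p w)^(p - 1) * w = 1\<close>.\<close>

definition dual_weight :: "real \<Rightarrow> ('a \<Rightarrow> real) \<Rightarrow> 'a \<Rightarrow> real" where
  "dual_weight p w x = w x powr (1 / (1 - p))"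

text \<open>If \<open>f\<close> exceeds \<open>c * w^(1 / (1 - p))\<close>, then \<open>f^(p - 1) w\<close> exceeds \<open>c^(p - 1)\<close>, so that \<open>f\<close> is at
  most \<open>c^(1 - p) f^p w\<close>; otherwise the first summand dominates. This two-case bound
  replaces Young's inequality: it holds for all \<open>c\<close>, and choosing \<open>c\<close> well after
  integration gives Hoelder's inequality up to the factor \<open>2^p\<close>.\<close>

lemma weighted_young:
  fixes p w c :: real
  assumes p: "1 < p" and w: "0 < w" and c: "0 < c"
  shows "f \<le> ennreal (c * w powr (1 / (1 - p))) + ennreal (c powr (1 - p)) * (ennreal_powr f p *
      ennreal w)"
proof (cases f)
  case (real a)
  let ?s = "w powr (1 / (1 - p))"
  have "a \<le> c * ?s + c powr (1 - p) * (a powr p * w)"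
  proof (cases "a \<le> c * ?s")
    case True
    thus ?thesis using w by (smt (verit) mult_nonneg_nonneg powr_ge_zero)
  next
    case False
    hence a: "c * ?s < a" "0 < c * ?s" using c w by auto
    hence a0: "0 < a" by linarith
    have "(c * ?s) powr (p - 1) \<le> a powr (p - 1)"
      using a p by (intro powr_mono2) auto
    moreover have "(c * ?s) powr (p - 1) = c powr (p - 1) * w powr (-1)"
    proof -
      have "1 / (1 - p) * (p - 1) = -1" using p by (simp add: field_simps)
      thus ?thesis using c w by (simp add: powr_mult powr_powr)
    qed
    ultimately have "c powr (p - 1) / w \<le> a powr (p - 1)"
      using w by (simp add: powr_minus divide_inverse)
    hence "c powr (1 - p) * c powr (p - 1) \<le> c powr (1 - p) * (a powr (p - 1) * w)"
      using w by (intro mult_left_mono) (auto simp: field_simps)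
    moreover have "c powr (1 - p) * c powr (p - 1) = 1"
      using c powr_add[of c "1 - p" "p - 1"] by simp
    ultimately have "1 \<le> c powr (1 - p) * (a powr (p - 1) * w)" by simp
    hence "a * 1 \<le> a * (c powr (1 - p) * (a powr (p - 1) * w))"
      using a0 by (intro mult_left_mono) auto
    also have "\<dots> = c powr (1 - p) * (a powr p * w)"
      using a0 powr_add[of a 1 "p - 1"] by (simp add: algebra_simps)
    finally show ?thesis using a by linarith
  qed
  thus ?thesis
    using real c w
    by (simp add: ennreal_powr_ennreal ennreal_mult[symmetric] ennreal_plus[symmetric] ennreal_leI
        del: ennreal_plus)
next
  case top
  thus ?thesis using c w by (simp add: ennreal_top_mult ennreal_mult_top ennreal_mult_eq_top_iff)
qed

text \<open>The constant \<open>2^p\<close> is not optimal, which is harmless for embeddings. With \<open>I = \<integral> f\<close> and \<open>S\<close> the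
  integral of the dual weight, the choice \<open>c = I / (2 S)\<close> makes the first term of
  \<open>weighted_young\<close> equal to \<open>I / 2\<close>, which is absorbed on the left.\<close>

lemma weighted_hoelder:
  fixes w :: "'a \<Rightarrow> real"
  assumes p: "1 < p" and [measurable]: "w \<in> borel_measurable M" "f \<in> borel_measurable M"
    and w: "\<And>x. 0 < w x"
    and fin: "(\<integral>\<^sup>+x. ennreal (dual_weight p w x) \<partial>M) < \<infinity>"
  shows "ennreal_powr (\<integral>\<^sup>+x. f x \<partial>M) p \<le>
    ennreal (2 powr p) * ennreal_powr (\<integral>\<^sup>+x. ennreal (dual_weight p w x) \<partial>M) (p - 1)
      * (\<integral>\<^sup>+x. ennreal_powr (f x) p * ennreal (w x) \<partial>M)"
proof -
  have [measurable]: "dual_weight p w \<in> borel_measurable M"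
    unfolding dual_weight_def by measurable
  define I where "I = (\<integral>\<^sup>+x. f x \<partial>M)"
  define G where "G = (\<integral>\<^sup>+x. ennreal_powr (f x) p * ennreal (w x) \<partial>M)"
  obtain b where b: "(\<integral>\<^sup>+x. ennreal (dual_weight p w x) \<partial>M) = ennreal b" "0 \<le> b"
    using fin by (metis ennreal_cases infinity_ennreal_def order_less_irrefl)
  have main: "I \<le> ennreal (c * b) + ennreal (c powr (1 - p)) * G" if "0 < c" for c
  proof -
    have "I \<le> (\<integral>\<^sup>+x. ennreal c * ennreal (dual_weight p w x) +
        ennreal (c powr (1 - p)) * (ennreal_powr (f x) p * ennreal (w x)) \<partial>M)"
      unfolding I_def using weighted_young[OF p w that] that
      by (intro nn_integral_mono) (simp add: dual_weight_def ennreal_mult)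
    also have "\<dots> = ennreal c * ennreal b + ennreal (c powr (1 - p)) * G"
      by (simp add: nn_integral_add nn_integral_cmult b G_def)
    finally show ?thesis using that b by (simp add: ennreal_mult)
  qed
  show ?thesis
  proof (cases "b = 0")
    case True
    hence "AE x in M. ennreal (dual_weight p w x) = 0"
      using b True by (subst nn_integral_0_iff_AE[symmetric]) auto
    \<comment> \<open>The dual weight is positive, so it integrates to zero only over a null space.\<close>
    hence "AE x in M. f x = 0"
    proof eventually_elim
      case (elim x)
      hence "w x powr (1 / (1 - p)) \<le> 0" by (simp add: dual_weight_def)
      thus ?case using w[of x] by (simp add: powr_gt_zero[symmetric] del: powr_gt_zero)
    qed
    hence "I = 0" unfolding I_def by (subst nn_integral_0_iff_AE) auto
    thus ?thesis by (simp add: I_def)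
  next
    case False
    hence b0: "0 < b" using b by auto
    show ?thesis
    proof (cases G)
      case top
      thus ?thesis using b b0 p
        by (simp add: G_def[symmetric] ennreal_powr_ennreal ennreal_mult_top)
    next
      case (real g)
      have "I < top" using main[of 1] real b0
        by (simp add: ennreal_mult[symmetric] ennreal_plus[symmetric] le_less_trans
            del: ennreal_plus)
      then obtain a where a: "I = ennreal a" "0 \<le> a"
        by (metis ennreal_cases order_less_irrefl)
      have "a powr p \<le> 2 powr p * b powr (p - 1) * g"
      proof (cases "a = 0")
        case False
        hence a0: "0 < a" using a by auto
        define c where "c = a / (2 * b)"
        have c: "0 < c" using a0 b0 by (simp add: c_def)
        have "ennreal a \<le> ennreal (c * b + c powr (1 - p) * g)"
          using main[OF c] a real c b0
          by (simp add: ennreal_mult[symmetric] ennreal_plus[symmetric] del: ennreal_plus)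
        hence "a \<le> c * b + c powr (1 - p) * g"
          using c b0 real by (subst (asm) ennreal_le_iff) auto
        moreover have "c * b = a / 2" using b0 by (simp add: c_def)
        ultimately have "a / 2 \<le> c powr (1 - p) * g" by simp
        hence "a / 2 * c powr (p - 1) \<le> c powr (1 - p) * g * c powr (p - 1)"
          by (intro mult_right_mono) auto
        also have "\<dots> = g" using c powr_add[of c "1 - p" "p - 1"] by (simp add: field_simps)
        finally have "a / 2 * c powr (p - 1) \<le> g" .
        moreover have "a / 2 * c powr (p - 1) = (a / 2) powr p / b powr (p - 1)"
        proof -
          have "c = (a / 2) / b" by (simp add: c_def)
          hence "c powr (p - 1) = (a / 2) powr (p - 1) / b powr (p - 1)"
            using a0 b0 powr_divide[of "a / 2" b "p - 1"] by (simp only:) 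
          moreover have "(a / 2) powr p = a / 2 * (a / 2) powr (p - 1)"
            using a0 powr_add[of "a / 2" 1 "p - 1"] by simp
          ultimately show ?thesis by (simp only: times_divide_eq_right)
        qed
        ultimately have "(a / 2) powr p / b powr (p - 1) \<le> g" by (simp only:)
        hence "(a / 2) powr p \<le> b powr (p - 1) * g"
          using b0 by (simp add: pos_divide_le_eq mult.commute)
        thus ?thesis using a0 by (simp add: powr_divide field_simps)
      qed (use real in simp)
      thus ?thesis using a real b p
        by (simp add: G_def[symmetric] I_def[symmetric] ennreal_powr_ennreal ennreal_mult[symmetric]
            ennreal_leI)
    qed
  qed
qed

section \<open>Muckenhoupt weights: doubling and averaging\<close>

lemma measurable_indicator_ball [measurable]:
  fixes f h :: "'b \<Rightarrow> 'a::{metric_space, second_countable_topology}"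
  assumes [measurable]: "f \<in> borel_measurable M" "g \<in> borel_measurable M" "h \<in> borel_measurable M"
  shows "(\<lambda>x. indicator (ball (f x) (g x)) (h x) :: ennreal) \<in> borel_measurable M"
proof -
  have "(\<lambda>x. indicator (ball (f x) (g x)) (h x) :: ennreal) =
      (\<lambda>x. if dist (f x) (h x) < g x then 1 else 0)"
    by (auto simp: fun_eq_iff indicator_def)
  thus ?thesis by simp
qed

definition ball_vol :: "nat \<Rightarrow> real \<Rightarrow> real" where
  "ball_vol d r = unit_ball_vol (real d) * r ^ d"

abbreviation "diametral_ball x y \<equiv> ball (midpoint x y) (dist x y / 2)"

text \<open>The \<open>A\<^sub>p\<close> condition for a Borel representative that is positive everywhere, multiplied by the
  \<open>p\<close>-th power of the volume of the ball so that no quotients of possibly infinite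
  quantities occur. The dimension \<open>d\<close> is a parameter so that constants depending on it can be
  defined without mentioning a type.\<close>

locale muckenhoupt =
  fixes w :: "'a::euclidean_space \<Rightarrow> real" and p K :: real and d :: nat
  assumes dim: "d = DIM('a)"
    and p_gt_1: "1 < p"
    and measurable_w [measurable]: "w \<in> borel_measurable borel"
    and w_pos: "\<And>x. 0 < w x"
    and K_nonneg: "0 \<le> K"
    and mass_ball_finite: "\<And>x r. (\<integral>\<^sup>+y\<in>ball x r. ennreal (w y) \<partial>lborel) < \<infinity>"
    and Ap_condition: "\<And>x r. 0 < r \<Longrightarrow>
      (\<integral>\<^sup>+y\<in>ball x r. ennreal (w y) \<partial>lborel) *
      ennreal_powr (\<integral>\<^sup>+y\<in>ball x r. ennreal (dual_weight p w y) \<partial>lborel) (p - 1)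
        \<le> ennreal (K * ball_vol d r powr p)"
begin

abbreviation vol :: "real \<Rightarrow> real" where "vol \<equiv> ball_vol d"

definition mass :: "'a set \<Rightarrow> ennreal" where
  "mass A = (\<integral>\<^sup>+y\<in>A. ennreal (w y) \<partial>lborel)"

abbreviation pw :: "ennreal \<Rightarrow> ennreal" where "pw t \<equiv> ennreal_powr t p"

definition avg :: "real \<Rightarrow> ('a \<Rightarrow> ennreal) \<Rightarrow> 'a \<Rightarrow> ennreal" where
  "avg r f x = ennreal (1 / vol r) * (\<integral>\<^sup>+y\<in>ball x r. f y \<partial>lborel)"

definition doubling_const :: "real \<Rightarrow> real" where
  "doubling_const a = 2 powr p * K * (a ^ d) powr p"

lemma doubling_const_nonneg: "0 \<le> doubling_const a"
  using K_nonneg by (simp add: doubling_const_def)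

lemma p_pos: "0 < p" using p_gt_1 by simp

lemma vol_pos: "0 < r \<Longrightarrow> 0 < vol r"
  by (simp add: ball_vol_def unit_ball_vol_pos)

lemma emeasure_ball_vol: "0 \<le> r \<Longrightarrow> emeasure lborel (ball (x::'a) r) = ennreal (vol r)"
  by (simp add: emeasure_ball ball_vol_def dim)

lemma measurable_mass_ball [measurable]:
  assumes [measurable]: "f \<in> borel_measurable M" "g \<in> borel_measurable M"
  shows "(\<lambda>x. mass (ball (f x) (g x))) \<in> borel_measurable M"
  unfolding mass_def by measurable

lemma measurable_avg [measurable]:
  assumes [measurable]: "f \<in> borel_measurable borel" "g \<in> borel_measurable M" "r \<in> borel_measurable M"
  shows "(\<lambda>x. avg (r x) f (g x)) \<in> borel_measurable M"
  unfolding avg_def ball_vol_def by measurable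

lemma mass_finite: "mass (ball x r) < \<infinity>"
  using mass_ball_finite by (simp add: mass_def)

lemma mass_mono: "A \<subseteq> B \<Longrightarrow> mass A \<le> mass B"
  unfolding mass_def by (intro nn_integral_mono) (auto simp: indicator_def)

lemma mass_pos:
  assumes "0 < r"
  shows "0 < mass (ball x r)"
proof -
  have "mass (ball x r) \<noteq> 0"
  proof
    assume "mass (ball x r) = 0"
    hence "AE y in lborel. ennreal (w y) * indicator (ball x r) y = 0"
      unfolding mass_def by (subst (asm) nn_integral_0_iff_AE) auto
    hence "AE y in lborel. y \<notin> ball x r"
    proof eventually_elim
      case (elim y)
      thus ?case using w_pos[of y] by (auto simp: indicator_def split: if_splits)
    qed
    hence "emeasure lborel (ball x r) = 0"
      by (subst (asm) AE_iff_measurable[of "ball x r"]) auto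
    thus False using vol_pos[OF assms] assms by (simp add: emeasure_ball_vol)
  qed
  thus ?thesis by (simp add: zero_less_iff_neq_zero)
qed

lemma mass_times_inverse:
  assumes "0 < r"
  shows "mass (ball x r) * inverse (mass (ball x r)) = 1"
  using mass_pos[OF assms, of x] mass_finite[of x r]
  by (metis ennreal_divide_self divide_ennreal_def infinity_ennreal_def less_irrefl)

text \<open>Hoelder's inequality on the ball produces the \<open>(p - 1)\<close>-st power of the dual mass, which is
  exactly what the \<open>A\<^sub>p\<close> condition pays for when multiplied by the mass of the ball. Finiteness of
  the dual mass is forced by the same condition, since the mass is positive.\<close>

lemma ball_hoelder:
  assumes r: "0 < r" and [measurable]: "f \<in> borel_measurable borel"
  shows "mass (ball x r) * pw (\<integral>\<^sup>+y\<in>ball x r. f y \<partial>lborel) \<le>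
    ennreal (2 powr p * K * vol r powr p) * (\<integral>\<^sup>+y\<in>ball x r. pw (f y) * ennreal (w y) \<partial>lborel)"
proof -
  let ?M = "restrict_space lborel (ball x r)"
  let ?S = "\<integral>\<^sup>+y\<in>ball x r. ennreal (dual_weight p w y) \<partial>lborel"
  have restr: "(\<integral>\<^sup>+y. g y \<partial>?M) = (\<integral>\<^sup>+y\<in>ball x r. g y \<partial>lborel)" for g
    by (subst nn_integral_restrict_space) auto
  have S: "?S < \<infinity>"
  proof (rule ccontr)
    assume "\<not> ?S < \<infinity>"
    hence "?S = top" by (simp add: not_less top_unique)
    hence "top \<le> ennreal (K * vol r powr p)"
      using Ap_condition[OF r, of x] mass_pos[OF r, of x]
      by (auto simp: mass_def ennreal_mult_top split: if_splits)
    thus False by (simp add: top_unique)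
  qed
  have "w \<in> borel_measurable ?M" "f \<in> borel_measurable ?M"
    by (auto intro!: measurable_restrict_space1)
  hence "pw (\<integral>\<^sup>+y\<in>ball x r. f y \<partial>lborel) \<le> ennreal (2 powr p) * ennreal_powr ?S (p - 1) *
      (\<integral>\<^sup>+y\<in>ball x r. pw (f y) * ennreal (w y) \<partial>lborel)"
    using weighted_hoelder[of p w ?M f] p_gt_1 w_pos S unfolding restr by blast
  hence "mass (ball x r) * pw (\<integral>\<^sup>+y\<in>ball x r. f y \<partial>lborel) \<le>
     mass (ball x r) * (ennreal (2 powr p) * ennreal_powr ?S (p - 1) *
      (\<integral>\<^sup>+y\<in>ball x r. pw (f y) * ennreal (w y) \<partial>lborel))"
    by (rule mult_left_mono) simp
  also have "\<dots> = ennreal (2 powr p) * (mass (ball x r) * ennreal_powr ?S (p - 1)) *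
      (\<integral>\<^sup>+y\<in>ball x r. pw (f y) * ennreal (w y) \<partial>lborel)"
    by (simp add: mult_ac)
  also have "\<dots> \<le> ennreal (2 powr p) * ennreal (K * vol r powr p) *
      (\<integral>\<^sup>+y\<in>ball x r. pw (f y) * ennreal (w y) \<partial>lborel)"
    using Ap_condition[OF r, of x] by (intro mult_right_mono mult_left_mono) (auto simp: mass_def)
  also have "ennreal (2 powr p) * ennreal (K * vol r powr p) = ennreal (2 powr p * K * vol r powr p)"
    using K_nonneg by (simp add: ennreal_mult[symmetric] mult_ac)
  finally show ?thesis .
qed

text \<open>This is \<open>ball_hoelder\<close> for the indicator function of the smaller ball.\<close>

lemma doubling:
  assumes sub: "ball y r' \<subseteq> ball x r" and r': "0 < r'" and r: "0 < r" "r \<le> a * r'"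
  shows "mass (ball x r) \<le> ennreal (doubling_const a) * mass (ball y r')"
proof -
  let ?f = "indicator (ball y r') :: 'a \<Rightarrow> ennreal"
  have "(\<integral>\<^sup>+z\<in>ball x r. ?f z \<partial>lborel) = emeasure lborel (ball y r')"
    using sub by (subst nn_integral_indicator[symmetric])
      (auto intro!: nn_integral_cong simp: indicator_def simp del: nn_integral_indicator)
  hence 1: "(\<integral>\<^sup>+z\<in>ball x r. ?f z \<partial>lborel) = ennreal (vol r')"
    using r' by (simp add: emeasure_ball_vol)
  have "pw 1 = 1" using ennreal_powr_ennreal[of 1 p] by simp
  hence 2: "(\<integral>\<^sup>+z\<in>ball x r. pw (?f z) * ennreal (w z) \<partial>lborel) = mass (ball y r')"
    unfolding mass_def using sub by (intro nn_integral_cong) (auto simp: indicator_def)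
  have "mass (ball x r) * ennreal (vol r' powr p) \<le>
      ennreal (2 powr p * K * vol r powr p) * mass (ball y r')"
    using ball_hoelder[OF r(1), of ?f x] r' vol_pos[OF r']
    unfolding 1 2 by (simp add: ennreal_powr_ennreal)
  hence "mass (ball x r) * ennreal (vol r' powr p) * ennreal (1 / vol r' powr p) \<le>
      ennreal (2 powr p * K * vol r powr p) * mass (ball y r') * ennreal (1 / vol r' powr p)"
    by (rule mult_right_mono) simp
  moreover have "ennreal (vol r' powr p) * ennreal (1 / vol r' powr p) = 1"
    using vol_pos[OF r'] by (simp add: ennreal_mult[symmetric])
  ultimately have "mass (ball x r) \<le>
      ennreal (2 powr p * K * vol r powr p) * ennreal (1 / vol r' powr p) * mass (ball y r')"
    by (simp add: mult_ac)
  also have "ennreal (2 powr p * K * vol r powr p) * ennreal (1 / vol r' powr p) =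
      ennreal (2 powr p * K * (vol r / vol r') powr p)"
    using K_nonneg vol_pos[OF r'] vol_pos[OF r(1)]
    by (simp add: ennreal_mult[symmetric] powr_divide)
  also have "\<dots> \<le> ennreal (doubling_const a)"
  proof -
    have "vol r / vol r' = (r / r') ^ d"
      using less_imp_neq[OF unit_ball_vol_pos[of "real d"]] by (simp add: ball_vol_def power_divide)
    also have "\<dots> \<le> a ^ d" using r r' by (intro power_mono) (auto simp: field_simps)
    finally show ?thesis unfolding doubling_const_def
      using vol_pos[OF r'] vol_pos[OF r(1)] p_pos K_nonneg
      by (intro ennreal_leI mult_left_mono powr_mono2) auto
  qed
  finally show ?thesis by (simp add: mult_right_mono)
qed

lemma inverse_doubling:
  assumes "mass (ball x r) \<le> ennreal c * mass (ball y r')" "0 < r" "0 < r'"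
  shows "inverse (mass (ball y r')) \<le> ennreal c * inverse (mass (ball x r))"
proof -
  have "inverse (mass (ball y r')) = mass (ball x r) * inverse (mass (ball x r)) *
      inverse (mass (ball y r'))"
    using mass_times_inverse[of r x] assms by simp
  also have "\<dots> \<le> ennreal c * mass (ball y r') * inverse (mass (ball x r)) * inverse (mass (ball y r'))"
    using assms by (intro mult_right_mono) auto
  also have "\<dots> = ennreal c * inverse (mass (ball x r)) * (mass (ball y r') * inverse (mass (ball y r')))"
    by (simp add: mult_ac)
  finally show ?thesis using mass_times_inverse[of r' y] assms by simp
qed

lemma pw_avg_le:
  assumes r: "0 < r" and [measurable]: "f \<in> borel_measurable borel"
  shows "pw (avg r f x) \<le>
    ennreal (2 powr p * K) * (\<integral>\<^sup>+y\<in>ball x r. pw (f y) * ennreal (w y) \<partial>lborel) *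
    inverse (mass (ball x r))"
proof -
  let ?I = "\<integral>\<^sup>+y\<in>ball x r. f y \<partial>lborel"
  let ?G = "\<integral>\<^sup>+y\<in>ball x r. pw (f y) * ennreal (w y) \<partial>lborel"
  have "pw (avg r f x) = ennreal ((1 / vol r) powr p) * pw ?I"
    unfolding avg_def using vol_pos[OF r] p_pos by (simp add: ennreal_powr_cmult)
  also have "\<dots> = ennreal ((1 / vol r) powr p) * (mass (ball x r) * inverse (mass (ball x r)) * pw ?I)"
    by (simp add: mass_times_inverse[OF r])
  also have "\<dots> = ennreal ((1 / vol r) powr p) * inverse (mass (ball x r)) * (mass (ball x r) * pw ?I)"
    by (simp add: mult_ac)
  also have "\<dots> \<le> ennreal ((1 / vol r) powr p) * inverse (mass (ball x r)) *
      (ennreal (2 powr p * K * vol r powr p) * ?G)"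
    by (intro mult_left_mono ball_hoelder r) auto
  also have "\<dots> = ennreal ((1 / vol r) powr p) * ennreal (2 powr p * K * vol r powr p) * ?G *
      inverse (mass (ball x r))"
    by (simp add: mult_ac)
  also have "ennreal ((1 / vol r) powr p) * ennreal (2 powr p * K * vol r powr p) =
      ennreal (2 powr p * K)"
    using vol_pos[OF r] K_nonneg by (simp add: ennreal_mult[symmetric] powr_divide)
  finally show ?thesis .
qed

definition avg_const :: real where
  "avg_const = 2 powr p * K * doubling_const 2"

lemma avg_const_nonneg: "0 \<le> avg_const"
  using K_nonneg doubling_const_nonneg by (simp add: avg_const_def)

text \<open>By \<open>pw_avg_le\<close> and Tonelli it suffices that the kernel \<open>w(x) / w(B(x, r))\<close>, integrated over the
  \<open>x\<close> within distance \<open>r\<close> of \<open>y\<close>, is bounded; by doubling \<open>w(B(x, r))\<close> may be replaced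
  by \<open>w(B(y, r))\<close>, and the integral becomes one. The constant does not depend on \<open>r\<close>.\<close>

lemma avg_bounded:
  assumes r: "0 < r" and [measurable]: "f \<in> borel_measurable borel"
  shows "(\<integral>\<^sup>+x. pw (avg r f x) * ennreal (w x) \<partial>lborel) \<le>
    ennreal avg_const * (\<integral>\<^sup>+x. pw (f x) * ennreal (w x) \<partial>lborel)"
proof -
  have kernel: "(\<integral>\<^sup>+x. indicator (ball x r) y * inverse (mass (ball x r)) * ennreal (w x) \<partial>lborel)
      \<le> ennreal (doubling_const 2)" for y
  proof -
    have "indicator (ball x r) y * inverse (mass (ball x r)) * ennreal (w x) \<le>
        ennreal (doubling_const 2) * inverse (mass (ball y r)) * (ennreal (w x) *
        indicator (ball y r) x)" for x
    proof (cases "dist x y < r")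
      case True
      have sub: "ball y r \<subseteq> ball x (2 * r)"
      proof
        fix z assume "z \<in> ball y r"
        thus "z \<in> ball x (2 * r)" using True dist_triangle[of x z y] by simp
      qed
      have "mass (ball y r) \<le> mass (ball x (2 * r))" by (rule mass_mono[OF sub])
      also have "\<dots> \<le> ennreal (doubling_const 2) * mass (ball x r)"
        using r by (intro doubling) (auto intro!: subset_ball)
      finally have "inverse (mass (ball x r)) \<le> ennreal (doubling_const 2) * inverse (mass (ball y r))"
        using r by (intro inverse_doubling) auto
      thus ?thesis using True by (simp add: indicator_def dist_commute mult_right_mono)
    qed (simp add: indicator_def)
    hence "(\<integral>\<^sup>+x. indicator (ball x r) y * inverse (mass (ball x r)) * ennreal (w x) \<partial>lborel)
      \<le> (\<integral>\<^sup>+x. ennreal (doubling_const 2) * inverse (mass (ball y r)) *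
           (ennreal (w x) * indicator (ball y r) x) \<partial>lborel)"
      by (intro nn_integral_mono)
    also have "\<dots> = ennreal (doubling_const 2) * inverse (mass (ball y r)) * mass (ball y r)"
      unfolding mass_def by (subst nn_integral_cmult) auto
    also have "\<dots> = ennreal (doubling_const 2)"
      using mass_times_inverse[OF r, of y] by (simp only: mult.assoc mult.commute[of "inverse _"] mult_1_right)
    finally show ?thesis .
  qed
  have "(\<integral>\<^sup>+x. pw (avg r f x) * ennreal (w x) \<partial>lborel) \<le>
      (\<integral>\<^sup>+x. ennreal (2 powr p * K) * (\<integral>\<^sup>+y. (pw (f y) * ennreal (w y)) *
         (indicator (ball x r) y * inverse (mass (ball x r)) * ennreal (w x)) \<partial>lborel) \<partial>lborel)"
  proof (intro nn_integral_mono)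
    fix x
    have "pw (avg r f x) * ennreal (w x) \<le> ennreal (2 powr p * K) *
        ((\<integral>\<^sup>+y\<in>ball x r. pw (f y) * ennreal (w y) \<partial>lborel) *
        (inverse (mass (ball x r)) * ennreal (w x)))"
      using mult_right_mono[OF pw_avg_le[OF r, of f x], of "ennreal (w x)"] by (simp add: mult_ac)
    also have "(\<integral>\<^sup>+y\<in>ball x r. pw (f y) * ennreal (w y) \<partial>lborel) *
        (inverse (mass (ball x r)) * ennreal (w x)) =
        (\<integral>\<^sup>+y. (pw (f y) * ennreal (w y)) *
         (indicator (ball x r) y * inverse (mass (ball x r)) * ennreal (w x)) \<partial>lborel)"
      by (subst nn_integral_multc[symmetric]) (auto simp: mult_ac)
    finally show "pw (avg r f x) * ennreal (w x) \<le> ennreal (2 powr p * K) * \<dots>" .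
  qed
  also have "\<dots> = ennreal (2 powr p * K) * (\<integral>\<^sup>+x. (\<integral>\<^sup>+y. (pw (f y) * ennreal (w y)) *
         (indicator (ball x r) y * inverse (mass (ball x r)) * ennreal (w x)) \<partial>lborel) \<partial>lborel)"
    by (rule nn_integral_cmult) measurable
  also have "(\<integral>\<^sup>+x. (\<integral>\<^sup>+y. (pw (f y) * ennreal (w y)) *
         (indicator (ball x r) y * inverse (mass (ball x r)) * ennreal (w x)) \<partial>lborel) \<partial>lborel) =
     (\<integral>\<^sup>+y. (\<integral>\<^sup>+x. (pw (f y) * ennreal (w y)) *
         (indicator (ball x r) y * inverse (mass (ball x r)) * ennreal (w x)) \<partial>lborel) \<partial>lborel)"
    by (rule lborel_pair.Fubini') measurable
  also have "\<dots> \<le> (\<integral>\<^sup>+y. ennreal (doubling_const 2) * (pw (f y) * ennreal (w y)) \<partial>lborel)"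
  proof (intro nn_integral_mono)
    fix y
    have "(\<integral>\<^sup>+x. (pw (f y) * ennreal (w y)) *
         (indicator (ball x r) y * inverse (mass (ball x r)) * ennreal (w x)) \<partial>lborel) =
      (pw (f y) * ennreal (w y)) *
         (\<integral>\<^sup>+x. indicator (ball x r) y * inverse (mass (ball x r)) * ennreal (w x) \<partial>lborel)"
      by (rule nn_integral_cmult) measurable
    also have "\<dots> \<le> (pw (f y) * ennreal (w y)) * ennreal (doubling_const 2)"
      by (rule mult_left_mono[OF kernel]) simp
    finally show "(\<integral>\<^sup>+x. (pw (f y) * ennreal (w y)) *
         (indicator (ball x r) y * inverse (mass (ball x r)) * ennreal (w x)) \<partial>lborel) \<le>
      ennreal (doubling_const 2) * (pw (f y) * ennreal (w y))" by (simp add: mult.commute)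
  qed
  also have "\<dots> = ennreal (doubling_const 2) * (\<integral>\<^sup>+y. pw (f y) * ennreal (w y) \<partial>lborel)"
    by (rule nn_integral_cmult) measurable
  finally show ?thesis
    using K_nonneg doubling_const_nonneg
    by (simp add: avg_const_def ennreal_mult mult_left_mono mult.assoc)
qed

end


section \<open>Mean oscillation on balls\<close>

text \<open>What remains of ``\<open>f\<close> bounds the gradient of \<open>u\<close>'' once only increments along segments matter.
  The parameter zero is excluded because dilation by it is degenerate.\<close>

definition line_dominated :: "('a::euclidean_space \<Rightarrow> real) \<Rightarrow> ('a \<Rightarrow> ennreal) \<Rightarrow> bool" where
  "line_dominated u f \<longleftrightarrow> (\<forall>x z. ennreal \<bar>u x - u z\<bar> \<le>
     ennreal (dist x z) * (\<integral>\<^sup>+c\<in>{0<..1}. f (x + c *\<^sub>R (z - x)) \<partial>lborel))"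

context muckenhoupt
begin

definition osc :: "real \<Rightarrow> ('a \<Rightarrow> real) \<Rightarrow> 'a \<Rightarrow> ennreal" where
  "osc t u x = avg t (\<lambda>z. ennreal \<bar>u x - u z\<bar>) x"

lemma measurable_osc [measurable]:
  assumes [measurable]: "u \<in> borel_measurable borel"
  shows "osc t u \<in> borel_measurable borel"
  unfolding osc_def avg_def by measurable

text \<open>The dilation about \<open>x\<close> with factor \<open>c\<close> maps the ball of radius \<open>t\<close> onto the ball of radius \<open>c t\<close>
  and multiplies volumes by \<open>c^d\<close>.\<close>

lemma avg_dilate:
  assumes t: "0 < t" and c: "0 < c" and [measurable]: "f \<in> borel_measurable borel"
  shows "ennreal (1 / vol t) * (\<integral>\<^sup>+z\<in>ball x t. f (x + c *\<^sub>R (z - x)) \<partial>lborel) = avg (c * t) f x"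
proof -
  let ?T = "\<lambda>z. (x - c *\<^sub>R x) + c *\<^sub>R z"
  have ind: "indicator (ball x (c * t)) (?T z) = (indicator (ball x t) z :: ennreal)" for z
  proof -
    have "x - ?T z = c *\<^sub>R (x - z)" by (simp add: algebra_simps)
    hence "dist x (?T z) = c * dist x z"
      using c by (simp add: dist_norm)
    thus ?thesis using c by (simp add: indicator_def)
  qed
  have "(\<integral>\<^sup>+y\<in>ball x (c * t). f y \<partial>lborel) =
      (\<integral>\<^sup>+y\<in>ball x (c * t). f y \<partial>density (distr lborel borel ?T) (\<lambda>_. ennreal (\<bar>c\<bar> ^ DIM('a))))"
    using lborel_affine[of c "x - c *\<^sub>R x"] c by simp
  also have "\<dots> = (\<integral>\<^sup>+z. ennreal (c ^ d) * (f (?T z) * indicator (ball x (c * t)) (?T z)) \<partial>lborel)"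
    using c by (simp add: nn_integral_density nn_integral_distr dim)
  also have "\<dots> = ennreal (c ^ d) * (\<integral>\<^sup>+z\<in>ball x t. f (x + c *\<^sub>R (z - x)) \<partial>lborel)"
    unfolding ind by (subst nn_integral_cmult) (auto simp: algebra_simps intro!: nn_integral_cong)
  finally have "avg (c * t) f x = ennreal (1 / vol (c * t)) * ennreal (c ^ d) *
      (\<integral>\<^sup>+z\<in>ball x t. f (x + c *\<^sub>R (z - x)) \<partial>lborel)"
    by (simp add: avg_def mult.assoc)
  also have "ennreal (1 / vol (c * t)) * ennreal (c ^ d) = ennreal (1 / vol t)"
    using c t vol_pos[of "c * t"] by (simp add: ennreal_mult[symmetric] ball_vol_def power_mult_distrib)
  finally show ?thesis by simp
qed

text \<open>Integrating the segment bound over the end point \<open>z\<close> and exchanging the integrals, the inner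
  integral for a fixed parameter \<open>c\<close> is an average of \<open>f\<close> over the ball of radius \<open>c t\<close>.\<close>

lemma osc_le:
  assumes t: "0 < t" and [measurable]: "f \<in> borel_measurable borel" and dom: "line_dominated u f"
  shows "osc t u x \<le> ennreal t * (\<integral>\<^sup>+c\<in>{0<..1}. avg (c * t) f x \<partial>lborel)"
proof -
  have "(\<integral>\<^sup>+z\<in>ball x t. ennreal \<bar>u x - u z\<bar> \<partial>lborel) \<le>
      (\<integral>\<^sup>+z. ennreal t * (\<integral>\<^sup>+c. (f (x + c *\<^sub>R (z - x)) * indicator {0<..1} c) *
      indicator (ball x t) z \<partial>lborel) \<partial>lborel)"
  proof (intro nn_integral_mono)
    fix z
    have "ennreal \<bar>u x - u z\<bar> \<le> ennreal t * (\<integral>\<^sup>+c\<in>{0<..1}. f (x + c *\<^sub>R (z - x)) \<partial>lborel)"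
      if "z \<in> ball x t"
    proof -
      have "ennreal (dist x z) \<le> ennreal t" using that by (intro ennreal_leI) simp
      thus ?thesis using dom unfolding line_dominated_def by (meson mult_right_mono order_trans zero_le)
    qed
    thus "ennreal \<bar>u x - u z\<bar> * indicator (ball x t) z \<le>
       ennreal t * (\<integral>\<^sup>+c. (f (x + c *\<^sub>R (z - x)) * indicator {0<..1} c) *
       indicator (ball x t) z \<partial>lborel)"
      by (cases "z \<in> ball x t") auto
  qed
  also have "\<dots> = ennreal t * (\<integral>\<^sup>+z. (\<integral>\<^sup>+c. (f (x + c *\<^sub>R (z - x)) * indicator {0<..1} c) *
      indicator (ball x t) z \<partial>lborel) \<partial>lborel)"
    by (rule nn_integral_cmult) measurable
  also have "(\<integral>\<^sup>+z. (\<integral>\<^sup>+c. (f (x + c *\<^sub>R (z - x)) * indicator {0<..1} c) *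
      indicator (ball x t) z \<partial>lborel) \<partial>lborel)
    = (\<integral>\<^sup>+c. (\<integral>\<^sup>+z. (f (x + c *\<^sub>R (z - x)) * indicator {0<..1} c) *
    indicator (ball x t) z \<partial>lborel) \<partial>lborel)"
    by (rule lborel_pair.Fubini') measurable
  finally have "osc t u x \<le> ennreal (1 / vol t) * (ennreal t *
      (\<integral>\<^sup>+c. (\<integral>\<^sup>+z. (f (x + c *\<^sub>R (z - x)) * indicator {0<..1} c) *
      indicator (ball x t) z \<partial>lborel) \<partial>lborel))"
    unfolding osc_def avg_def by (rule mult_left_mono) simp
  also have "\<dots> = ennreal t * (\<integral>\<^sup>+c. ennreal (1 / vol t) *
      (\<integral>\<^sup>+z. (f (x + c *\<^sub>R (z - x)) * indicator {0<..1} c) * indicator (ball x t) z \<partial>lborel) \<partial>lborel)"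
    by (subst nn_integral_cmult) (auto simp: mult_ac)
  also have "(\<integral>\<^sup>+c. ennreal (1 / vol t) *
      (\<integral>\<^sup>+z. (f (x + c *\<^sub>R (z - x)) * indicator {0<..1} c) * indicator (ball x t) z \<partial>lborel) \<partial>lborel)
      = (\<integral>\<^sup>+c\<in>{0<..1}. avg (c * t) f x \<partial>lborel)"
  proof (intro nn_integral_cong)
    fix c :: real
    show "ennreal (1 / vol t) *
      (\<integral>\<^sup>+z. (f (x + c *\<^sub>R (z - x)) * indicator {0<..1} c) * indicator (ball x t) z \<partial>lborel)
      = avg (c * t) f x * indicator {0<..1} c"
      using avg_dilate[OF t, of c f x] by (cases "c \<in> {0<..1}") auto
  qed
  finally show ?thesis .
qed

text \<open>A form of Jensen's inequality, obtained as the unweighted case of \<open>weighted_hoelder\<close>.\<close>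

lemma pw_unit_interval_le:
  assumes [measurable]: "g \<in> borel_measurable borel"
  shows "pw (\<integral>\<^sup>+c\<in>{0<..1::real}. g c \<partial>lborel) \<le> ennreal (2 powr p) * (\<integral>\<^sup>+c\<in>{0<..1}. pw (g c) \<partial>lborel)"
proof -
  let ?M = "restrict_space lborel {0<..1::real}"
  have restr: "(\<integral>\<^sup>+c. h c \<partial>?M) = (\<integral>\<^sup>+c\<in>{0<..1}. h c \<partial>lborel)" for h :: "real \<Rightarrow> ennreal"
    by (subst nn_integral_restrict_space) auto
  have dual: "dual_weight p (\<lambda>_. 1) = (\<lambda>_::real. 1)"
    by (simp add: dual_weight_def fun_eq_iff)
  have one: "(\<integral>\<^sup>+c. ennreal (dual_weight p (\<lambda>_. 1) c) \<partial>?M) = 1"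
    unfolding dual restr by (simp add: nn_integral_indicator)
  have "g \<in> borel_measurable ?M" by (auto intro!: measurable_restrict_space1)
  from weighted_hoelder[OF p_gt_1 _ this, of "\<lambda>_. 1"]
  have "pw (\<integral>\<^sup>+c. g c \<partial>?M) \<le> ennreal (2 powr p) * ennreal_powr 1 (p - 1) * (\<integral>\<^sup>+c. pw (g c) \<partial>?M)"
    unfolding one by simp
  thus ?thesis unfolding restr using ennreal_powr_ennreal[of 1 "p - 1"] by simp
qed

definition osc_const :: real where "osc_const = 2 powr p * avg_const"

lemma osc_const_nonneg: "0 \<le> osc_const"
  using avg_const_nonneg by (simp add: osc_const_def)

text \<open>The factor \<open>t^p\<close> is the point: it outweighs the singularity \<open>t^(-s p)\<close> of the fractional energy.
  The radii \<open>c t\<close> vary, so uniformity of \<open>avg_bounded\<close> in the radius is essential.\<close>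

lemma osc_bounded:
  assumes t: "0 < t" and [measurable]: "u \<in> borel_measurable borel" "f \<in> borel_measurable borel"
    and dom: "line_dominated u f"
  shows "(\<integral>\<^sup>+x. pw (osc t u x) * ennreal (w x) \<partial>lborel) \<le>
    ennreal (osc_const * t powr p) * (\<integral>\<^sup>+x. pw (f x) * ennreal (w x) \<partial>lborel)"
proof -
  have [measurable]: "(\<lambda>(x, c). avg (c * t) f x) \<in> borel_measurable (lborel \<Otimes>\<^sub>M lborel)"
    by measurable
  have "(\<integral>\<^sup>+x. pw (osc t u x) * ennreal (w x) \<partial>lborel) \<le>
      (\<integral>\<^sup>+x. ennreal (2 powr p * t powr p) *
        (\<integral>\<^sup>+c. pw (avg (c * t) f x) * indicator {0<..1} c * ennreal (w x) \<partial>lborel) \<partial>lborel)"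
  proof (intro nn_integral_mono)
    fix x
    have "pw (osc t u x) \<le> pw (ennreal t * (\<integral>\<^sup>+c\<in>{0<..1}. avg (c * t) f x \<partial>lborel))"
      using osc_le[OF t _ dom] p_pos by (intro ennreal_powr_mono) auto
    also have "\<dots> = ennreal (t powr p) * pw (\<integral>\<^sup>+c\<in>{0<..1}. avg (c * t) f x \<partial>lborel)"
      using t p_pos by (simp add: ennreal_powr_cmult)
    also have "\<dots> \<le> ennreal (t powr p) *
        (ennreal (2 powr p) * (\<integral>\<^sup>+c\<in>{0<..1}. pw (avg (c * t) f x) \<partial>lborel))"
      by (intro mult_left_mono pw_unit_interval_le) auto
    also have "\<dots> = ennreal (2 powr p * t powr p) * (\<integral>\<^sup>+c\<in>{0<..1}. pw (avg (c * t) f x) \<partial>lborel)"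
      by (simp add: ennreal_mult mult_ac)
    finally have "pw (osc t u x) * ennreal (w x) \<le> \<dots> * ennreal (w x)"
      by (rule mult_right_mono) simp
    also have "\<dots> = ennreal (2 powr p * t powr p) *
        (\<integral>\<^sup>+c. pw (avg (c * t) f x) * indicator {0<..1} c * ennreal (w x) \<partial>lborel)"
      by (subst nn_integral_multc) (auto simp: mult_ac)
    finally show "pw (osc t u x) * ennreal (w x) \<le> \<dots>" .
  qed
  also have "\<dots> = ennreal (2 powr p * t powr p) * (\<integral>\<^sup>+x.
        (\<integral>\<^sup>+c. pw (avg (c * t) f x) * indicator {0<..1} c * ennreal (w x) \<partial>lborel) \<partial>lborel)"
    by (rule nn_integral_cmult) measurable
  also have "(\<integral>\<^sup>+x. (\<integral>\<^sup>+c. pw (avg (c * t) f x) * indicator {0<..1} c * ennreal (w x) \<partial>lborel) \<partial>lborel) =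
      (\<integral>\<^sup>+c. (\<integral>\<^sup>+x. pw (avg (c * t) f x) * indicator {0<..1} c * ennreal (w x) \<partial>lborel) \<partial>lborel)"
    by (rule lborel_pair.Fubini') measurable
  also have "\<dots> \<le> (\<integral>\<^sup>+c. ennreal avg_const * (\<integral>\<^sup>+x. pw (f x) * ennreal (w x) \<partial>lborel) *
      indicator {0<..1::real} c \<partial>lborel)"
  proof (intro nn_integral_mono)
    fix c :: real
    show "(\<integral>\<^sup>+x. pw (avg (c * t) f x) * indicator {0<..1} c * ennreal (w x) \<partial>lborel) \<le>
      ennreal avg_const * (\<integral>\<^sup>+x. pw (f x) * ennreal (w x) \<partial>lborel) * indicator {0<..1::real} c"
      using avg_bounded[of "c * t" f] t by (cases "c \<in> {0<..1}") auto
  qed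
  also have "\<dots> = ennreal avg_const * (\<integral>\<^sup>+x. pw (f x) * ennreal (w x) \<partial>lborel)"
    by (subst nn_integral_cmult) (auto simp: nn_integral_indicator)
  finally show ?thesis using avg_const_nonneg
    by (simp add: osc_const_def ennreal_mult mult_right_mono mult_ac)
qed

text \<open>Both \<open>x\<close> and \<open>y\<close> see the ball of radius \<open>t / 2\<close> around their midpoint inside their own ball of
  radius \<open>t\<close>; inserting its points \<open>z\<close> and averaging over them costs the volume ratio \<open>2^d\<close>.\<close>

lemma difference_le_osc:
  assumes t: "dist x y < t" and [measurable]: "u \<in> borel_measurable borel"
  shows "ennreal \<bar>u x - u y\<bar> \<le> ennreal (2 ^ d) * (osc t u x + osc t u y)"
proof -
  have t0: "0 < t" using t zero_le_dist[of x y] by linarith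
  let ?m = "midpoint x y"
  \<comment> \<open>A point of the small ball is within \<open>t / 2 + t / 2\<close> of \<open>x\<close> and of \<open>y\<close>.\<close>
  have dm: "dist ?m x \<le> t / 2" "dist ?m y \<le> t / 2" using t by (auto simp: dist_midpoint)
  have sub: "ball ?m (t / 2) \<subseteq> ball x t" "ball ?m (t / 2) \<subseteq> ball y t"
  proof -
    have "dist a z < t" if "z \<in> ball ?m (t / 2)" "dist ?m a \<le> t / 2" for a z
      using that dist_triangle[of a z ?m] by (simp add: dist_commute)
    thus "ball ?m (t / 2) \<subseteq> ball x t" "ball ?m (t / 2) \<subseteq> ball y t" using dm by auto
  qed
  have "ennreal \<bar>u x - u y\<bar> * ennreal (vol (t / 2)) =
      (\<integral>\<^sup>+z\<in>ball ?m (t / 2). ennreal \<bar>u x - u y\<bar> \<partial>lborel)"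
    using t0 by (simp add: nn_integral_cmult_indicator emeasure_ball_vol)
  also have "\<dots> \<le> (\<integral>\<^sup>+z. ennreal \<bar>u x - u z\<bar> * indicator (ball x t) z + ennreal \<bar>u y - u z\<bar> *
      indicator (ball y t) z \<partial>lborel)"
  proof (intro nn_integral_mono)
    fix z
    show "ennreal \<bar>u x - u y\<bar> * indicator (ball ?m (t / 2)) z \<le>
      ennreal \<bar>u x - u z\<bar> * indicator (ball x t) z + ennreal \<bar>u y - u z\<bar> * indicator (ball y t) z"
    proof (cases "z \<in> ball ?m (t / 2)")
      case True
      hence "z \<in> ball x t" "z \<in> ball y t" using sub by auto
      moreover have "\<bar>u x - u y\<bar> \<le> \<bar>u x - u z\<bar> + \<bar>u y - u z\<bar>" by linarith
      ultimately show ?thesis using True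
        by (simp add: ennreal_plus[symmetric] ennreal_leI del: ennreal_plus mem_ball)
    qed simp
  qed
  also have "\<dots> = (\<integral>\<^sup>+z\<in>ball x t. ennreal \<bar>u x - u z\<bar> \<partial>lborel) +
      (\<integral>\<^sup>+z\<in>ball y t. ennreal \<bar>u y - u z\<bar> \<partial>lborel)"
    by (rule nn_integral_add) measurable
  finally have "ennreal \<bar>u x - u y\<bar> * ennreal (vol (t / 2)) * ennreal (1 / vol (t / 2)) \<le>
      ((\<integral>\<^sup>+z\<in>ball x t. ennreal \<bar>u x - u z\<bar> \<partial>lborel) +
      (\<integral>\<^sup>+z\<in>ball y t. ennreal \<bar>u y - u z\<bar> \<partial>lborel)) * ennreal (1 / vol (t / 2))"
    by (rule mult_right_mono) simp
  moreover have "ennreal (vol (t / 2)) * ennreal (1 / vol (t / 2)) = 1"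
    using vol_pos[of "t / 2"] t0 by (simp add: ennreal_mult[symmetric])
  ultimately have "ennreal \<bar>u x - u y\<bar> \<le>
      ((\<integral>\<^sup>+z\<in>ball x t. ennreal \<bar>u x - u z\<bar> \<partial>lborel) +
      (\<integral>\<^sup>+z\<in>ball y t. ennreal \<bar>u y - u z\<bar> \<partial>lborel)) * ennreal (1 / vol (t / 2))"
    by (simp only: mult.assoc mult_1_right)
  also have "ennreal (1 / vol (t / 2)) = ennreal (2 ^ d) * ennreal (1 / vol t)"
    using t0 by (simp add: ennreal_mult[symmetric] ball_vol_def power_divide)
  finally show ?thesis unfolding osc_def avg_def
    by (simp only: distrib_left distrib_right mult.assoc mult.left_commute mult.commute)
qed

subsection \<open>The kernel on dyadic annuli\<close>

definition kern :: "'a \<Rightarrow> 'a \<Rightarrow> ennreal" where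
  "kern x y = ennreal (w x) * ennreal (w y) * inverse (mass (diametral_ball x y))"

text \<open>Half-open, so that the annuli with dyadic \<open>t\<close> partition the pairs of distinct points.\<close>

definition annulus :: "real \<Rightarrow> 'a \<Rightarrow> 'a \<Rightarrow> ennreal" where
  "annulus t x y = indicator {t / 2..<t} (dist x y)"

lemma measurable_kern [measurable]:
  assumes [measurable]: "f \<in> borel_measurable M" "g \<in> borel_measurable M"
  shows "(\<lambda>x. kern (f x) (g x)) \<in> borel_measurable M"
  unfolding kern_def midpoint_def by measurable

lemma measurable_annulus [measurable]:
  assumes [measurable]: "f \<in> borel_measurable M" "g \<in> borel_measurable M"
  shows "(\<lambda>x. annulus t (f x) (g x)) \<in> borel_measurable M"
  unfolding annulus_def by measurable

lemma kern_commute: "kern x y = kern y x"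
  unfolding kern_def by (simp add: midpoint_sym dist_commute mult.commute)

lemma annulus_commute: "annulus t x y = annulus t y x"
  by (simp add: annulus_def dist_commute)

text \<open>On the annulus the ball with diameter \<open>x y\<close> has radius at least \<open>t / 4\<close> and lies in \<open>B(y, t)\<close>, so
  doubling replaces its mass by that of \<open>B(y, t)\<close>, after which the integral is trivial.\<close>

lemma kern_annulus_mass:
  assumes t: "0 < t"
  shows "(\<integral>\<^sup>+x. annulus t x y * kern x y \<partial>lborel) \<le> ennreal (doubling_const 4 * w y)"
proof -
  have "annulus t x y * kern x y \<le> ennreal (doubling_const 4 * w y) * inverse (mass (ball y t)) *
      (ennreal (w x) * indicator (ball y t) x)" for x
  proof (cases "dist x y \<in> {t / 2..<t}")
    case True
    have sub: "diametral_ball x y \<subseteq> ball y t"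
    proof
      fix z assume "z \<in> diametral_ball x y"
      thus "z \<in> ball y t" using True dist_triangle[of y z "midpoint x y"]
        by (simp add: dist_midpoint dist_commute)
    qed
    have "mass (ball y t) \<le> ennreal (doubling_const 4) * mass (diametral_ball x y)"
      using True t by (intro doubling[OF sub]) auto
    hence "inverse (mass (diametral_ball x y)) \<le> ennreal (doubling_const 4) * inverse (mass (ball y t))"
      using True t by (intro inverse_doubling) auto
    hence "ennreal (w x) * ennreal (w y) * inverse (mass (diametral_ball x y)) \<le>
       ennreal (w x) * ennreal (w y) * (ennreal (doubling_const 4) * inverse (mass (ball y t)))"
      by (rule mult_left_mono) simp
    thus ?thesis using True w_pos[of y] doubling_const_nonneg
      by (simp add: annulus_def kern_def dist_commute ennreal_mult mult_ac)
  qed (simp add: annulus_def)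
  hence "(\<integral>\<^sup>+x. annulus t x y * kern x y \<partial>lborel) \<le> (\<integral>\<^sup>+x. ennreal (doubling_const 4 * w y) *
      inverse (mass (ball y t)) * (ennreal (w x) * indicator (ball y t) x) \<partial>lborel)"
    by (rule nn_integral_mono)
  also have "\<dots> = ennreal (doubling_const 4 * w y) * (mass (ball y t) * inverse (mass (ball y t)))"
    unfolding mass_def by (subst nn_integral_cmult) (auto simp: mult_ac)
  finally show ?thesis by (simp add: mass_times_inverse[OF t])
qed

text \<open>The kernel and the annulus are symmetric, so the term with \<open>h x\<close> reduces to the one with \<open>h y\<close>.\<close>

lemma kern_annulus_integral:
  assumes t: "0 < t" and [measurable]: "h \<in> borel_measurable borel"
  shows "(\<integral>\<^sup>+y. \<integral>\<^sup>+x. annulus t x y * kern x y * (h x + h y) \<partial>lborel \<partial>lborel) \<le>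
    ennreal (2 * doubling_const 4) * (\<integral>\<^sup>+x. h x * ennreal (w x) \<partial>lborel)"
proof -
  let ?H = "\<integral>\<^sup>+x. h x * ennreal (w x) \<partial>lborel"
  have 1: "(\<integral>\<^sup>+y. \<integral>\<^sup>+x. annulus t x y * kern x y * h y \<partial>lborel \<partial>lborel) \<le>
      ennreal (doubling_const 4) * ?H"
  proof -
    have "(\<integral>\<^sup>+y. \<integral>\<^sup>+x. annulus t x y * kern x y * h y \<partial>lborel \<partial>lborel) \<le>
        (\<integral>\<^sup>+y. ennreal (doubling_const 4) * (h y * ennreal (w y)) \<partial>lborel)"
    proof (intro nn_integral_mono)
      fix y
      have "(\<integral>\<^sup>+x. annulus t x y * kern x y * h y \<partial>lborel) = (\<integral>\<^sup>+x. annulus t x y *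
          kern x y \<partial>lborel) * h y"
        by (rule nn_integral_multc) measurable
      also have "\<dots> \<le> ennreal (doubling_const 4 * w y) * h y"
        by (rule mult_right_mono[OF kern_annulus_mass[OF t]]) simp
      finally show "(\<integral>\<^sup>+x. annulus t x y * kern x y * h y \<partial>lborel) \<le>
          ennreal (doubling_const 4) * (h y * ennreal (w y))"
        using doubling_const_nonneg w_pos[of y] by (simp add: ennreal_mult mult_ac)
    qed
    also have "\<dots> = ennreal (doubling_const 4) * ?H" by (rule nn_integral_cmult) measurable
    finally show ?thesis .
  qed
  have "(\<integral>\<^sup>+y. \<integral>\<^sup>+x. annulus t x y * kern x y * h x \<partial>lborel \<partial>lborel) =
      (\<integral>\<^sup>+x. \<integral>\<^sup>+y. annulus t x y * kern x y * h x \<partial>lborel \<partial>lborel)"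
    by (rule lborel_pair.Fubini') measurable
  also have "\<dots> = (\<integral>\<^sup>+y. \<integral>\<^sup>+x. annulus t x y * kern x y * h y \<partial>lborel \<partial>lborel)"
    by (simp only: kern_commute annulus_commute)
  finally have 2: "(\<integral>\<^sup>+y. \<integral>\<^sup>+x. annulus t x y * kern x y * h x \<partial>lborel \<partial>lborel) \<le>
      ennreal (doubling_const 4) * ?H"
    using 1 by simp
  have "(\<integral>\<^sup>+y. \<integral>\<^sup>+x. annulus t x y * kern x y * (h x + h y) \<partial>lborel \<partial>lborel) =
    (\<integral>\<^sup>+y. \<integral>\<^sup>+x. annulus t x y * kern x y * h x \<partial>lborel \<partial>lborel) +
    (\<integral>\<^sup>+y. \<integral>\<^sup>+x. annulus t x y * kern x y * h y \<partial>lborel \<partial>lborel)"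
    by (simp add: distrib_left nn_integral_add)
  also have "\<dots> \<le> ennreal (doubling_const 4) * ?H + ennreal (doubling_const 4) * ?H"
    by (intro add_mono 1 2)
  also have "\<dots> = ennreal (2 * doubling_const 4) * ?H"
  proof -
    have "ennreal (2 * doubling_const 4) = ennreal (doubling_const 4) + ennreal (doubling_const 4)"
      using doubling_const_nonneg[of 4] by (simp add: ennreal_plus[symmetric] del: ennreal_plus)
    thus ?thesis by (simp only: distrib_right)
  qed
  finally show ?thesis .
qed

end


section \<open>Fractional energies as sums over dyadic scales\<close>

definition diff_quotient :: "real \<Rightarrow> real \<Rightarrow> ('a::real_normed_vector \<Rightarrow> real) \<Rightarrow> 'a \<Rightarrow> 'a \<Rightarrow> ennreal" where
  "diff_quotient s p u x y = ennreal ((\<bar>u x - u y\<bar> / norm (x - y) powr s) powr p)"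

lemma diff_quotient_le:
  assumes "0 < c" "c \<le> dist x y" "0 < s" "0 < p"
  shows "diff_quotient s p u x y \<le> ennreal (c powr (- (s * p))) * ennreal_powr (ennreal \<bar>u x - u y\<bar>) p"
proof -
  have d: "0 < dist x y" using assms by linarith
  have "(\<bar>u x - u y\<bar> / norm (x - y) powr s) powr p = \<bar>u x - u y\<bar> powr p / dist x y powr (s * p)"
    by (simp add: powr_divide powr_powr dist_norm)
  also have "\<dots> \<le> \<bar>u x - u y\<bar> powr p / c powr (s * p)"
    using assms d by (intro divide_left_mono powr_mono2 mult_pos_pos) auto
  also have "\<dots> = c powr (- (s * p)) * \<bar>u x - u y\<bar> powr p"
    by (simp add: powr_minus divide_inverse)
  finally show ?thesis
    by (simp add: diff_quotient_def ennreal_powr_ennreal ennreal_mult[symmetric] ennreal_leI)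
qed

lemma measurable_diff_quotient [measurable]:
  fixes f g :: "'b \<Rightarrow> 'a::euclidean_space"
  assumes [measurable]: "u \<in> borel_measurable borel" "f \<in> borel_measurable M" "g \<in> borel_measurable M"
  shows "(\<lambda>x. diff_quotient s p u (f x) (g x)) \<in> borel_measurable M"
  unfolding diff_quotient_def by measurable

lemma le_suminf_ennreal: "f j \<le> (\<Sum>i. f i :: ennreal)"
  using sum_le_suminf[of f "{j}"] by simp

lemma dyadic_scale_small:
  fixes r :: real
  assumes "0 < r" "r < 1"
  obtains j :: nat where "r \<in> {(1/2) ^ j / 2..<(1/2) ^ j}"
proof -
  obtain m :: nat where m: "(1/2) ^ m < r" using assms real_arch_pow_inv[of r "1/2"] by auto
  define j where "j = (LEAST i. (1/2::real) ^ Suc i \<le> r)"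
  have ex: "(1/2::real) ^ Suc m \<le> r" using m assms by simp
  have 1: "(1/2::real) ^ Suc j \<le> r" unfolding j_def by (rule LeastI[of _ m]) (rule ex)
  have 2: "r < (1/2) ^ j"
  proof (cases j)
    case (Suc i)
    hence "\<not> (1/2::real) ^ Suc i \<le> r" unfolding j_def by (metis lessI not_less_Least)
    thus ?thesis using Suc by simp
  qed (use assms in simp)
  show ?thesis using 1 2 by (intro that[of j]) auto
qed

lemma dyadic_scale_large:
  fixes r :: real
  assumes "1 \<le> r"
  obtains j :: nat where "r \<in> {2 ^ Suc j / 2..<2 ^ Suc j}"
proof -
  obtain m :: nat where m: "r < 2 ^ m" using real_arch_pow[of 2 r] by auto
  define j where "j = (LEAST i. r < 2 ^ Suc i)"
  have ex: "r < 2 ^ Suc m" using m assms by simp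
  have 1: "r < 2 ^ Suc j" unfolding j_def by (rule LeastI[of _ m]) (rule ex)
  have 2: "2 ^ j \<le> r"
  proof (cases j)
    case (Suc i)
    hence "\<not> r < 2 ^ Suc i" unfolding j_def by (metis lessI not_less_Least)
    thus ?thesis using Suc by simp
  qed (use assms in simp)
  show ?thesis using 1 2 by (intro that[of j]) auto
qed

context muckenhoupt
begin

text \<open>The common mechanism of the small and the large scales: on the \<open>j\<close>-th annulus the integrand is at
  most \<open>c j * kern x y * (h j x + h j y)\<close>, and the products of \<open>c j\<close> with the bound \<open>b j\<close> for the
  weighted integral of \<open>h j\<close> decay geometrically.\<close>

lemma sum_over_scales:
  fixes h :: "nat \<Rightarrow> 'a \<Rightarrow> ennreal" and \<Phi> :: "'a \<Rightarrow> 'a \<Rightarrow> ennreal"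
  assumes t: "\<And>j. 0 < t j" and h [measurable]: "\<And>j. h j \<in> borel_measurable borel"
    and c: "\<And>j. 0 \<le> c j" and b: "\<And>j. 0 \<le> b j" and q: "0 \<le> q" "q < 1" and A: "0 \<le> A"
    and cb: "\<And>j. c j * b j \<le> A * q ^ j"
    and h_bound: "\<And>j. (\<integral>\<^sup>+x. h j x * ennreal (w x) \<partial>lborel) \<le> ennreal (b j) * F"
    and \<Phi>: "\<And>x y. \<Phi> x y \<noteq> 0 \<Longrightarrow> \<exists>j. annulus (t j) x y = 1 \<and>
       \<Phi> x y \<le> ennreal (c j) * (kern x y * (h j x + h j y))"
  shows "(\<integral>\<^sup>+y. \<integral>\<^sup>+x. \<Phi> x y \<partial>lborel \<partial>lborel) \<le> ennreal (2 * doubling_const 4 * A / (1 - q)) * F"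
proof -
  have \<Phi>_le: "\<Phi> x y \<le> (\<Sum>j. ennreal (c j) * (annulus (t j) x y * kern x y * (h j x + h j y)))" for x y
  proof (cases "\<Phi> x y = 0")
    case False
    then obtain j where j: "annulus (t j) x y = 1"
        "\<Phi> x y \<le> ennreal (c j) * (kern x y * (h j x + h j y))" using \<Phi> by blast
    hence "\<Phi> x y \<le> ennreal (c j) * (annulus (t j) x y * kern x y * (h j x + h j y))"
      by simp
    also have "\<dots> \<le> (\<Sum>j. ennreal (c j) * (annulus (t j) x y * kern x y * (h j x + h j y)))"
      by (rule le_suminf_ennreal)
    finally show ?thesis .
  qed simp
  have "(\<integral>\<^sup>+y. \<integral>\<^sup>+x. \<Phi> x y \<partial>lborel \<partial>lborel) \<le>
      (\<integral>\<^sup>+y. \<integral>\<^sup>+x. (\<Sum>j. ennreal (c j) * (annulus (t j) x y * kern x y * (h j x +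
      h j y))) \<partial>lborel \<partial>lborel)"
    by (intro nn_integral_mono \<Phi>_le)
  also have "\<dots> = (\<Sum>j. ennreal (c j) * (\<integral>\<^sup>+y. \<integral>\<^sup>+x. annulus (t j) x y * kern x y * (h j x +
      h j y) \<partial>lborel \<partial>lborel))"
    by (simp add: nn_integral_suminf nn_integral_cmult)
  also have "\<dots> \<le> (\<Sum>j. ennreal (2 * doubling_const 4 * A * q ^ j) * F)"
  proof (intro suminf_le summableI)
    fix j
    have "ennreal (c j) * (\<integral>\<^sup>+y. \<integral>\<^sup>+x. annulus (t j) x y * kern x y * (h j x + h j y) \<partial>lborel \<partial>lborel)
        \<le> ennreal (c j) * (ennreal (2 * doubling_const 4) * (ennreal (b j) * F))"
      by (intro mult_left_mono order_trans[OF kern_annulus_integral[OF t h]] h_bound) auto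
    also have "\<dots> = ennreal (2 * doubling_const 4 * (c j * b j)) * F"
      using c b doubling_const_nonneg by (simp add: ennreal_mult mult_ac)
    also have "\<dots> \<le> ennreal (2 * doubling_const 4 * A * q ^ j) * F"
      using mult_left_mono[OF cb[of j], of "2 * doubling_const 4"] doubling_const_nonneg[of 4]
      by (intro mult_right_mono ennreal_leI) (auto simp: mult_ac)
    finally show "ennreal (c j) * (\<integral>\<^sup>+y. \<integral>\<^sup>+x. annulus (t j) x y * kern x y * (h j x +
        h j y) \<partial>lborel \<partial>lborel)
        \<le> ennreal (2 * doubling_const 4 * A * q ^ j) * F" .
  qed
  also have "\<dots> = (\<Sum>j. ennreal (2 * doubling_const 4 * A * q ^ j)) * F"
    by (rule ennreal_suminf_multc)
  also have "(\<Sum>j. ennreal (2 * doubling_const 4 * A * q ^ j)) = ennreal (2 * doubling_const 4 *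
      A / (1 - q))"
  proof -
    have "(\<lambda>j. 2 * doubling_const 4 * A * q ^ j) sums (2 * doubling_const 4 * A * (1 / (1 - q)))"
      using q by (intro sums_mult geometric_sums) auto
    thus ?thesis using doubling_const_nonneg[of 4] A q
      by (subst suminf_ennreal_eq) (auto simp: divide_inverse)
  qed
  finally show ?thesis .
qed

text \<open>The scales are \<open>t = 2^(-j)\<close> and \<open>h j\<close> is the \<open>p\<close>-th power of the oscillation at scale \<open>t\<close>. The
  ratio of the geometric series is \<open>2^(-(1 - s) p)\<close>, less than one because \<open>s < 1\<close>.\<close>

lemma near_diagonal_energy:
  assumes s: "0 < s" "s < 1"
  shows "\<exists>C\<ge>0. \<forall>u f. u \<in> borel_measurable borel \<longrightarrow> f \<in> borel_measurable borel \<longrightarrow> line_dominated u f \<longrightarrow>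
    (\<integral>\<^sup>+y. \<integral>\<^sup>+x. indicator {0<..<1} (dist x y) * diff_quotient s p u x y * kern x y \<partial>lborel \<partial>lborel) \<le>
      ennreal C * (\<integral>\<^sup>+x. pw (f x) * ennreal (w x) \<partial>lborel)"
proof -
  define q where "q = 2 powr (- ((1 - s) * p))"
  define D where "D = (2 ^ d) powr p * 2 powr p"
  define A where "A = 2 powr (s * p) * D * osc_const"
  have q: "0 \<le> q" "q < 1"
    using s p_pos powr_less_one[of 2 "- ((1 - s) * p)"] by (auto simp: q_def)
  have A: "0 \<le> A" "0 \<le> D" using osc_const_nonneg by (auto simp: A_def D_def)
  let ?t = "\<lambda>j::nat. (1/2::real) ^ j"
  have "(\<integral>\<^sup>+y. \<integral>\<^sup>+x. indicator {0<..<1} (dist x y) * diff_quotient s p u x y *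
      kern x y \<partial>lborel \<partial>lborel) \<le>
      ennreal (2 * doubling_const 4 * A / (1 - q)) * (\<integral>\<^sup>+x. pw (f x) * ennreal (w x) \<partial>lborel)"
    if [measurable]: "u \<in> borel_measurable borel" "f \<in> borel_measurable borel"
      and dom: "line_dominated u f" for u f
  proof (rule sum_over_scales)
    show "0 < ?t j" for j by simp
    show "(\<lambda>x. pw (osc (?t j) u x)) \<in> borel_measurable borel" for j by measurable
    show "0 \<le> (?t j / 2) powr (- (s * p)) * D" "0 \<le> osc_const * ?t j powr p" for j
      using A osc_const_nonneg by auto
    show "(?t j / 2) powr (- (s * p)) * D * (osc_const * ?t j powr p) \<le> A * q ^ j" for j
    proof -
      have t: "?t j = 2 powr (- real j)" by (simp add: powr_minus_divide powr_realpow power_one_over)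
      have "(?t j / 2) powr (- (s * p)) * ?t j powr p = 2 powr (s * p) * (?t j powr (- (s * p)) *
          ?t j powr p)"
        by (simp only: powr_divide[of _ 2] powr_minus_divide[of 2]) simp
      also have "?t j powr (- (s * p)) * ?t j powr p = ?t j powr ((1 - s) * p)"
        by (simp add: powr_add[symmetric] algebra_simps)
      also have "\<dots> = q ^ j"
        unfolding t by (simp add: q_def powr_power powr_powr mult_ac)
      finally show ?thesis by (simp add: A_def mult_ac)
    qed
    show "(\<integral>\<^sup>+x. pw (osc (?t j) u x) * ennreal (w x) \<partial>lborel) \<le>
        ennreal (osc_const * ?t j powr p) * (\<integral>\<^sup>+x. pw (f x) * ennreal (w x) \<partial>lborel)" for j
      by (rule osc_bounded[OF _ _ _ dom]) auto
  next
    fix x y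
    assume nz: "indicator {0<..<1} (dist x y) * diff_quotient s p u x y * kern x y \<noteq> 0"
    hence "0 < dist x y" "dist x y < 1" by (auto simp: indicator_def split: if_splits)
    then obtain j where j: "dist x y \<in> {?t j / 2..<?t j}" by (rule dyadic_scale_small)
    have "pw (ennreal \<bar>u x - u y\<bar>) \<le> pw (ennreal (2 ^ d) * (osc (?t j) u x + osc (?t j) u y))"
      using j p_pos by (intro ennreal_powr_mono difference_le_osc) auto
    also have "\<dots> = ennreal ((2 ^ d) powr p) * pw (osc (?t j) u x + osc (?t j) u y)"
      using p_pos by (simp add: ennreal_powr_cmult)
    also have "\<dots> \<le> ennreal ((2 ^ d) powr p) * (ennreal (2 powr p) * (pw (osc (?t j) u x) +
        pw (osc (?t j) u y)))"
      by (intro mult_left_mono ennreal_powr_add_le p_pos) auto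
    finally have u: "pw (ennreal \<bar>u x - u y\<bar>) \<le> ennreal D * (pw (osc (?t j) u x) + pw (osc (?t j) u y))"
      by (simp add: D_def ennreal_mult mult.assoc)
    have "diff_quotient s p u x y \<le> ennreal ((?t j / 2) powr (- (s * p))) * pw (ennreal \<bar>u x - u y\<bar>)"
      using j s p_pos by (intro diff_quotient_le) auto
    also have "\<dots> \<le> ennreal ((?t j / 2) powr (- (s * p))) * (ennreal D * (pw (osc (?t j) u x) +
        pw (osc (?t j) u y)))"
      by (intro mult_left_mono u) auto
    finally have "diff_quotient s p u x y \<le> ennreal ((?t j / 2) powr (- (s * p)) * D) *
        (pw (osc (?t j) u x) + pw (osc (?t j) u y))"
      using A by (simp add: ennreal_mult mult.assoc)
    hence "diff_quotient s p u x y * kern x y \<le> ennreal ((?t j / 2) powr (- (s * p)) * D) *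
        (pw (osc (?t j) u x) + pw (osc (?t j) u y)) * kern x y"
      by (rule mult_right_mono) simp
    moreover have "indicator {0<..<1} (dist x y) * diff_quotient s p u x y * kern x y \<le>
        diff_quotient s p u x y * kern x y"
      by (simp add: indicator_def)
    ultimately show "\<exists>j. annulus (?t j) x y = 1 \<and>
       indicator {0<..<1} (dist x y) * diff_quotient s p u x y * kern x y \<le>
         ennreal ((?t j / 2) powr (- (s * p)) * D) * (kern x y * (pw (osc (?t j) u x) +
         pw (osc (?t j) u y)))"
      using j by (intro exI[of _ j]) (auto simp: annulus_def mult_ac intro: order_trans)
  qed (use q A in auto)
  moreover have "0 \<le> 2 * doubling_const 4 * A / (1 - q)"
    using doubling_const_nonneg[of 4] A q by simp
  ultimately show ?thesis by blast
qed

text \<open>The scales are \<open>t = 2^(j + 1)\<close>, and the difference is simply bounded by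
  \<open>|u x| + |u y|\<close>. The ratio of the geometric series is \<open>2^(-s p)\<close>, less than one because \<open>s > 0\<close>.\<close>

lemma off_diagonal_energy:
  assumes s: "0 < s"
  shows "\<exists>C\<ge>0. \<forall>u. u \<in> borel_measurable borel \<longrightarrow>
    (\<integral>\<^sup>+y. \<integral>\<^sup>+x. indicator {1..} (dist x y) * diff_quotient s p u x y * kern x y \<partial>lborel \<partial>lborel) \<le>
      ennreal C * (\<integral>\<^sup>+x. pw (ennreal \<bar>u x\<bar>) * ennreal (w x) \<partial>lborel)"
proof -
  define q where "q = 2 powr (- (s * p))"
  have q: "0 \<le> q" "q < 1"
    using s p_pos powr_less_one[of 2 "- (s * p)"] by (auto simp: q_def)
  let ?t = "\<lambda>j::nat. 2 ^ Suc j :: real"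
  have "(\<integral>\<^sup>+y. \<integral>\<^sup>+x. indicator {1..} (dist x y) * diff_quotient s p u x y * kern x y \<partial>lborel \<partial>lborel) \<le>
      ennreal (2 * doubling_const 4 * 2 powr p / (1 - q)) * (\<integral>\<^sup>+x. pw (ennreal \<bar>u x\<bar>) *
      ennreal (w x) \<partial>lborel)"
    if [measurable]: "u \<in> borel_measurable borel" for u
  proof (rule sum_over_scales)
    show "0 < ?t j" for j by simp
    show "(\<lambda>x. pw (ennreal \<bar>u x\<bar>)) \<in> borel_measurable borel" for j by measurable
    show "0 \<le> (?t j / 2) powr (- (s * p)) * 2 powr p" "0 \<le> (1::real)" for j by auto
    show "(?t j / 2) powr (- (s * p)) * 2 powr p * 1 \<le> 2 powr p * q ^ j" for j
    proof -
      have "?t j / 2 = 2 powr real j" by (simp add: powr_realpow)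
      thus ?thesis by (simp add: q_def powr_power powr_powr mult_ac)
    qed
    show "(\<integral>\<^sup>+x. pw (ennreal \<bar>u x\<bar>) * ennreal (w x) \<partial>lborel) \<le>
        ennreal 1 * (\<integral>\<^sup>+x. pw (ennreal \<bar>u x\<bar>) * ennreal (w x) \<partial>lborel)" for j
      by simp
  next
    fix x y
    assume nz: "indicator {1..} (dist x y) * diff_quotient s p u x y * kern x y \<noteq> 0"
    hence "1 \<le> dist x y" by (auto simp: indicator_def split: if_splits)
    then obtain j where j: "dist x y \<in> {?t j / 2..<?t j}" by (rule dyadic_scale_large)
    have "pw (ennreal \<bar>u x - u y\<bar>) \<le> pw (ennreal \<bar>u x\<bar> + ennreal \<bar>u y\<bar>)"
      using p_pos by (intro ennreal_powr_mono) (auto simp: ennreal_plus[symmetric] simp del: ennreal_plus intro!: ennreal_leI)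
    also have "\<dots> \<le> ennreal (2 powr p) * (pw (ennreal \<bar>u x\<bar>) + pw (ennreal \<bar>u y\<bar>))"
      by (rule ennreal_powr_add_le[OF p_pos])
    finally have u: "pw (ennreal \<bar>u x - u y\<bar>) \<le> ennreal (2 powr p) * (pw (ennreal \<bar>u x\<bar>) +
        pw (ennreal \<bar>u y\<bar>))" .
    have "diff_quotient s p u x y \<le> ennreal ((?t j / 2) powr (- (s * p))) * pw (ennreal \<bar>u x - u y\<bar>)"
      using j s p_pos by (intro diff_quotient_le) auto
    also have "\<dots> \<le> ennreal ((?t j / 2) powr (- (s * p))) * (ennreal (2 powr p) *
        (pw (ennreal \<bar>u x\<bar>) + pw (ennreal \<bar>u y\<bar>)))"
      by (intro mult_left_mono u) auto
    finally have "diff_quotient s p u x y \<le> ennreal ((?t j / 2) powr (- (s * p)) * 2 powr p) *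
        (pw (ennreal \<bar>u x\<bar>) + pw (ennreal \<bar>u y\<bar>))"
      by (simp add: ennreal_mult mult.assoc)
    hence "diff_quotient s p u x y * kern x y \<le> ennreal ((?t j / 2) powr (- (s * p)) * 2 powr p) *
        (pw (ennreal \<bar>u x\<bar>) + pw (ennreal \<bar>u y\<bar>)) * kern x y"
      by (rule mult_right_mono) simp
    moreover have "indicator {1..} (dist x y) * diff_quotient s p u x y * kern x y \<le>
        diff_quotient s p u x y * kern x y"
      by (simp add: indicator_def)
    ultimately show "\<exists>j. annulus (?t j) x y = 1 \<and>
       indicator {1..} (dist x y) * diff_quotient s p u x y * kern x y \<le>
         ennreal ((?t j / 2) powr (- (s * p)) * 2 powr p) * (kern x y * (pw (ennreal \<bar>u x\<bar>) +
         pw (ennreal \<bar>u y\<bar>)))"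
      using j by (intro exI[of _ j]) (auto simp: annulus_def mult_ac intro: order_trans)
  qed (use q in auto)
  moreover have "0 \<le> 2 * doubling_const 4 * 2 powr p / (1 - q)"
    using doubling_const_nonneg[of 4] q by simp
  ultimately show ?thesis by blast
qed

end


section \<open>Smooth bump functions\<close>

lemma partial_deriv_eq:
  fixes f :: "real^'n \<Rightarrow> real"
  assumes "(f has_derivative D) (at x)"
  shows "partial_deriv i f x = D (axis i 1)"
  using frechet_derivative_at[OF assms] by (simp add: partial_deriv_def)

lemma has_derivative_partial_derivs:
  fixes f :: "real^'n \<Rightarrow> real"
  assumes "f differentiable (at x)"
  shows "(f has_derivative (\<lambda>h. \<Sum>i\<in>UNIV. h $ i * partial_deriv i f x)) (at x)"
proof -
  obtain D where D: "(f has_derivative D) (at x)" using assms differentiable_def by blast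
  interpret D: bounded_linear D by (rule has_derivative_bounded_linear[OF D])
  have "D h = (\<Sum>i\<in>UNIV. h $ i * partial_deriv i f x)" for h
  proof -
    have "D h = D (\<Sum>i\<in>UNIV. h $ i *\<^sub>R axis i 1)"
      by (simp add: basis_expansion scalar_mult_eq_scaleR[symmetric])
    also have "\<dots> = (\<Sum>i\<in>UNIV. h $ i * partial_deriv i f x)"
      by (simp add: D.sum D.scaleR partial_deriv_eq[OF D])
    finally show ?thesis .
  qed
  hence "D = (\<lambda>h. \<Sum>i\<in>UNIV. h $ i * partial_deriv i f x)" by (rule ext)
  thus ?thesis using D by (simp only:)
qed

lemma cont_diff_SucD: "cont_diff (Suc m) f \<Longrightarrow> cont_diff m f"
proof (induction m arbitrary: f)
  case 0
  thus ?case by (auto intro!: differentiable_imp_continuous_on simp: differentiable_on_def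
      intro: differentiable_at_withinI)
next
  case (Suc m)
  thus ?case by auto
qed

lemma cont_diff_const: "cont_diff m (\<lambda>x::real^'n. c)"
proof (induction m arbitrary: c)
  case (Suc m)
  have "partial_deriv i (\<lambda>x::real^'n. c) = (\<lambda>x. 0)" for i
    by (rule ext, subst partial_deriv_eq) (auto intro: derivative_intros)
  thus ?case using Suc by simp
qed simp

lemma cont_diff_component: "cont_diff m (\<lambda>x::real^'n. x $ j)"
proof (cases m)
  case (Suc m)
  have "partial_deriv i (\<lambda>x::real^'n. x $ j) = (\<lambda>x. axis i 1 $ j)" for i
    by (rule ext, subst partial_deriv_eq)
      (auto intro: bounded_linear.has_derivative bounded_linear_vec_nth has_derivative_ident)
  moreover have "(\<lambda>x::real^'n. x $ j) differentiable at x" for x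
    by (intro bounded_linear_imp_differentiable bounded_linear_vec_nth)
  ultimately show ?thesis using Suc by (simp add: cont_diff_const)
qed (auto intro: continuous_intros)

lemma cont_diff_add: "cont_diff m f \<Longrightarrow> cont_diff m g \<Longrightarrow> cont_diff m (\<lambda>x::real^'n. f x + g x)"
proof (induction m arbitrary: f g)
  case 0
  thus ?case by (auto intro: continuous_intros)
next
  case (Suc m)
  have "partial_deriv i (\<lambda>x. f x + g x) = (\<lambda>x. partial_deriv i f x + partial_deriv i g x)" for i
  proof
    fix x
    have "f differentiable at x" "g differentiable at x" using Suc.prems by auto
    hence "((\<lambda>x. f x + g x) has_derivative
        (\<lambda>h. frechet_derivative f (at x) h + frechet_derivative g (at x) h)) (at x)"
      by (intro has_derivative_add) (auto simp: frechet_derivative_works[symmetric])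
    from partial_deriv_eq[OF this]
    show "partial_deriv i (\<lambda>x. f x + g x) x = partial_deriv i f x + partial_deriv i g x"
      by (simp add: partial_deriv_def)
  qed
  thus ?case using Suc by auto
qed

lemma cont_diff_mult: "cont_diff m f \<Longrightarrow> cont_diff m g \<Longrightarrow> cont_diff m (\<lambda>x::real^'n. f x * g x)"
proof (induction m arbitrary: f g)
  case 0
  thus ?case by (auto intro: continuous_intros)
next
  case (Suc m)
  have "partial_deriv i (\<lambda>x. f x * g x) = (\<lambda>x. f x * partial_deriv i g x + partial_deriv i f x *
      g x)" for i
  proof
    fix x
    have "f differentiable at x" "g differentiable at x" using Suc.prems by auto
    hence "((\<lambda>x. f x * g x) has_derivative
        (\<lambda>h. f x * frechet_derivative g (at x) h + frechet_derivative f (at x) h * g x)) (at x)"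
      by (intro has_derivative_mult) (auto simp: frechet_derivative_works[symmetric])
    from partial_deriv_eq[OF this]
    show "partial_deriv i (\<lambda>x. f x * g x) x = f x * partial_deriv i g x + partial_deriv i f x * g x"
      by (simp add: partial_deriv_def)
  qed
  moreover have "cont_diff m f" "cont_diff m g" using Suc.prems cont_diff_SucD by auto
  ultimately show ?case using Suc by (auto intro!: cont_diff_add)
qed

lemma cont_diff_sum:
  assumes "finite A" "\<And>i. i \<in> A \<Longrightarrow> cont_diff m (f i)"
  shows "cont_diff m (\<lambda>x::real^'n. \<Sum>i\<in>A. f i x)"
  using assms by (induction rule: finite_induct) (auto intro: cont_diff_const cont_diff_add)

text \<open>Affine maps act on partial derivatives by a constant factor, so the induction only needs closure
  under multiplication by constants.\<close>

lemma cont_diff_dilate: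
  "cont_diff m f \<Longrightarrow> cont_diff m (\<lambda>x::real^'n. f (c *\<^sub>R (x - a)))"
proof (induction m arbitrary: f)
  case 0
  thus ?case by (auto intro!: continuous_on_compose2[of UNIV f] continuous_intros)
next
  case (Suc m)
  have der: "((\<lambda>x. f (c *\<^sub>R (x - a))) has_derivative
        (\<lambda>h. frechet_derivative f (at (c *\<^sub>R (x - a))) (c *\<^sub>R h))) (at x)" for x
  proof -
    have "(f has_derivative frechet_derivative f (at (c *\<^sub>R (x - a)))) (at (c *\<^sub>R (x - a)))"
      using Suc.prems by (simp add: frechet_derivative_works[symmetric])
    moreover have "((\<lambda>x. c *\<^sub>R (x - a)) has_derivative (\<lambda>h. c *\<^sub>R h)) (at x)"
      by (auto intro!: derivative_eq_intros)
    ultimately show ?thesis using has_derivative_compose by blast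
  qed
  have "partial_deriv i (\<lambda>x. f (c *\<^sub>R (x - a))) = (\<lambda>x. c * partial_deriv i f (c *\<^sub>R (x - a)))" for i
  proof
    fix x
    have "linear (frechet_derivative f (at (c *\<^sub>R (x - a))))"
      using Suc.prems by (intro linear_frechet_derivative) auto
    thus "partial_deriv i (\<lambda>x. f (c *\<^sub>R (x - a))) x = c * partial_deriv i f (c *\<^sub>R (x - a))"
      using partial_deriv_eq[OF der] by (simp add: partial_deriv_def linear_scale)
  qed
  moreover have "(\<lambda>x. f (c *\<^sub>R (x - a))) differentiable at x" for x
    using der unfolding differentiable_def by blast
  ultimately show ?case using Suc by (auto intro!: cont_diff_mult cont_diff_const)
qed

text \<open>These functions form a class that contains \<open>exp (- 1 / t)\<close>, cut off at zero, and is closed under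
  differentiation: by \<open>flat_exp_deriv\<close> the derivative only changes the polynomial. Their smoothness
  thus follows by an induction on the order in which the polynomial is arbitrary.\<close>

definition flat_exp :: "real poly \<Rightarrow> real \<Rightarrow> real" where
  "flat_exp q t = (if t \<le> 0 then 0 else poly q (1 / t) * exp (- (1 / t)))"

lemma poly_exp_minus_tendsto_0: "((\<lambda>y. poly q y * exp (- y)) \<longlongrightarrow> (0::real)) at_top"
proof -
  have "((\<lambda>y. \<Sum>i\<le>degree q. coeff q i * (y ^ i / exp y)) \<longlongrightarrow> (\<Sum>i\<le>degree q. coeff q i * 0)) at_top"
    by (intro tendsto_sum tendsto_mult tendsto_const tendsto_power_div_exp_0)
  thus ?thesis by (simp add: poly_altdef exp_minus divide_inverse sum_distrib_right mult.assoc)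
qed

lemma flat_exp_deriv:
  "(flat_exp q has_real_derivative flat_exp (pCons 0 (pCons 0 (q - pderiv q))) t) (at t)"
proof (cases t "0::real" rule: linorder_cases)
  case less
  have "((\<lambda>_. 0) has_real_derivative 0) (at t)" by simp
  moreover have "eventually (\<lambda>x. (0::real) = flat_exp q x) (nhds t)"
    using less by (intro eventually_mono[OF eventually_nhds_in_open[of "{..<0}"]]) (auto simp: flat_exp_def)
  ultimately show ?thesis using less
    by (subst (asm) DERIV_cong_ev[OF refl _ refl]) (auto simp: flat_exp_def)
next
  case greater
  have "((\<lambda>x. poly q (1 / x) * exp (- (1 / x))) has_real_derivative
     (1 / t) * (1 / t) * (poly q (1 / t) - poly (pderiv q) (1 / t)) * exp (- (1 / t))) (at t)"
    using greater
    by (auto intro!: derivative_eq_intros DERIV_chain2[OF poly_DERIV] simp: field_simps power2_eq_square)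
  moreover have "eventually (\<lambda>x. poly q (1 / x) * exp (- (1 / x)) = flat_exp q x) (nhds t)"
    using greater by (intro eventually_mono[OF eventually_nhds_in_open[of "{0<..}"]]) (auto simp: flat_exp_def)
  ultimately show ?thesis using greater
    by (subst (asm) DERIV_cong_ev[OF refl _ refl]) (auto simp: flat_exp_def)
next
  case equal
  have "((\<lambda>h. flat_exp q h / h) \<longlongrightarrow> 0) (at 0)"
  proof (rule filterlim_split_at_real)
    have "eventually (\<lambda>h. 0 = flat_exp q h / h) (at_left 0)"
      by (intro eventually_at_leftI[of "-1"]) (auto simp: flat_exp_def)
    thus "((\<lambda>h. flat_exp q h / h) \<longlongrightarrow> 0) (at_left 0)"
      by (rule Lim_transform_eventually[OF tendsto_const])
    have "((\<lambda>h. poly (pCons 0 q) (inverse h) * exp (- inverse h)) \<longlongrightarrow> 0) (at_right 0)"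
      by (rule filterlim_compose[OF poly_exp_minus_tendsto_0 filterlim_inverse_at_top_right])
    moreover have "eventually (\<lambda>h. poly (pCons 0 q) (inverse h) * exp (- inverse h) =
        flat_exp q h / h) (at_right 0)"
      by (intro eventually_at_rightI[of _ 1]) (auto simp: flat_exp_def field_simps)
    ultimately show "((\<lambda>h. flat_exp q h / h) \<longlongrightarrow> 0) (at_right 0)"
      by (rule Lim_transform_eventually)
  qed
  thus ?thesis using equal by (simp add: DERIV_def flat_exp_def)
qed

lemma cont_diff_flat_exp: "cont_diff m f \<Longrightarrow> cont_diff m (\<lambda>x::real^'n. flat_exp q (f x))"
proof (induction m arbitrary: q)
  case 0
  have "continuous_on UNIV (flat_exp q)"
    using flat_exp_deriv DERIV_isCont by (blast intro: continuous_at_imp_continuous_on)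
  with 0 show ?case by (auto intro: continuous_on_compose2[of UNIV "flat_exp q"])
next
  case (Suc m)
  let ?q = "pCons 0 (pCons 0 (q - pderiv q))"
  have der: "((\<lambda>x. flat_exp q (f x)) has_derivative
        (\<lambda>h. flat_exp ?q (f x) * frechet_derivative f (at x) h)) (at x)" for x
  proof -
    have "(f has_derivative frechet_derivative f (at x)) (at x)"
      using Suc.prems by (simp add: frechet_derivative_works[symmetric])
    from has_derivative_compose[OF this, of "flat_exp q" "(*) (flat_exp ?q (f x))"]
      flat_exp_deriv[of q "f x"]
    show ?thesis unfolding has_field_derivative_def by blast
  qed
  have "partial_deriv i (\<lambda>x. flat_exp q (f x)) = (\<lambda>x. flat_exp ?q (f x) * partial_deriv i f x)" for i
    using partial_deriv_eq[OF der] by (simp add: fun_eq_iff partial_deriv_def)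
  moreover have "(\<lambda>x. flat_exp q (f x)) differentiable at x" for x
    using der unfolding differentiable_def by blast
  ultimately show ?case using Suc cont_diff_SucD[OF Suc.prems] by (auto intro!: cont_diff_mult)
qed

text \<open>Supported in the ball of radius one half around the centre of the unit cube. Having
  the support in that cube, with the origin as a corner, matches the one-sided cubes
  for which the differentiation theorem \<open>integrable_ccontinuous_explicit\<close> is stated.\<close>

definition bump :: "real^'n \<Rightarrow> real" where
  "bump x = flat_exp 1 (1 / 4 - (\<Sum>i\<in>UNIV. (x $ i + (- 1 / 2)) * (x $ i + (- 1 / 2))))"

lemma cont_diff_bump: "cont_diff m bump"
proof -
  have "cont_diff m (\<lambda>x::real^'n. flat_exp 1 (1 / 4 + (- 1) * (\<Sum>i\<in>UNIV. (x $ i + (- 1 / 2)) *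
      (x $ i + (- 1 / 2)))))"
    by (intro cont_diff_flat_exp cont_diff_add cont_diff_mult cont_diff_sum cont_diff_const
        cont_diff_component) auto
  thus ?thesis by (simp add: bump_def[abs_def])
qed

lemma bump_nonneg: "0 \<le> bump x"
  by (simp add: bump_def flat_exp_def)

lemma bump_le_1: "bump x \<le> 1"
  by (simp add: bump_def flat_exp_def)

lemma bump_support:
  assumes "bump x \<noteq> 0"
  shows "0 \<le> x $ i \<and> x $ i \<le> 1"
proof -
  have "(x $ i - 1/2)\<^sup>2 \<le> (\<Sum>i\<in>UNIV. (x $ i - 1/2)\<^sup>2)"
    by (rule member_le_sum) auto
  also have "\<dots> < (1/2)\<^sup>2"
    using assms by (auto simp: bump_def flat_exp_def power2_eq_square split: if_splits)
  finally have "\<bar>x $ i - 1/2\<bar>\<^sup>2 < (1/2)\<^sup>2" by simp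
  hence "\<bar>x $ i - 1/2\<bar> < 1/2" by (rule power2_less_imp_less) simp
  thus ?thesis by linarith
qed

lemma bump_pos_center: "0 < bump (\<chi> i. 1 / 2)"
  by (simp add: bump_def flat_exp_def)

lemma continuous_bump: "continuous_on UNIV bump"
  using cont_diff_bump[of 0] by simp


section \<open>Mollification\<close>

lemma lborel_integral_affine:
  fixes f :: "'a::euclidean_space \<Rightarrow> real"
  assumes c: "c \<noteq> 0" and [measurable]: "f \<in> borel_measurable borel"
  shows "(LINT x|lborel. f (a + c *\<^sub>R x)) = (LINT x|lborel. f x) / \<bar>c\<bar> ^ DIM('a)"
proof -
  have "(LINT x|lborel. f x) = (LINT x|density (distr lborel borel (\<lambda>x. a +
      c *\<^sub>R x)) (\<lambda>_. ennreal (\<bar>c\<bar> ^ DIM('a))). f x)"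
    using lborel_affine[OF c, of a] by simp
  also have "\<dots> = (LINT x|lborel. \<bar>c\<bar> ^ DIM('a) * f (a + c *\<^sub>R x))"
    by (simp add: integral_density integral_distr)
  also have "\<dots> = \<bar>c\<bar> ^ DIM('a) * (LINT x|lborel. f (a + c *\<^sub>R x))" by simp
  finally show ?thesis using c by simp
qed

lemma locally_integrable_lborel:
  fixes f :: "'a::euclidean_space \<Rightarrow> 'b::{banach, second_countable_topology}"
  assumes f: "locally_integrable f" and [measurable]: "f \<in> borel_measurable borel" and "compact K"
  shows "integrable lborel (\<lambda>x. indicator K x *\<^sub>R f x)"
proof -
  have "integrable lebesgue (\<lambda>x. indicator K x *\<^sub>R f x)"
    using f \<open>compact K\<close> unfolding locally_integrable_def set_integrable_def by blast
  moreover have [measurable]: "K \<in> sets borel" using \<open>compact K\<close> by (rule borel_compact)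
  ultimately show ?thesis by (subst (asm) integrable_completion) auto
qed

text \<open>A continuous function that vanishes outside a compact ball is bounded.\<close>

lemma integrable_mult_compact_support:
  fixes f \<psi> :: "'a::euclidean_space \<Rightarrow> real"
  assumes f: "locally_integrable f" and [measurable]: "f \<in> borel_measurable borel"
    and \<psi>: "continuous_on UNIV \<psi>" and supp: "\<And>x. x \<notin> cball c R \<Longrightarrow> \<psi> x = 0"
  shows "integrable lborel (\<lambda>x. f x * \<psi> x)"
proof -
  have [measurable]: "\<psi> \<in> borel_measurable borel" using \<psi> by (rule borel_measurable_continuous_onI)
  have "compact (\<psi> ` cball c R)" by (intro compact_continuous_image continuous_on_subset[OF \<psi>]) auto
  from compact_imp_bounded[OF this] obtain B where B: "\<And>x. x \<in> cball c R \<Longrightarrow> norm (\<psi> x) \<le> B"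
    unfolding bounded_iff by blast
  have bound: "norm (f x * \<psi> x) \<le> norm (indicator (cball c R) x *\<^sub>R f x * B)" for x
  proof (cases "x \<in> cball c R")
    case True
    hence "\<bar>\<psi> x\<bar> \<le> \<bar>B\<bar>" using B[of x] by simp
    thus ?thesis using True by (simp add: abs_mult mult_left_mono)
  qed (use supp in simp)
  show ?thesis
    using integrable_mult_left[OF locally_integrable_lborel[OF f _ compact_cball[of c R]], of B] bound
    by (intro Bochner_Integration.integrable_bound[where g = "\<lambda>x. f x * \<psi> x"
       and f = "\<lambda>x. indicator (cball c R) x *\<^sub>R f x * B"]) (auto simp del: mem_cball)
qed

text \<open>The type argument records the dimension, which the value does not otherwise reveal.\<close>

definition bump_mass :: "'n::finite itself \<Rightarrow> real" where
  "bump_mass _ = (LINT x|lborel. bump (x :: real^'n))"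

definition mollifier :: "real \<Rightarrow> real^'n \<Rightarrow> real" where
  "mollifier \<epsilon> x = bump ((1 / \<epsilon>) *\<^sub>R x) / (bump_mass TYPE('n) * \<epsilon> ^ CARD('n))"

lemma bump_outside: "x \<notin> cball 0 (real CARD('n)) \<Longrightarrow> bump (x::real^'n) = 0"
proof (rule ccontr)
  assume x: "x \<notin> cball 0 (real CARD('n))" and nz: "bump x \<noteq> 0"
  have "norm x \<le> (\<Sum>i\<in>UNIV. \<bar>x $ i\<bar>)" by (rule norm_le_l1_cart)
  also have "\<dots> \<le> (\<Sum>i\<in>(UNIV::'n set). 1)" using bump_support[OF nz] by (intro sum_mono) auto
  finally show False using x by simp
qed

lemma measurable_bump [measurable]: "bump \<in> borel_measurable borel"
  using continuous_bump by (rule borel_measurable_continuous_onI)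

lemma integrable_bump: "integrable lborel (bump :: real^'n \<Rightarrow> real)"
proof -
  have "locally_integrable (\<lambda>x::real^'n. 1::real)"
    unfolding locally_integrable_def set_integrable_def
    using lmeasurable_compact integrable_real_indicator by (auto simp: fmeasurable_def)
  from integrable_mult_compact_support[OF this _ continuous_bump, of 0 "real CARD('n)"] bump_outside[where 'n='n]
  show ?thesis by simp
qed

lemma bump_mass_pos: "0 < bump_mass TYPE('n::finite)"
proof -
  let ?c = "(\<chi> i. 1 / 2) :: real^'n"
  have "0 \<le> bump_mass TYPE('n)" unfolding bump_mass_def by (intro integral_nonneg_AE) (simp add: bump_nonneg)
  moreover have "bump_mass TYPE('n) \<noteq> 0"
  proof
    assume "bump_mass TYPE('n) = 0"
    hence "AE x in lborel. bump (x::real^'n) = 0"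
      unfolding bump_mass_def using integral_nonneg_eq_0_iff_AE[OF integrable_bump] bump_nonneg by auto
    hence N: "{x::real^'n. bump x \<noteq> 0} \<in> null_sets lborel"
      by (subst (asm) AE_iff_null) auto
    have "open {x::real^'n. bump x \<noteq> 0}"
      using open_vimage[OF open_Compl[OF closed_singleton] continuous_bump, of 0] by (simp add: vimage_def)
    moreover have "?c \<in> {x. bump x \<noteq> 0}" using less_imp_neq[OF bump_pos_center[where 'a='n]] by simp
    ultimately have "\<not> negligible {x::real^'n. bump x \<noteq> 0}"
      by (intro open_not_negligible) blast+
    moreover have "negligible {x::real^'n. bump x \<noteq> 0}"
      using N unfolding negligible_iff_null_sets by (rule null_sets_completionI)
    ultimately show False by blast
  qed
  ultimately show ?thesis by simp
qed

lemma mollifier_nonneg: "0 < \<epsilon> \<Longrightarrow> 0 \<le> mollifier \<epsilon> (x::real^'n)"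
  using bump_mass_pos[where 'n='n] by (simp add: mollifier_def bump_nonneg less_imp_le)

lemma mollifier_le: "0 < \<epsilon> \<Longrightarrow> mollifier \<epsilon> (x::real^'n) \<le> 1 / (bump_mass TYPE('n) * \<epsilon> ^ CARD('n))"
  using bump_mass_pos[where 'n='n] by (simp add: mollifier_def bump_le_1 divide_right_mono less_imp_le)

lemma mollifier_support:
  assumes "0 < \<epsilon>" "mollifier \<epsilon> x \<noteq> 0"
  shows "0 \<le> x $ i \<and> x $ i \<le> \<epsilon>"
  using bump_support[of "(1 / \<epsilon>) *\<^sub>R x" i] assms
  by (auto simp: mollifier_def zero_le_divide_iff pos_divide_le_eq)

lemma mollifier_outside:
  assumes "0 < \<epsilon>" "x \<notin> cball 0 (\<epsilon> * real CARD('n))"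
  shows "mollifier \<epsilon> (x::real^'n) = 0"
proof -
  have "(1 / \<epsilon>) *\<^sub>R x \<notin> cball 0 (real CARD('n))" using assms by (simp add: field_simps not_le)
  thus ?thesis by (simp add: mollifier_def bump_outside)
qed

lemma cont_diff_mollifier: "cont_diff m (\<lambda>y::real^'n. mollifier \<epsilon> (y - a))"
proof -
  have "cont_diff m (\<lambda>y::real^'n. bump ((1 / \<epsilon>) *\<^sub>R (y - a)) * (1 / (bump_mass TYPE('n) *
      \<epsilon> ^ CARD('n))))"
    by (intro cont_diff_mult cont_diff_const cont_diff_dilate cont_diff_bump)
  thus ?thesis by (simp add: mollifier_def)
qed

lemma cont_diff_mollifier_0: "cont_diff m (mollifier \<epsilon> :: real^'n \<Rightarrow> real)"
  using cont_diff_mollifier[of m \<epsilon> 0] by simp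

lemma continuous_mollifier: "continuous_on UNIV (mollifier \<epsilon> :: real^'n \<Rightarrow> real)"
  using cont_diff_mollifier_0[of 0] by simp

lemma measurable_mollifier [measurable]: "(mollifier \<epsilon> :: real^'n \<Rightarrow> real) \<in> borel_measurable borel"
  using continuous_mollifier by (rule borel_measurable_continuous_onI)

lemma mollifier_test_function:
  assumes "0 < \<epsilon>"
  shows "(\<lambda>y::real^'n. mollifier \<epsilon> (y - a)) \<in> test_functions"
proof -
  have sub: "{y::real^'n. mollifier \<epsilon> (y - a) \<noteq> 0} \<subseteq> cball a (\<epsilon> * real CARD('n))"
    using mollifier_outside[OF assms, of "_ - a"] by (force simp: dist_norm norm_minus_commute)
  hence "closure {y::real^'n. mollifier \<epsilon> (y - a) \<noteq> 0} \<subseteq> cball a (\<epsilon> * real CARD('n))"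
    by (intro closure_minimal) auto
  hence "compact (closure {y::real^'n. mollifier \<epsilon> (y - a) \<noteq> 0})"
    by (meson bounded_cball bounded_subset closed_closure compact_eq_bounded_closed)
  thus ?thesis by (simp add: test_functions_def cont_diff_mollifier)
qed

lemma integral_mollifier:
  assumes "0 < \<epsilon>"
  shows "(LINT y|lborel. mollifier \<epsilon> (y - a :: real^'n)) = 1"
proof -
  have "(LINT y|lborel. mollifier \<epsilon> (y - a)) = (LINT y|lborel. bump ((- (1 / \<epsilon>)) *\<^sub>R a +
      (1 / \<epsilon>) *\<^sub>R y)) / (bump_mass TYPE('n) * \<epsilon> ^ CARD('n))"
    by (simp add: mollifier_def algebra_simps)
  also have "(LINT y|lborel. bump ((- (1 / \<epsilon>)) *\<^sub>R a + (1 / \<epsilon>) *\<^sub>R y)) =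
      bump_mass TYPE('n) / \<bar>1 / \<epsilon>\<bar> ^ CARD('n)"
    using assms by (subst lborel_integral_affine) (auto simp: bump_mass_def)
  finally show ?thesis using assms bump_mass_pos[where 'n='n] by (simp add: power_one_over)
qed

lemma partial_deriv_translate:
  fixes f :: "real^'n \<Rightarrow> real"
  assumes "f differentiable (at (x - a))"
  shows "partial_deriv i (\<lambda>y. f (y - a)) x = partial_deriv i f (x - a)"
proof -
  obtain D where D: "(f has_derivative D) (at (x - a))" using assms differentiable_def by blast
  have "((\<lambda>y. y - a) has_derivative (\<lambda>h. h)) (at x)" by (auto intro!: derivative_eq_intros)
  from has_derivative_compose[OF this D] have "((\<lambda>y. f (y - a)) has_derivative D) (at x)" .
  from partial_deriv_eq[OF this] partial_deriv_eq[OF D] show ?thesis by simp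
qed

lemma mollifier_differentiable: "(mollifier \<epsilon> :: real^'n \<Rightarrow> real) differentiable (at x)"
  using cont_diff_mollifier_0[where 'n='n and m = "Suc 0" and \<epsilon> = \<epsilon>] by simp

lemma continuous_partial_mollifier: "continuous_on UNIV (partial_deriv i (mollifier \<epsilon> :: real^'n \<Rightarrow> real))"
  using cont_diff_mollifier_0[where 'n='n and m = "Suc 0" and \<epsilon> = \<epsilon>] by simp

lemma partial_mollifier_outside:
  assumes "0 < \<epsilon>" "x \<notin> cball 0 (\<epsilon> * real CARD('n))"
  shows "partial_deriv i (mollifier \<epsilon>) (x::real^'n) = 0"
proof -
  have "((\<lambda>_. 0) has_derivative (\<lambda>_. 0)) (at x)" by simp
  moreover have "open (- cball (0::real^'n) (\<epsilon> * real CARD('n)))" by (simp add: open_Compl)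
  moreover have "x \<in> - cball 0 (\<epsilon> * real CARD('n))" using assms(2) by blast
  moreover have "0 = mollifier \<epsilon> y" if "y \<in> - cball (0::real^'n) (\<epsilon> * real CARD('n))" for y
    using mollifier_outside[OF assms(1), of y] that by (metis ComplD)
  ultimately have "(mollifier \<epsilon> has_derivative (\<lambda>_. 0)) (at x)"
    by (rule has_derivative_transform_within_open)
  thus ?thesis by (rule partial_deriv_eq)
qed

text \<open>The mollifier is at most a multiple of the normalised indicator of a one-sided cube, so it is
  enough that almost every \<open>x\<close> is a Lebesgue point: the averages of \<open>|f - f x|\<close> over
  the cubes tend to zero. The differentiation theorem is applied to the countably many functions
  \<open>|f - q|\<close> with \<open>q\<close> rational, and \<open>f x\<close> is approximated by such a \<open>q\<close>.\<close>

lemma mollification_converges: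
  fixes f :: "real^'n \<Rightarrow> real"
  assumes f: "locally_integrable f" and [measurable]: "f \<in> borel_measurable borel"
  shows "AE x in lborel. (\<lambda>m. LINT y|lborel. f y * mollifier (1 / Suc m) (y - x)) \<longlonglongrightarrow> f x"
proof -
  let ?Q = "\<lambda>h x::real^'n. cbox x (x + h *\<^sub>R One)"
  have int_cbox: "integrable lborel (\<lambda>y. indicator (cbox a b) y *\<^sub>R \<bar>f y - q\<bar>)" for a b q
  proof -
    have "integrable lborel (\<lambda>y. \<bar>indicator (cbox a b) y *\<^sub>R f y - indicator (cbox a b) y * q\<bar>)"
      using locally_integrable_lborel[OF f _ compact_cbox[of a b]]
      by (intro integrable_abs Bochner_Integration.integrable_diff integrable_mult_left)
        (auto intro: integrable_real_indicator simp: emeasure_lborel_cbox_eq)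
    moreover have "\<bar>indicator (cbox a b) y *\<^sub>R f y - indicator (cbox a b) y * q\<bar> =
        indicator (cbox a b) y *\<^sub>R \<bar>f y - q\<bar>" for y
      by (simp add: indicator_def)
    ultimately show ?thesis by simp
  qed
  have int_on: "(\<lambda>y. \<bar>f y - q\<bar>) integrable_on cbox a b"
    and int_eq: "integral (cbox a b) (\<lambda>y. \<bar>f y - q\<bar>) =
        (LINT y|lborel. indicator (cbox a b) y *\<^sub>R \<bar>f y - q\<bar>)" for a b q
  proof -
    have "set_integrable lborel (cbox a b) (\<lambda>y. \<bar>f y - q\<bar>)" unfolding set_integrable_def by (rule int_cbox)
    from set_borel_integral_eq_integral[OF this]
    show "(\<lambda>y. \<bar>f y - q\<bar>) integrable_on cbox a b"
     "integral (cbox a b) (\<lambda>y. \<bar>f y - q\<bar>) = (LINT y|lborel. indicator (cbox a b) y *\<^sub>R \<bar>f y - q\<bar>)"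
      by (auto simp: set_lebesgue_integral_def)
  qed
  have "\<exists>N. negligible N \<and> (\<forall>x e. x \<notin> N \<longrightarrow> 0 < e \<longrightarrow> (\<exists>d>0. \<forall>h. 0 < h \<and> h < d \<longrightarrow>
     norm (integral (?Q h x) (\<lambda>y. \<bar>f y - q\<bar>) /\<^sub>R h ^ CARD('n) - \<bar>f x - q\<bar>) < e))" for q
    using integrable_ccontinuous_explicit[OF int_on[of q]] by (metis DIM_cart DIM_real mult_1_right)
  then obtain N where N: "\<And>q. negligible (N q)" and
    conv: "\<And>q x e. x \<notin> N q \<Longrightarrow> 0 < e \<Longrightarrow> (\<exists>d>0. \<forall>h. 0 < h \<and> h < d \<longrightarrow>
     norm (integral (?Q h x) (\<lambda>y. \<bar>f y - q\<bar>) /\<^sub>R h ^ CARD('n) - \<bar>f x - q\<bar>) < e)"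
    by metis
  have "negligible (\<Union>q\<in>\<rat>. N q)"
    using N countable_rat by (intro negligible_countable_Union) auto
  hence AE: "AE x in lborel. x \<notin> (\<Union>q\<in>\<rat>. N q)"
    unfolding negligible_iff_null_sets by (subst AE_completion_iff[symmetric]) (rule AE_not_in)
  show ?thesis using AE
  proof eventually_elim
    case (elim x)
    define B where "B = 1 / bump_mass TYPE('n)"
    have B: "0 < B" using bump_mass_pos[where 'n='n] by (simp add: B_def)
    show ?case
    proof (rule LIMSEQ_I)
      fix e :: real assume e: "0 < e"
      \<comment> \<open>The error is at most \<open>B\<close> times the sum of an average below \<open>2 * e'\<close> and a distance below \<open>e'\<close>.\<close>
      define e' where "e' = e / (4 * B)"
      have e': "0 < e'" using e B by (simp add: e'_def)
      obtain q where q: "q \<in> \<rat>" "f x < q" "q < f x + e'"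
        using Rats_dense_in_real[of "f x" "f x + e'"] e' by auto
      have qx: "\<bar>f x - q\<bar> < e'" using q by simp
      from elim q have "x \<notin> N q" by auto
      from conv[OF this e'] obtain \<delta> where \<delta>: "0 < \<delta>" and
        \<delta>c: "\<And>h. 0 < h \<Longrightarrow> h < \<delta> \<Longrightarrow> norm (integral (?Q h x) (\<lambda>y. \<bar>f y - q\<bar>) /\<^sub>R h ^ CARD('n) - \<bar>f x - q\<bar>) < e'"
        by blast
      obtain m0 :: nat where m0: "1 / Suc m0 < \<delta>" using \<delta> nat_approx_posE by blast
      show "\<exists>no. \<forall>m\<ge>no. norm ((LINT y|lborel. f y * mollifier (1 / Suc m) (y - x)) - f x) < e"
      proof (intro exI[of _ m0] allI impI)
        fix m assume m: "m0 \<le> m"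
        define h where "h = 1 / real (Suc m)"
        have h0: "0 < h" by (simp add: h_def)
        have "h \<le> 1 / Suc m0" using m by (simp add: h_def frac_le)
        hence h\<delta>: "h < \<delta>" using m0 by simp
        have ball: "mollifier h (y - x) = 0" if "y \<notin> cball x (h * real CARD('n))" for y
          using mollifier_outside[OF h0, of "y - x"] that by (simp add: dist_norm norm_minus_commute)
        have cont: "continuous_on UNIV (\<lambda>y. mollifier h (y - x))"
          by (intro continuous_on_compose2[OF continuous_mollifier]) (auto intro: continuous_intros)
        have i1: "integrable lborel (\<lambda>y. f y * mollifier h (y - x))"
          using integrable_mult_compact_support[OF f _ cont ball] by simp
        have i2: "integrable lborel (\<lambda>y. mollifier h (y - x))"
          using integral_mollifier[OF h0, of x] not_integrable_integral_eq by fastforce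
        have "(LINT y|lborel. f y * mollifier h (y - x)) - f x = (LINT y|lborel. f y *
            mollifier h (y - x)) - (LINT y|lborel. f x * mollifier h (y - x))"
          using integral_mollifier[OF h0, of x] by simp
        also have "\<dots> = (LINT y|lborel. (f y - f x) * mollifier h (y - x))"
          using i1 i2 by (simp add: left_diff_distrib)
        finally have eq: "(LINT y|lborel. f y * mollifier h (y - x)) - f x = \<dots>" .
        have i3: "integrable lborel (\<lambda>y. indicator (?Q h x) y *\<^sub>R \<bar>f y - q\<bar> + indicator (?Q h x) y *
            \<bar>f x - q\<bar>)"
          using int_cbox by (intro Bochner_Integration.integrable_add integrable_mult_left)
            (auto intro: integrable_real_indicator simp: emeasure_lborel_cbox_eq)
        have "norm (LINT y|lborel. (f y - f x) * mollifier h (y - x)) \<le>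
          (LINT y|lborel. norm ((f y - f x) * mollifier h (y - x)))"
          by (rule integral_norm_bound)
        also have "\<dots> \<le> (LINT y|lborel. (B / h ^ CARD('n)) * (indicator (?Q h x) y *\<^sub>R \<bar>f y - q\<bar> +
            indicator (?Q h x) y * \<bar>f x - q\<bar>))"
        proof (rule integral_mono)
          show "integrable lborel (\<lambda>y. norm ((f y - f x) * mollifier h (y - x)))"
            using i1 i2 by (intro integrable_norm) (simp add: left_diff_distrib)
          show "integrable lborel (\<lambda>y. (B / h ^ CARD('n)) * (indicator (?Q h x) y *\<^sub>R \<bar>f y - q\<bar> +
              indicator (?Q h x) y * \<bar>f x - q\<bar>))"
            using i3 by (rule integrable_mult_right)
          fix y
          show "norm ((f y - f x) * mollifier h (y - x)) \<le> (B / h ^ CARD('n)) *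
              (indicator (?Q h x) y *\<^sub>R \<bar>f y - q\<bar> + indicator (?Q h x) y * \<bar>f x - q\<bar>)"
          proof (cases "mollifier h (y - x) = 0")
            case False
            hence "x $ i \<le> y $ i \<and> y $ i \<le> x $ i + h" for i
              using mollifier_support[OF h0 False, of i] by auto
            moreover have "One $ i = (1::real)" for i :: 'n
      by (simp add: cart_eq_inner_axis inner_sum_left_Basis axis_in_Basis_iff)
            ultimately have Q: "y \<in> ?Q h x" by (simp add: mem_box_cart)
            have "\<bar>f y - f x\<bar> \<le> \<bar>f y - q\<bar> + \<bar>f x - q\<bar>" by linarith
            moreover have "\<bar>mollifier h (y - x)\<bar> \<le> B / h ^ CARD('n)"
              using mollifier_le[OF h0, of "y - x"] mollifier_nonneg[OF h0, of "y - x"] by (simp add: B_def)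
            ultimately have "\<bar>f y - f x\<bar> * \<bar>mollifier h (y - x)\<bar> \<le> (\<bar>f y - q\<bar> + \<bar>f x - q\<bar>) *
                (B / h ^ CARD('n))"
              by (intro mult_mono) auto
            thus ?thesis using Q by (simp add: abs_mult mult.commute)
          qed (use B h0 in auto)
        qed
        also have "\<dots> = (B / h ^ CARD('n)) * (integral (?Q h x) (\<lambda>y. \<bar>f y - q\<bar>) + h ^ CARD('n) *
            \<bar>f x - q\<bar>)"
        proof -
          have "measure lborel (?Q h x) = h ^ CARD('n)"
            using h0 by (subst measure_lborel_cbox) (auto simp: inner_left_distrib)
          hence "(LINT y|lborel. indicator (?Q h x) y * \<bar>f x - q\<bar>) = h ^ CARD('n) * \<bar>f x - q\<bar>"
            by simp
          thus ?thesis using int_cbox int_eq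
            by (subst integral_mult_right_zero, subst Bochner_Integration.integral_add)
              (auto intro!: integrable_mult_left integrable_real_indicator simp: emeasure_lborel_cbox_eq)
        qed
        also have "\<dots> = B * (integral (?Q h x) (\<lambda>y. \<bar>f y - q\<bar>) /\<^sub>R h ^ CARD('n) + \<bar>f x - q\<bar>)"
          using h0 by (simp add: field_simps)
        also have "\<dots> < B * (3 * e')"
        proof (rule mult_strict_left_mono[OF _ B])
          show "integral (?Q h x) (\<lambda>y. \<bar>f y - q\<bar>) /\<^sub>R h ^ CARD('n) + \<bar>f x - q\<bar> < 3 * e'"
            using \<delta>c[OF h0 h\<delta>] qx unfolding real_norm_def by linarith
        qed
        also have "\<dots> \<le> e" using B e by (simp add: e'_def)
        finally show "norm ((LINT y|lborel. f y * mollifier (1 / Suc m) (y - x)) - f x) < e"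
          unfolding eq[unfolded h_def] h_def .
      qed
    qed
  qed
qed


section \<open>Mollified Sobolev functions\<close>

definition mollify :: "real \<Rightarrow> (real^'n \<Rightarrow> real) \<Rightarrow> real^'n \<Rightarrow> real" where
  "mollify \<epsilon> f x = (LINT y|lborel. f y * mollifier \<epsilon> (y - x))"

text \<open>The mollification of \<open>norm g\<close>, as an extended real; it dominates the gradient of the mollification
  of a function with weak gradient \<open>g\<close>.\<close>

definition mollified_gradient_bound :: "real \<Rightarrow> (real^'n \<Rightarrow> real^'n) \<Rightarrow> real^'n \<Rightarrow> ennreal" where
  "mollified_gradient_bound \<epsilon> g x = (\<integral>\<^sup>+y. ennreal (norm (g y) * mollifier \<epsilon> (y - x)) \<partial>lborel)"

lemma measurable_mollify [measurable]:
  assumes [measurable]: "f \<in> borel_measurable borel"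
  shows "mollify \<epsilon> f \<in> borel_measurable borel"
  unfolding mollify_def by measurable

lemma measurable_mollified_gradient_bound [measurable]:
  assumes [measurable]: "g \<in> borel_measurable borel"
  shows "mollified_gradient_bound \<epsilon> g \<in> borel_measurable borel"
  unfolding mollified_gradient_bound_def by measurable

lemma measurable_component [measurable (raw)]:
  fixes g :: "'b \<Rightarrow> real^'n"
  assumes "g \<in> borel_measurable M"
  shows "(\<lambda>x. g x $ i) \<in> borel_measurable M"
  using assms by (rule borel_measurable_continuous_on[rotated])
    (intro linear_continuous_on bounded_linear_vec_nth)

lemma locally_integrable_component:
  assumes "locally_integrable (g :: real^'n \<Rightarrow> real^'n)"
  shows "locally_integrable (\<lambda>x. g x $ i)"
  unfolding locally_integrable_def set_integrable_def
proof (intro allI impI)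
  fix K :: "(real^'n) set" assume "compact K"
  hence "integrable lebesgue (\<lambda>x. indicator K x *\<^sub>R g x)"
    using assms unfolding locally_integrable_def set_integrable_def by blast
  from integrable_bounded_linear[OF bounded_linear_vec_nth[of i] this]
  show "integrable lebesgue (\<lambda>x. indicator K x *\<^sub>R g x $ i)" by simp
qed

lemma translated_outside:
  fixes \<psi> :: "real^'n \<Rightarrow> real"
  assumes "\<And>x. x \<notin> cball 0 R \<Longrightarrow> \<psi> x = 0" "y \<notin> cball a R"
  shows "\<psi> (y - a) = 0"
  using assms by (simp add: dist_norm norm_minus_commute)

lemma integrable_mult_mollifier:
  fixes f :: "real^'n \<Rightarrow> real"
  assumes "0 < \<epsilon>" "locally_integrable f" and [measurable]: "f \<in> borel_measurable borel"
  shows "integrable lborel (\<lambda>y. f y * mollifier \<epsilon> (y - a))"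
    and "integrable lborel (\<lambda>y. f y * partial_deriv i (mollifier \<epsilon>) (y - a))"
proof -
  have c: "continuous_on UNIV (\<lambda>y::real^'n. mollifier \<epsilon> (y - a))"
    by (rule continuous_on_compose2[OF continuous_mollifier]) (auto intro: continuous_intros)
  show "integrable lborel (\<lambda>y. f y * mollifier \<epsilon> (y - a))"
    using translated_outside[OF mollifier_outside[OF assms(1)]]
    by (intro integrable_mult_compact_support[OF assms(2) _ c, of a "\<epsilon> * real CARD('n)"]) auto
  have c: "continuous_on UNIV (\<lambda>y::real^'n. partial_deriv i (mollifier \<epsilon>) (y - a))"
    by (rule continuous_on_compose2[OF continuous_partial_mollifier]) (auto intro: continuous_intros)
  show "integrable lborel (\<lambda>y. f y * partial_deriv i (mollifier \<epsilon>) (y - a))"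
    using translated_outside[OF partial_mollifier_outside[OF assms(1)]]
    by (intro integrable_mult_compact_support[OF assms(2) _ c, of a "\<epsilon> * real CARD('n)"]) auto
qed

lemma measurable_partial_mollifier [measurable]:
  "partial_deriv i (mollifier \<epsilon> :: real^'n \<Rightarrow> real) \<in> borel_measurable borel"
  by (rule borel_measurable_continuous_onI[OF continuous_partial_mollifier])

lemma weak_gradient_mollifier:
  fixes v :: "real^'n \<Rightarrow> real"
  assumes wg: "has_weak_gradient v g" and \<epsilon>: "0 < \<epsilon>"
    and [measurable]: "v \<in> borel_measurable borel" "g \<in> borel_measurable borel"
  shows "(LINT y|lborel. v y * partial_deriv i (mollifier \<epsilon>) (y - a)) =
     - (LINT y|lborel. g y $ i * mollifier \<epsilon> (y - a))"
proof -
  have "(LINT y|lebesgue. v y * partial_deriv i (\<lambda>y. mollifier \<epsilon> (y - a)) y) =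
     - (LINT y|lebesgue. g y $ i * mollifier \<epsilon> (y - a))"
    using wg mollifier_test_function[OF \<epsilon>, of a] unfolding has_weak_gradient_def by blast
  hence "(LINT y|lebesgue. v y * partial_deriv i (mollifier \<epsilon>) (y - a)) =
     - (LINT y|lebesgue. g y $ i * mollifier \<epsilon> (y - a))"
    by (simp only: partial_deriv_translate[OF mollifier_differentiable])
  thus ?thesis by (subst (asm) (1 2) integral_completion) auto
qed

text \<open>The fundamental theorem of calculus along the segment from \<open>a\<close> to \<open>a + h\<close>.\<close>

lemma mollifier_increment:
  fixes y a h :: "real^'n"
  shows "(LINT c|lborel. indicator {0..1} c *\<^sub>R - (\<Sum>i\<in>UNIV. h $ i *
      partial_deriv i (mollifier \<epsilon>) (y - (a + c *\<^sub>R h)))) =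
    mollifier \<epsilon> (y - (a + h)) - mollifier \<epsilon> (y - a)"
proof -
  have der: "((\<lambda>c. mollifier \<epsilon> (y - (a + c *\<^sub>R h))) has_vector_derivative
      - (\<Sum>i\<in>UNIV. h $ i * partial_deriv i (mollifier \<epsilon>) (y - (a + c *\<^sub>R h)))) (at c within {0..1})" for c
  proof -
    have "((\<lambda>c. y - (a + c *\<^sub>R h)) has_derivative (\<lambda>t. - (t *\<^sub>R h))) (at c within {0..1})"
      by (auto intro!: derivative_eq_intros)
    from has_derivative_compose[OF this has_derivative_partial_derivs[OF mollifier_differentiable]]
    show ?thesis
      by (simp add: has_vector_derivative_def sum_negf sum_distrib_left mult.assoc)
  qed
  have cont: "continuous_on {0..1} (\<lambda>c. - (\<Sum>i\<in>UNIV. h $ i * partial_deriv i (mollifier \<epsilon>) (y - (a +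
      c *\<^sub>R h))))"
    by (intro continuous_intros continuous_on_compose2[OF continuous_partial_mollifier]) auto
  show ?thesis using integral_FTC_atLeastAtMost[OF _ der cont] by simp
qed

text \<open>The increment of the mollifier between
  \<open>x\<close> and \<open>z\<close> is a segment integral of its partial derivatives; multiplying by \<open>v\<close> and exchanging the
  integrals, the inner integral pairs \<open>v\<close> with derivatives of the test function
  \<open>\<lambda>y. mollifier \<epsilon> (y - a)\<close>, where the definition of the weak gradient applies.\<close>

lemma mollify_line_dominated:
  fixes v :: "real^'n \<Rightarrow> real"
  assumes wg: "has_weak_gradient v g" and \<epsilon>: "0 < \<epsilon>"
    and [measurable]: "v \<in> borel_measurable borel" "g \<in> borel_measurable borel"
  shows "line_dominated (mollify \<epsilon> v) (mollified_gradient_bound \<epsilon> g)"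
  unfolding line_dominated_def
proof (intro allI)
  fix x z :: "real^'n"
  define h where "h = z - x"
  let ?D = "\<lambda>i. partial_deriv i (mollifier \<epsilon> :: real^'n \<Rightarrow> real)"
  let ?G = "\<lambda>y c. - (\<Sum>i\<in>UNIV. h $ i * ?D i (y - (x + c *\<^sub>R h)))"
  let ?F = "\<lambda>y c::real. v y * (indicator {0..1} c *\<^sub>R ?G y c)"
  have lv: "locally_integrable v" and lg: "locally_integrable g"
    using wg by (auto simp: has_weak_gradient_def)
  note lgi = locally_integrable_component[OF lg]
  define R where "R = \<epsilon> * real CARD('n) + norm h"
  have bounded_D: "\<exists>B. \<forall>x. \<bar>?D i x\<bar> \<le> B" for i
  proof -
    have "compact (?D i ` cball 0 (\<epsilon> * real CARD('n)))"
      by (intro compact_continuous_image continuous_on_subset[OF continuous_partial_mollifier]) auto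
    from compact_imp_bounded[OF this] obtain B where B: "\<And>x. x \<in> cball 0 (\<epsilon> * real CARD('n)) \<Longrightarrow>
        \<bar>?D i x\<bar> \<le> B"
      unfolding bounded_iff real_norm_def by blast
    have "\<bar>?D i x\<bar> \<le> \<bar>B\<bar>" for x
    proof (cases "x \<in> cball 0 (\<epsilon> * real CARD('n))")
      case True thus ?thesis using B[of x] by linarith
    next
      case False thus ?thesis using partial_mollifier_outside[OF \<epsilon> False] by simp
    qed
    thus ?thesis by blast
  qed
  then obtain B where B: "\<And>i x. \<bar>?D i x\<bar> \<le> B i" by metis
  define BB where "BB = (\<Sum>i\<in>UNIV. \<bar>h $ i\<bar> * B i)"
  have G_le: "\<bar>?G y c\<bar> \<le> BB" for y c
  proof -
    have "\<bar>?G y c\<bar> \<le> (\<Sum>i\<in>UNIV. \<bar>h $ i * ?D i (y - (x + c *\<^sub>R h))\<bar>)"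
      by (simp add: sum_abs)
    also have "\<dots> \<le> BB" unfolding BB_def by (intro sum_mono) (auto simp: abs_mult B mult_left_mono)
    finally show ?thesis .
  qed
  \<comment> \<open>Along the whole segment the derivatives are supported in one fixed ball around \<open>x\<close>.\<close>
  have G_out: "?G y c = 0" if "y \<notin> cball x R" "c \<in> {0..1}" for y c
  proof -
    have "norm (c *\<^sub>R h) \<le> norm h" using that(2) by (simp add: mult_left_le_one_le)
    hence "y - (x + c *\<^sub>R h) \<notin> cball 0 (\<epsilon> * real CARD('n))"
      using that(1) norm_triangle_ineq[of "y - (x + c *\<^sub>R h)" "c *\<^sub>R h"]
      by (auto simp: R_def dist_norm norm_minus_commute algebra_simps)
    from partial_mollifier_outside[OF \<epsilon> this] show ?thesis by simp
  qed
  have F_le: "norm (?F y c) \<le> (BB * indicator {0..1} c) * norm (indicator (cball x R) y *\<^sub>R v y)" for y c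
    using G_le[of y c] G_out[of y c]
    by (cases "c \<in> {0..1}"; cases "y \<in> cball x R")
      (auto simp: abs_mult mult.commute[of BB] simp del: mem_cball intro!: mult_left_mono)
  have BB: "0 \<le> BB" using G_le[of 0 0] by linarith
  have meas [measurable]: "(\<lambda>(y, c). ?F y c) \<in> borel_measurable (lborel \<Otimes>\<^sub>M lborel)"
    by measurable
  have int_v: "integrable lborel (\<lambda>y. indicator (cball x R) y *\<^sub>R v y)"
    by (rule locally_integrable_lborel[OF lv]) auto
  \<comment> \<open>\<open>F_le\<close> dominates the integrand by a product of integrable functions of \<open>y\<close> and of \<open>c\<close>.\<close>
  have int_pair: "integrable (lborel \<Otimes>\<^sub>M lborel) (\<lambda>(y, c). ?F y c)"
  proof (rule integrableI_bounded)
    have "(\<integral>\<^sup>+p. ennreal (norm (case p of (y, c) \<Rightarrow> ?F y c)) \<partial>(lborel \<Otimes>\<^sub>M lborel)) =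
        (\<integral>\<^sup>+y. \<integral>\<^sup>+c. ennreal (norm (?F y c)) \<partial>lborel \<partial>lborel)"
      by (subst lborel.nn_integral_fst[symmetric]) auto
    also have "\<dots> \<le> (\<integral>\<^sup>+y. \<integral>\<^sup>+c. ennreal (norm (indicator (cball x R) y *\<^sub>R v y)) * ennreal BB *
        indicator {0..1::real} c \<partial>lborel \<partial>lborel)"
    proof (intro nn_integral_mono)
      fix y c
      have "ennreal (norm (?F y c)) \<le> ennreal ((BB * indicator {0..1} c) *
          norm (indicator (cball x R) y *\<^sub>R v y))"
        by (intro ennreal_leI F_le)
      thus "ennreal (norm (?F y c)) \<le> ennreal (norm (indicator (cball x R) y *\<^sub>R v y)) *
          ennreal BB * indicator {0..1::real} c"
        using BB by (cases "c \<in> {0..1}") (auto simp: ennreal_mult mult_ac)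
    qed
    also have "\<dots> = (\<integral>\<^sup>+y. ennreal (norm (indicator (cball x R) y *\<^sub>R v y)) * ennreal BB \<partial>lborel)"
      by (simp add: nn_integral_cmult_indicator)
    also have "\<dots> = (\<integral>\<^sup>+y. ennreal (norm (indicator (cball x R) y *\<^sub>R v y)) \<partial>lborel) * ennreal BB"
      using borel_measurable_integrable[OF int_v] by (intro nn_integral_multc) simp
    also have "\<dots> < \<infinity>"
      using int_v by (simp add: integrable_iff_bounded ennreal_mult_less_top)
    finally show "(\<integral>\<^sup>+p. ennreal (norm (case p of (y, c) \<Rightarrow> ?F y c)) \<partial>(lborel \<Otimes>\<^sub>M lborel)) < \<infinity>" .
  qed (rule meas)
  have inner: "norm (LINT y|lborel. ?F y c) \<le> ennreal (norm h) * mollified_gradient_bound \<epsilon> g (x +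
      c *\<^sub>R h) * indicator {0..1} c"
    if "c \<in> {0..1}" for c
  proof -
    let ?a = "x + c *\<^sub>R h"
    have "(LINT y|lborel. ?F y c) = (LINT y|lborel. - (\<Sum>i\<in>UNIV. h $ i * (v y * ?D i (y - ?a))))"
      using that by (simp add: sum_distrib_left mult_ac)
    also have "\<dots> = - (\<Sum>i\<in>UNIV. h $ i * (LINT y|lborel. v y * ?D i (y - ?a)))"
      using integrable_mult_mollifier(2)[OF \<epsilon> lv] by (simp add: Bochner_Integration.integral_sum)
    also have "\<dots> = (\<Sum>i\<in>UNIV. h $ i * (LINT y|lborel. g y $ i * mollifier \<epsilon> (y - ?a)))"
      by (simp add: weak_gradient_mollifier[OF wg \<epsilon>] sum_negf)
    also have "\<dots> = (LINT y|lborel. (\<Sum>i\<in>UNIV. h $ i * (g y $ i * mollifier \<epsilon> (y - ?a))))"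
      using integrable_mult_mollifier(1)[OF \<epsilon> lgi] by (simp add: Bochner_Integration.integral_sum)
    also have "\<dots> = (LINT y|lborel. (h \<bullet> g y) * mollifier \<epsilon> (y - ?a))"
      by (simp add: inner_vec_def sum_distrib_right mult.assoc)
    finally have eq: "(LINT y|lborel. ?F y c) = \<dots>" .
    have "integrable lborel (\<lambda>y. (h \<bullet> g y) * mollifier \<epsilon> (y - ?a))"
      using integrable_mult_mollifier(1)[OF \<epsilon> lgi] 
      by (simp add: inner_vec_def sum_distrib_right mult.assoc)
    hence "ennreal (norm (LINT y|lborel. (h \<bullet> g y) * mollifier \<epsilon> (y - ?a))) \<le>
        (\<integral>\<^sup>+y. ennreal (norm ((h \<bullet> g y) * mollifier \<epsilon> (y - ?a))) \<partial>lborel)"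
      by (rule integral_norm_bound_ennreal)
    also have "\<dots> \<le> (\<integral>\<^sup>+y. ennreal (norm h) * ennreal (norm (g y) * mollifier \<epsilon> (y - ?a)) \<partial>lborel)"
    proof (intro nn_integral_mono)
      fix y
      have "norm ((h \<bullet> g y) * mollifier \<epsilon> (y - ?a)) \<le> norm h * (norm (g y) * mollifier \<epsilon> (y - ?a))"
        using mollifier_nonneg[OF \<epsilon>, of "y - ?a"] Cauchy_Schwarz_ineq2[of h "g y"]
        by (simp add: abs_mult mult_right_mono mult.assoc[symmetric])
      thus "ennreal (norm ((h \<bullet> g y) * mollifier \<epsilon> (y - ?a))) \<le>
          ennreal (norm h) * ennreal (norm (g y) * mollifier \<epsilon> (y - ?a))"
        using mollifier_nonneg[OF \<epsilon>, of "y - ?a"] by (simp add: ennreal_mult[symmetric] ennreal_leI)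
    qed
    also have "\<dots> = ennreal (norm h) * mollified_gradient_bound \<epsilon> g ?a"
      unfolding mollified_gradient_bound_def by (rule nn_integral_cmult) measurable
    finally show ?thesis unfolding eq using that by simp
  qed
  have "mollify \<epsilon> v z - mollify \<epsilon> v x = (LINT y|lborel. v y * (mollifier \<epsilon> (y - (x +
      h)) - mollifier \<epsilon> (y - x)))"
    using integrable_mult_mollifier(1)[OF \<epsilon> lv] by (simp add: mollify_def h_def right_diff_distrib)
  also have "\<dots> = (LINT y|lborel. LINT c|lborel. ?F y c)"
    unfolding mollifier_increment[symmetric] by simp
  also have "\<dots> = (LINT c|lborel. LINT y|lborel. ?F y c)"
    by (rule lborel_pair.Fubini_integral[OF int_pair, symmetric])
  finally have diff: "mollify \<epsilon> v z - mollify \<epsilon> v x = (LINT c|lborel. LINT y|lborel. ?F y c)" .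
  have "integrable lborel (\<lambda>c. LINT y|lborel. ?F y c)"
    by (rule lborel_pair.integrable_snd[OF int_pair])
  hence "ennreal (norm (LINT c|lborel. LINT y|lborel. ?F y c)) \<le>
      (\<integral>\<^sup>+c. norm (LINT y|lborel. ?F y c) \<partial>lborel)"
    by (rule integral_norm_bound_ennreal)
  also have "\<dots> \<le> (\<integral>\<^sup>+c. ennreal (norm h) * (mollified_gradient_bound \<epsilon> g (x + c *\<^sub>R h) *
      indicator {0<..1} c) \<partial>lborel)"
  proof (intro nn_integral_mono_AE)
    have "AE c in lborel. c \<noteq> (0::real)" by (rule AE_lborel_singleton)
    thus "AE c in lborel. ennreal (norm (LINT y|lborel. ?F y c)) \<le>
       ennreal (norm h) * (mollified_gradient_bound \<epsilon> g (x + c *\<^sub>R h) * indicator {0<..1} c)"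
    proof eventually_elim
      case (elim c)
      show ?case
      proof (cases "c \<in> {0..1}")
        case True
        thus ?thesis using inner[OF True] elim by (simp add: mult.assoc)
      qed simp
    qed
  qed
  also have "\<dots> = ennreal (norm h) * (\<integral>\<^sup>+c\<in>{0<..1}. mollified_gradient_bound \<epsilon> g (x + c *\<^sub>R h) \<partial>lborel)"
    by (rule nn_integral_cmult) measurable
  finally show "ennreal \<bar>mollify \<epsilon> v x - mollify \<epsilon> v z\<bar> \<le> ennreal (dist x z) *
      (\<integral>\<^sup>+c\<in>{0<..1}. mollified_gradient_bound \<epsilon> g (x + c *\<^sub>R (z - x)) \<partial>lborel)"
    unfolding diff[symmetric] by (simp add: h_def dist_norm abs_minus_commute norm_minus_commute)
qed


section \<open>The Sobolev energy controls the fractional energy\<close>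

text \<open>Weak gradients are defined for functions on \<open>real^'n\<close>, so the ambient space is specialised here.\<close>

locale muckenhoupt_vec = muckenhoupt w p K d
  for w :: "real^'n \<Rightarrow> real" and p K :: real and d :: nat
begin

text \<open>The mollifier is bounded by a multiple of \<open>\<epsilon>^(-d)\<close> and supported within distance \<open>\<epsilon> d\<close> of the
  origin. The radius is \<open>\<epsilon> (d + 1)\<close> because the average is over an open ball.\<close>

lemma mollified_gradient_bound_le_avg:
  assumes \<epsilon>: "0 < \<epsilon>" and [measurable]: "g \<in> borel_measurable borel"
  shows "mollified_gradient_bound \<epsilon> g x \<le>
    ennreal (unit_ball_vol (real d) * (real d + 1) ^ d / bump_mass TYPE('n)) * avg (\<epsilon> * (real d +
    1)) (\<lambda>y. ennreal (norm (g y))) x"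
proof -
  let ?r = "\<epsilon> * (real d + 1)"
  let ?m = "1 / (bump_mass TYPE('n) * \<epsilon> ^ d)"
  have d: "d = CARD('n)" using dim by simp
  have r: "0 < ?r" using \<epsilon> by (intro mult_pos_pos) auto
  have m: "0 < ?m" using bump_mass_pos[where 'n='n] \<epsilon> by simp
  have "mollified_gradient_bound \<epsilon> g x \<le> (\<integral>\<^sup>+y. ennreal ?m * (ennreal (norm (g y)) *
      indicator (ball x ?r) y) \<partial>lborel)"
    unfolding mollified_gradient_bound_def
  proof (intro nn_integral_mono)
    fix y
    show "ennreal (norm (g y) * mollifier \<epsilon> (y - x)) \<le> ennreal ?m * (ennreal (norm (g y)) *
        indicator (ball x ?r) y)"
    proof (cases "y \<in> ball x ?r")
      case True
      have "norm (g y) * mollifier \<epsilon> (y - x) \<le> ?m * norm (g y)"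
        using mult_left_mono[OF mollifier_le[OF \<epsilon>, of "y - x"], of "norm (g y)"]
        by (simp add: d mult.commute)
      thus ?thesis using True m by (simp add: ennreal_mult[symmetric] ennreal_leI del: mem_ball)
    next
      case False
      have "y - x \<notin> cball 0 (\<epsilon> * real CARD('n))"
        using False \<epsilon> by (auto simp: d dist_norm norm_minus_commute algebra_simps)
      hence "mollifier \<epsilon> (y - x) = 0" by (rule mollifier_outside[OF \<epsilon>])
      thus ?thesis by simp
    qed
  qed
  also have "\<dots> = ennreal ?m * (\<integral>\<^sup>+y\<in>ball x ?r. ennreal (norm (g y)) \<partial>lborel)"
    by (rule nn_integral_cmult) measurable
  also have "ennreal ?m = ennreal (unit_ball_vol (real d) * (real d + 1) ^ d / bump_mass TYPE('n)) *
      ennreal (1 / ball_vol d ?r)"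
  proof -
    let ?V = "unit_ball_vol (real d)" and ?q = "(real d + 1) ^ d"
    have V: "0 < ?V" and q: "0 < ?q" using unit_ball_vol_pos[of "real d"] by auto
    have "ball_vol d ?r = ?V * (\<epsilon> ^ d * ?q)"
      by (simp only: ball_vol_def power_mult_distrib)
    hence "?V * ?q / bump_mass TYPE('n) * (1 / ball_vol d ?r) = ?m"
      using less_imp_neq[OF V] less_imp_neq[OF q] by simp
    thus ?thesis
      using bump_mass_pos[where 'n='n] vol_pos[OF r] V q by (simp add: ennreal_mult[symmetric] less_imp_le del: times_divide_eq_right times_divide_eq_left)
  qed
  finally show ?thesis by (simp add: avg_def mult.assoc)
qed

lemma mollified_gradient_energy:
  "\<exists>C\<ge>0. \<forall>\<epsilon> g. 0 < \<epsilon> \<longrightarrow> g \<in> borel_measurable borel \<longrightarrow>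
    (\<integral>\<^sup>+x. pw (mollified_gradient_bound \<epsilon> g x) * ennreal (w x) \<partial>lborel) \<le>
      ennreal C * (\<integral>\<^sup>+x. pw (ennreal (norm (g x))) * ennreal (w x) \<partial>lborel)"
proof -
  define c where "c = unit_ball_vol (real d) * (real d + 1) ^ d / bump_mass TYPE('n)"
  have c: "0 \<le> c" using bump_mass_pos[where 'n='n] unit_ball_vol_pos[of "real d"] by (simp add: c_def)
  have "(\<integral>\<^sup>+x. pw (mollified_gradient_bound \<epsilon> g x) * ennreal (w x) \<partial>lborel) \<le>
      ennreal (c powr p * avg_const) * (\<integral>\<^sup>+x. pw (ennreal (norm (g x))) * ennreal (w x) \<partial>lborel)"
    if \<epsilon>: "0 < \<epsilon>" and [measurable]: "g \<in> borel_measurable borel" for \<epsilon> g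
  proof -
    let ?r = "\<epsilon> * (real d + 1)"
    let ?A = "avg ?r (\<lambda>y. ennreal (norm (g y)))"
    have r: "0 < ?r" using \<epsilon> by (intro mult_pos_pos) auto
    have "pw (mollified_gradient_bound \<epsilon> g x) \<le> ennreal (c powr p) * pw (?A x)" for x
    proof -
      have "pw (mollified_gradient_bound \<epsilon> g x) \<le> pw (ennreal c * ?A x)"
        unfolding c_def using p_pos by (intro ennreal_powr_mono mollified_gradient_bound_le_avg \<epsilon>) auto
      thus ?thesis using c p_pos by (simp add: ennreal_powr_cmult)
    qed
    hence "(\<integral>\<^sup>+x. pw (mollified_gradient_bound \<epsilon> g x) * ennreal (w x) \<partial>lborel) \<le>
        (\<integral>\<^sup>+x. ennreal (c powr p) * (pw (?A x) * ennreal (w x)) \<partial>lborel)"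
      by (intro nn_integral_mono) (simp add: mult.assoc[symmetric] mult_right_mono)
    also have "\<dots> = ennreal (c powr p) * (\<integral>\<^sup>+x. pw (?A x) * ennreal (w x) \<partial>lborel)"
      by (rule nn_integral_cmult) measurable
    also have "\<dots> \<le> ennreal (c powr p) * (ennreal avg_const * (\<integral>\<^sup>+x. pw (ennreal (norm (g x))) *
        ennreal (w x) \<partial>lborel))"
      by (intro mult_left_mono avg_bounded[OF r]) auto
    finally show ?thesis using avg_const_nonneg by (simp add: ennreal_mult mult.assoc)
  qed
  thus ?thesis using avg_const_nonneg by (intro exI[of _ "c powr p * avg_const"]) auto
qed

lemma kern_finite:
  assumes "x \<noteq> y"
  shows "kern x y < top"
proof -
  have "0 < mass (diametral_ball x y)" using assms by (intro mass_pos) simp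
  thus ?thesis unfolding kern_def by (simp add: less_top[symmetric] ennreal_mult_eq_top_iff ennreal_inverse_eq_top_iff)
qed

lemma diff_quotient_tendsto:
  assumes "(\<lambda>m. u m x) \<longlonglongrightarrow> v x" "(\<lambda>m. u m y) \<longlonglongrightarrow> v y" "x \<noteq> y"
  shows "(\<lambda>m. diff_quotient s p (u m) x y) \<longlonglongrightarrow> diff_quotient s p v x y"
  unfolding diff_quotient_def
  using assms p_pos by (intro tendsto_ennrealI tendsto_powr' tendsto_intros) auto

text \<open>The bound holds for all mollifications of \<open>v\<close> with the same right-hand side, and the integrands
  converge almost everywhere; Fatou's lemma is applied once to each of the two integrals.\<close>

lemma near_diagonal_sobolev:
  assumes s: "0 < s" "s < 1"
  shows "\<exists>C\<ge>0. \<forall>v g. has_weak_gradient v g \<longrightarrow> v \<in> borel_measurable borel \<longrightarrow> g \<in> borel_measurable borel \<longrightarrow>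
    (\<integral>\<^sup>+y. \<integral>\<^sup>+x. indicator {0<..<1} (dist x y) * diff_quotient s p v x y * kern x y \<partial>lborel \<partial>lborel) \<le>
      ennreal C * (\<integral>\<^sup>+x. pw (ennreal (norm (g x))) * ennreal (w x) \<partial>lborel)"
proof -
  obtain C1 where C1: "0 \<le> C1" "\<And>u f. u \<in> borel_measurable borel \<Longrightarrow> f \<in> borel_measurable borel \<Longrightarrow>
      line_dominated u f \<Longrightarrow>
    (\<integral>\<^sup>+y. \<integral>\<^sup>+x. indicator {0<..<1} (dist x y) * diff_quotient s p u x y * kern x y \<partial>lborel \<partial>lborel) \<le>
      ennreal C1 * (\<integral>\<^sup>+x. pw (f x) * ennreal (w x) \<partial>lborel)"
    using near_diagonal_energy[OF s] by blast
  obtain C2 where C2: "0 \<le> C2" "\<And>\<epsilon> g. 0 < \<epsilon> \<Longrightarrow> g \<in> borel_measurable borel \<Longrightarrow>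
    (\<integral>\<^sup>+x. pw (mollified_gradient_bound \<epsilon> g x) * ennreal (w x) \<partial>lborel) \<le>
      ennreal C2 * (\<integral>\<^sup>+x. pw (ennreal (norm (g x))) * ennreal (w x) \<partial>lborel)"
    using mollified_gradient_energy by blast
  have "(\<integral>\<^sup>+y. \<integral>\<^sup>+x. indicator {0<..<1} (dist x y) * diff_quotient s p v x y *
      kern x y \<partial>lborel \<partial>lborel) \<le>
      ennreal (C1 * C2) * (\<integral>\<^sup>+x. pw (ennreal (norm (g x))) * ennreal (w x) \<partial>lborel)"
    if wg: "has_weak_gradient v g" and [measurable]: "v \<in> borel_measurable borel" "g \<in>
        borel_measurable borel" for v g
  proof -
    let ?u = "\<lambda>m. mollify (1 / Suc m) v"
    let ?\<Phi> = "\<lambda>u x y. indicator {0<..<1} (dist x y) * diff_quotient s p u x y * kern x y"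
    let ?rhs = "ennreal (C1 * C2) * (\<integral>\<^sup>+x. pw (ennreal (norm (g x))) * ennreal (w x) \<partial>lborel)"
    have conv: "AE x in lborel. (\<lambda>m. ?u m x) \<longlonglongrightarrow> v x"
      unfolding mollify_def using wg by (intro mollification_converges) (auto simp: has_weak_gradient_def)
    have bound: "(\<integral>\<^sup>+y. \<integral>\<^sup>+x. ?\<Phi> (?u m) x y \<partial>lborel \<partial>lborel) \<le> ?rhs" for m
    proof -
      have "(\<integral>\<^sup>+y. \<integral>\<^sup>+x. ?\<Phi> (?u m) x y \<partial>lborel \<partial>lborel) \<le>
          ennreal C1 * (\<integral>\<^sup>+x. pw (mollified_gradient_bound (1 / Suc m) g x) * ennreal (w x) \<partial>lborel)"
        by (intro C1 mollify_line_dominated[OF wg]) auto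
      also have "\<dots> \<le> ennreal C1 * (ennreal C2 * (\<integral>\<^sup>+x. pw (ennreal (norm (g x))) *
          ennreal (w x) \<partial>lborel))"
        by (intro mult_left_mono C2) auto
      finally show ?thesis using C1 C2 by (simp add: ennreal_mult mult.assoc)
    qed
    have lim: "?\<Phi> v x y = liminf (\<lambda>m. ?\<Phi> (?u m) x y)"
      if "(\<lambda>m. ?u m x) \<longlonglongrightarrow> v x" "(\<lambda>m. ?u m y) \<longlonglongrightarrow> v y" for x y
    proof (cases "x = y")
      case False
      let ?c = "indicator {0<..<1} (dist x y) * kern x y"
      have "?c < top" using kern_finite[OF False] by (auto simp: indicator_def)
      from ennreal_tendsto_cmult[OF this diff_quotient_tendsto[OF that False]]
      have "(\<lambda>m. ?c * diff_quotient s p (?u m) x y) \<longlonglongrightarrow> ?c * diff_quotient s p v x y" .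
      from lim_imp_Liminf[OF _ this] show ?thesis by (simp add: mult_ac)
    qed (simp add: Liminf_const)
    have "(\<integral>\<^sup>+y. \<integral>\<^sup>+x. ?\<Phi> v x y \<partial>lborel \<partial>lborel) \<le>
        (\<integral>\<^sup>+y. liminf (\<lambda>m. \<integral>\<^sup>+x. ?\<Phi> (?u m) x y \<partial>lborel) \<partial>lborel)"
    proof (rule nn_integral_mono_AE)
      show "AE y in lborel. (\<integral>\<^sup>+x. ?\<Phi> v x y \<partial>lborel) \<le> liminf (\<lambda>m. \<integral>\<^sup>+x. ?\<Phi> (?u m) x y \<partial>lborel)"
        using conv
      proof eventually_elim
        case (elim y)
        have "AE x in lborel. ?\<Phi> v x y = liminf (\<lambda>m. ?\<Phi> (?u m) x y)"
          using conv by eventually_elim (rule lim[OF _ elim])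
        hence "(\<integral>\<^sup>+x. ?\<Phi> v x y \<partial>lborel) = (\<integral>\<^sup>+x. liminf (\<lambda>m. ?\<Phi> (?u m) x y) \<partial>lborel)"
          by (rule nn_integral_cong_AE)
        also have "\<dots> \<le> liminf (\<lambda>m. \<integral>\<^sup>+x. ?\<Phi> (?u m) x y \<partial>lborel)"
          by (rule nn_integral_liminf) measurable
        finally show ?case .
      qed
    qed
    also have "\<dots> \<le> liminf (\<lambda>m. \<integral>\<^sup>+y. \<integral>\<^sup>+x. ?\<Phi> (?u m) x y \<partial>lborel \<partial>lborel)"
      by (rule nn_integral_liminf) measurable
    also have "\<dots> \<le> liminf (\<lambda>m::nat. ?rhs)"
      by (intro Liminf_mono always_eventually allI bound)
    also have "\<dots> = ?rhs" by (simp add: Liminf_const)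
    finally show ?thesis .
  qed
  thus ?thesis using C1(1) C2(1) by (intro exI[of _ "C1 * C2"]) auto
qed

lemma fractional_energy_le_sobolev_energy:
  assumes s: "0 < s" "s < 1"
  shows "\<exists>C\<ge>0. \<forall>v g. has_weak_gradient v g \<longrightarrow> v \<in> borel_measurable borel \<longrightarrow> g \<in> borel_measurable borel \<longrightarrow>
    (\<integral>\<^sup>+y. \<integral>\<^sup>+x. indicator {0<..} (dist x y) * diff_quotient s p v x y * kern x y \<partial>lborel \<partial>lborel) \<le>
      ennreal C * (\<integral>\<^sup>+x. ennreal ((\<bar>v x\<bar> powr p + norm (g x) powr p) * w x) \<partial>lborel)"
proof -
  obtain C1 where C1: "0 \<le> C1" "\<And>v g. has_weak_gradient v g \<Longrightarrow> v \<in> borel_measurable borel \<Longrightarrow> g \<in>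
      borel_measurable borel \<Longrightarrow>
    (\<integral>\<^sup>+y. \<integral>\<^sup>+x. indicator {0<..<1} (dist x y) * diff_quotient s p v x y * kern x y \<partial>lborel \<partial>lborel) \<le>
      ennreal C1 * (\<integral>\<^sup>+x. pw (ennreal (norm (g x))) * ennreal (w x) \<partial>lborel)"
    using near_diagonal_sobolev[OF s] by blast
  obtain C2 where C2: "0 \<le> C2" "\<And>v. v \<in> borel_measurable borel \<Longrightarrow>
    (\<integral>\<^sup>+y. \<integral>\<^sup>+x. indicator {1..} (dist x y) * diff_quotient s p v x y * kern x y \<partial>lborel \<partial>lborel) \<le>
      ennreal C2 * (\<integral>\<^sup>+x. pw (ennreal \<bar>v x\<bar>) * ennreal (w x) \<partial>lborel)"
    using off_diagonal_energy[OF s(1)] by blast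
  have "(\<integral>\<^sup>+y. \<integral>\<^sup>+x. indicator {0<..} (dist x y) * diff_quotient s p v x y * kern x y \<partial>lborel \<partial>lborel) \<le>
      ennreal (C1 + C2) * (\<integral>\<^sup>+x. ennreal ((\<bar>v x\<bar> powr p + norm (g x) powr p) * w x) \<partial>lborel)"
    if wg: "has_weak_gradient v g" and [measurable]: "v \<in> borel_measurable borel" "g \<in>
        borel_measurable borel" for v g
  proof -
    let ?\<Phi> = "\<lambda>A x y. indicator A (dist x y) * diff_quotient s p v x y * kern x y"
    let ?E = "\<integral>\<^sup>+x. ennreal ((\<bar>v x\<bar> powr p + norm (g x) powr p) * w x) \<partial>lborel"
    have le: "(\<integral>\<^sup>+x. pw (ennreal (norm (g x))) * ennreal (w x) \<partial>lborel) \<le> ?E"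
      "(\<integral>\<^sup>+x. pw (ennreal \<bar>v x\<bar>) * ennreal (w x) \<partial>lborel) \<le> ?E"
      using w_pos
      by (auto intro!: nn_integral_mono ennreal_leI mult_right_mono
          simp: ennreal_powr_ennreal ennreal_mult[symmetric] less_imp_le)
    have "?\<Phi> {0<..} x y = ?\<Phi> {0<..<1} x y + ?\<Phi> {1..} x y" for x y
      by (simp add: indicator_def)
    hence "(\<integral>\<^sup>+y. \<integral>\<^sup>+x. ?\<Phi> {0<..} x y \<partial>lborel \<partial>lborel) =
        (\<integral>\<^sup>+y. \<integral>\<^sup>+x. ?\<Phi> {0<..<1} x y \<partial>lborel \<partial>lborel) + (\<integral>\<^sup>+y. \<integral>\<^sup>+x. ?\<Phi> {1..} x y \<partial>lborel \<partial>lborel)"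
      by (simp add: nn_integral_add)
    also have "\<dots> \<le> ennreal C1 * ?E + ennreal C2 * ?E"
      by (intro add_mono order_trans[OF C1(2)[OF wg]] order_trans[OF C2(2)] mult_left_mono le) auto
    also have "\<dots> = ennreal (C1 + C2) * ?E" using C1(1) C2(1) by (simp add: distrib_right)
    finally show ?thesis .
  qed
  thus ?thesis using C1(1) C2(1) by (intro exI[of _ "C1 + C2"]) auto
qed

end


section \<open>Borel representatives and null functions\<close>

lemma locally_integrable_measurable:
  fixes f :: "'a::euclidean_space \<Rightarrow> 'b::{banach, second_countable_topology}"
  assumes "locally_integrable f"
  shows "f \<in> borel_measurable lebesgue"
proof (rule borel_measurable_LIMSEQ_metric)
  fix m :: nat
  have "integrable lebesgue (\<lambda>x. indicator (cball 0 (real m)) x *\<^sub>R f x)"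
    using assms unfolding locally_integrable_def set_integrable_def by auto
  thus "(\<lambda>x. indicator (cball 0 (real m)) x *\<^sub>R f x) \<in> borel_measurable lebesgue"
    by (rule borel_measurable_integrable)
next
  fix x :: 'a
  obtain m0 :: nat where "norm x \<le> real m0" using real_arch_simple by blast
  hence "eventually (\<lambda>m. f x = indicator (cball 0 (real m)) x *\<^sub>R f x) sequentially"
    by (intro eventually_sequentiallyI[of m0]) (auto simp: indicator_def)
  thus "(\<lambda>m. indicator (cball 0 (real m)) x *\<^sub>R f x) \<longlonglongrightarrow> f x"
    by (rule Lim_transform_eventually[OF tendsto_const])
qed

lemma locally_integrable_cong_AE:
  fixes f g :: "'a::euclidean_space \<Rightarrow> 'b::{banach, second_countable_topology}"
  assumes f: "locally_integrable f" and g: "g \<in>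
      borel_measurable lebesgue" and eq: "AE x in lebesgue. f x = g x"
  shows "locally_integrable g"
  unfolding locally_integrable_def set_integrable_def
proof (intro allI impI)
  fix K :: "'a set" assume K: "compact K"
  have [measurable]: "K \<in> sets lebesgue" using borel_compact[OF K] by simp
  have i: "integrable lebesgue (\<lambda>x. indicator K x *\<^sub>R f x)"
    using f K unfolding locally_integrable_def set_integrable_def by blast
  have eq': "AE x in lebesgue. indicator K x *\<^sub>R f x =
      indicator K x *\<^sub>R g x" using eq by eventually_elim simp
  note [measurable] = locally_integrable_measurable[OF f] g
  have "(\<lambda>x. indicator K x *\<^sub>R f x) \<in> borel_measurable lebesgue"
    "(\<lambda>x. indicator K x *\<^sub>R g x) \<in> borel_measurable lebesgue" by measurable
  with i eq' show "integrable lebesgue (\<lambda>x. indicator K x *\<^sub>R g x)"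
    using integrable_cong_AE by blast
qed

lemma borel_representative_vec:
  fixes g :: "'a::euclidean_space \<Rightarrow> real^'n"
  assumes "g \<in> borel_measurable lebesgue"
  obtains g' where "g' \<in> borel_measurable borel" "AE x in lebesgue. g x = g' x"
proof -
  have "\<exists>h\<in>borel_measurable lborel. AE x in lborel. g x $ i = h x" for i
    by (rule completion_ex_borel_measurable_real) (use assms in measurable)
  then obtain h where h: "\<And>i. h i \<in> borel_measurable lborel" "\<And>i. AE x in lborel. g x $ i = h i x"
    by metis
  have "(\<lambda>x. \<chi> i. h i x) \<in> borel_measurable borel"
  proof -
    have "(\<chi> i. h i x) = (\<Sum>i\<in>UNIV. h i x *\<^sub>R axis i 1)" for x
      using basis_expansion[of "\<chi> i. h i x"] by (simp add: scalar_mult_eq_scaleR)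
    moreover have "(\<lambda>x. \<Sum>i\<in>UNIV. h i x *\<^sub>R (axis i 1 :: real^'n)) \<in> borel_measurable borel"
      using h(1) by (intro borel_measurable_sum borel_measurable_scaleR) auto
    ultimately show ?thesis by simp
  qed
  moreover have "AE x in lborel. \<forall>i. g x $ i =
      h i x" using h(2) by (intro AE_all_countable[THEN iffD2]) auto
  hence "AE x in lebesgue. g x = (\<chi> i. h i x)"
    unfolding AE_completion_iff by eventually_elim (simp add: vec_eq_iff)
  ultimately show ?thesis by (rule that)
qed

lemma borel_representative:
  fixes f :: "'a::euclidean_space \<Rightarrow> real"
  assumes "f \<in> borel_measurable lebesgue"
  obtains f' where "f' \<in> borel_measurable borel" "AE x in lebesgue. f x = f' x"
  using completion_ex_borel_measurable_real[OF assms] by (auto simp: AE_completion_iff)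

lemma has_weak_gradient_cong_AE:
  assumes vg: "has_weak_gradient v g" and v': "v' \<in> borel_measurable borel" "AE x in lebesgue. v x =
      v' x"
    and g': "g' \<in> borel_measurable borel" "AE x in lebesgue. g x = g' x"
  shows "has_weak_gradient v' g'"
proof -
  have lv: "locally_integrable v" and lg: "locally_integrable g" using vg by (auto simp: has_weak_gradient_def)
  have m: "v' \<in> borel_measurable lebesgue" "g' \<in> borel_measurable lebesgue"
    using v'(1) g'(1) by (auto intro: measurable_completion)
  have "(LINT x|lebesgue. v' x * partial_deriv i \<phi> x) = - (LINT x|lebesgue. g' x $ i * \<phi> x)"
    if \<phi>: "\<phi> \<in> test_functions" for \<phi> i
  proof -
    have cd: "cont_diff m \<phi>" for m using \<phi> by (simp add: test_functions_def)
    have "\<phi> \<in> borel_measurable borel"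
      using cd[of 0] by (auto intro: borel_measurable_continuous_onI)
    hence \<phi>m: "\<phi> \<in> borel_measurable lebesgue" by (auto intro: measurable_completion)
    have "partial_deriv i \<phi> \<in> borel_measurable borel"
      using cd[of "Suc 0"] by (auto intro: borel_measurable_continuous_onI)
    hence d\<phi>m: "partial_deriv i \<phi> \<in> borel_measurable lebesgue" by (auto intro: measurable_completion)
    note [measurable] = m \<phi>m d\<phi>m locally_integrable_measurable[OF lv] locally_integrable_measurable[OF lg]
    have "(LINT x|lebesgue. v' x * partial_deriv i \<phi> x) = (LINT x|lebesgue. v x * partial_deriv i \<phi> x)"
    proof (rule integral_cong_AE)
      show "AE x in lebesgue. v' x * partial_deriv i \<phi> x = v x * partial_deriv i \<phi> x"
        using v'(2) by eventually_elim simp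
    qed measurable
    moreover have "(LINT x|lebesgue. g' x $ i * \<phi> x) = (LINT x|lebesgue. g x $ i * \<phi> x)"
    proof (rule integral_cong_AE)
      show "AE x in lebesgue. g' x $ i * \<phi> x = g x $ i * \<phi> x"
        using g'(2) by eventually_elim simp
    qed measurable
    ultimately show ?thesis using vg \<phi> by (simp add: has_weak_gradient_def)
  qed
  thus ?thesis
    using locally_integrable_cong_AE[OF lv m(1) v'(2)] locally_integrable_cong_AE[OF lg m(2) g'(2)]
    by (simp add: has_weak_gradient_def)
qed

text \<open>Testing with translated mollifiers shows that every mollification of every component of \<open>g\<close>
  vanishes identically, and these converge to the component almost everywhere.\<close>

lemma weak_gradient_of_null_function:
  fixes v :: "real^'n \<Rightarrow> real"
  assumes vg: "has_weak_gradient v g" and v: "AE x in lebesgue. v x = 0"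
  shows "AE x in lebesgue. g x = 0"
proof -
  have lg: "locally_integrable g" using vg by (auto simp: has_weak_gradient_def)
  obtain g' where g': "g' \<in> borel_measurable borel" "AE x in lebesgue. g x = g' x"
    using borel_representative_vec[OF locally_integrable_measurable[OF lg]] .
  have wg: "has_weak_gradient (\<lambda>_. 0) g'"
    using v by (intro has_weak_gradient_cong_AE[OF vg _ _ g']) auto
  hence lg': "locally_integrable g'" by (auto simp: has_weak_gradient_def)
  have "AE x in lborel. g' x $ i = 0" for i
  proof -
    have "(LINT y|lborel. g' y $ i * mollifier (1 / Suc m) (y - x)) = 0" for m x
      using weak_gradient_mollifier[OF wg, of "1 / Suc m" i x] g'(1) by simp
    moreover have "AE x in lborel. (\<lambda>m. LINT y|lborel. g' y $ i *
        mollifier (1 / Suc m) (y - x)) \<longlonglongrightarrow> g' x $ i"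
      using g'(1) by (intro mollification_converges locally_integrable_component[OF lg']) measurable
    ultimately show ?thesis by (simp add: LIMSEQ_const_iff)
  qed
  hence "AE x in lborel. \<forall>i. g' x $ i = 0" by (intro AE_all_countable[THEN iffD2]) auto
  hence "AE x in lebesgue. g' x = 0" unfolding AE_completion_iff by eventually_elim (simp add: vec_eq_iff)
  with g'(2) show ?thesis by eventually_elim simp
qed

lemma emeasure_lebesgue_ball:
  "0 \<le> r \<Longrightarrow> emeasure lebesgue (ball (x::real^'n) r) = ennreal (ball_vol CARD('n) r)"
  by (simp add: emeasure_completion emeasure_ball ball_vol_def)

text \<open>The \<open>A\<^sub>p\<close> constant and all masses only depend on the weight up to null sets, so the
  representative can be changed to one on the null set where it fails to be positive.\<close>

lemma weight_borel_representative:
  fixes w :: "real^'n \<Rightarrow> real"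
  assumes p: "1 < p" and w: "w \<in> Ap_weights p"
  obtains w' K where "muckenhoupt_vec w' p K CARD('n)" "AE x in lebesgue. w x = w' x"
proof -
  have lw: "locally_integrable w" and pos: "AE x in lebesgue. 0 < w x" and Ap: "Ap_constant p w < \<infinity>"
    using w by (auto simp: Ap_weights_def weight_def)
  obtain w0 where w0: "w0 \<in> borel_measurable borel" "AE x in lebesgue. w x = w0 x"
    using borel_representative[OF locally_integrable_measurable[OF lw]] .
  define w' where "w' = (\<lambda>x. if 0 < w0 x then w0 x else 1)"
  have eq: "AE x in lebesgue. w x = w' x"
    using w0(2) pos by eventually_elim (simp add: w'_def)
  obtain K where K: "Ap_constant p w = ennreal K" "0 \<le> K"
    using Ap by (metis ennreal_cases infinity_ennreal_def order_less_irrefl)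
  have int_eq: "(\<integral>\<^sup>+y\<in>ball x r. ennreal (F (w y)) \<partial>lebesgue) =
      (\<integral>\<^sup>+y\<in>ball x r. ennreal (F (w' y)) \<partial>lborel)" for F x r
    unfolding nn_integral_completion using eq[unfolded AE_completion_iff]
    by (intro nn_integral_cong_AE) (auto elim: eventually_mono)
  have "muckenhoupt_vec w' p K CARD('n)"
    unfolding muckenhoupt_vec_def
  proof
    show "w' \<in> borel_measurable borel" unfolding w'_def using w0(1) by measurable
    show "0 < w' x" for x by (simp add: w'_def)
    show "(\<integral>\<^sup>+y\<in>ball x r. ennreal (w' y) \<partial>lborel) < \<infinity>" for x r
    proof -
      have "integrable lebesgue (\<lambda>y. indicator (cball x r) y *\<^sub>R w y)"
        using lw unfolding locally_integrable_def set_integrable_def by auto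
      hence fin: "(\<integral>\<^sup>+y. ennreal (norm (indicator (cball x r) y *\<^sub>R w y)) \<partial>lebesgue) < \<infinity>"
        by (simp add: integrable_iff_bounded)
      have "(\<integral>\<^sup>+y\<in>ball x r. ennreal (w y) \<partial>lebesgue) \<le>
          (\<integral>\<^sup>+y. ennreal (norm (indicator (cball x r) y *\<^sub>R w y)) \<partial>lebesgue)"
        by (intro nn_integral_mono) (auto simp: indicator_def ennreal_leI)
      thus ?thesis using fin int_eq[of "\<lambda>t. t" x r] by (simp add: le_less_trans)
    qed
    show "(\<integral>\<^sup>+y\<in>ball x r. ennreal (w' y) \<partial>lborel) *
      ennreal_powr (\<integral>\<^sup>+y\<in>ball x r. ennreal (dual_weight p w' y) \<partial>lborel) (p - 1)
        \<le> ennreal (K * ball_vol CARD('n) r powr p)" if r: "0 < r" for x r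
    proof -
      let ?V = "ball_vol CARD('n) r"
      let ?W = "\<integral>\<^sup>+y\<in>ball x r. ennreal (w' y) \<partial>lborel"
      let ?S = "\<integral>\<^sup>+y\<in>ball x r. ennreal (dual_weight p w' y) \<partial>lborel"
      have V: "0 < ?V" using r by (simp add: ball_vol_def)
      have div: "X / emeasure lebesgue (ball x r) = ennreal (1 / ?V) * X" for X
        using V r unfolding emeasure_lebesgue_ball[OF less_imp_le[OF r]] divide_ennreal_def
        by (subst inverse_ennreal) (auto simp: inverse_eq_divide mult.commute)
      have "ball_average w (ball x r) * ennreal_powr (ball_average (\<lambda>x. w x powr (1 / (1 - p))) (ball x r)) (p - 1) \<le> Ap_constant p w"
        unfolding Ap_constant_def using r by (intro SUP_upper2[of "(x, r)"]) auto
      hence "ennreal (1 / ?V) * ?W * ennreal_powr (ennreal (1 / ?V) * ?S) (p - 1) \<le> ennreal K"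
        unfolding ball_average_def div K int_eq[of "\<lambda>t. t"] int_eq[of "\<lambda>t. t powr (1 / (1 - p))"] dual_weight_def .
      hence "ennreal (?V powr p) * (ennreal (1 / ?V) * ?W * ennreal_powr (ennreal (1 / ?V) *
          ?S) (p - 1)) \<le> ennreal (?V powr p) * ennreal K"
        by (rule mult_left_mono) simp
      moreover have "ennreal (?V powr p) * (ennreal (1 / ?V) * ?W * ennreal_powr (ennreal (1 / ?V) *
          ?S) (p - 1)) = ?W * ennreal_powr ?S (p - 1)"
      proof -
        have "?V powr p * ((1 / ?V) * (1 / ?V) powr (p - 1)) = 1"
        proof -
          have "?V powr p = ?V * ?V powr (p - 1)" using V powr_add[of ?V 1 "p - 1"] by simp
          thus ?thesis using V by (simp add: powr_divide)
        qed
        hence "ennreal (?V powr p) * (ennreal (1 / ?V) * ennreal ((1 / ?V) powr (p - 1))) = 1"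
          using V by (simp add: ennreal_mult[symmetric])
        moreover have "ennreal_powr (ennreal (1 / ?V) * ?S) (p - 1) =
            ennreal ((1 / ?V) powr (p - 1)) * ennreal_powr ?S (p - 1)"
          using p V by (intro ennreal_powr_cmult) auto
        moreover have "a * (b * W * (c * S)) = (a * (b * c)) * (W * S)" for a b c W S :: ennreal
          by (simp only: mult_ac)
        ultimately show ?thesis by simp
      qed
      ultimately show ?thesis using K V by (simp add: ennreal_mult mult.commute)
    qed
  qed (use p K in auto)
  thus ?thesis using eq that by blast
qed

text \<open>The kernel bound holds off a null set of the product space; Fubini's theorem, in the order of
  the fractional energy (outer variable \<open>y\<close>), turns it into a bound for almost every \<open>y\<close>.\<close>

lemma kernel_bounds_AE:
  assumes "comparable_kernel l L w k"
  shows "AE y in lebesgue. AE x in lebesgue.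
    l * (w x * w y / weight_of w (ball_between x y)) \<le> k (x, y) \<and>
    k (x, y) \<le> L * (w x * w y / weight_of w (ball_between x y))"
proof -
  let ?P = "\<lambda>x y. l * (w x * w y / weight_of w (ball_between x y)) \<le> k (x, y) \<and>
    k (x, y) \<le> L * (w x * w y / weight_of w (ball_between x y))"
  have "AE z in lborel. case z of (x, y) \<Rightarrow> ?P x y"
    using assms unfolding comparable_kernel_def AE_completion_iff by blast
  hence "AE z in lborel \<Otimes>\<^sub>M lborel. case z of (x, y) \<Rightarrow> ?P x y"
    unfolding lborel_prod .
  hence "AE z in distr (lborel \<Otimes>\<^sub>M lborel) (lborel \<Otimes>\<^sub>M lborel) (\<lambda>(x, y). (y, x)). case z of (x, y) \<Rightarrow> ?P x y"
    by (subst (asm) lborel_pair.distr_pair_swap)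
  from AE_distrD[OF _ this] have "AE z in lborel \<Otimes>\<^sub>M lborel. case z of (y, x) \<Rightarrow> ?P x y"
    by (simp add: case_prod_unfold measurable_pair_swap')
  from lborel_pair.AE_pair[OF this] show ?thesis unfolding AE_completion_iff by simp
qed


section \<open>Comparable kernels and the fractional Poincare inequality\<close>

lemma (in muckenhoupt_vec) mass_eq_weight_of:
  assumes w0: "locally_integrable w0" and eq: "AE x in lebesgue. w0 x = w x"
  shows "ennreal (weight_of w0 (ball c r)) = mass (ball c r)"
    and "0 < r \<Longrightarrow> 0 < weight_of w0 (ball c r)"
proof -
  have "set_integrable lebesgue (cball c r) w0" using w0 by (simp add: locally_integrable_def)
  hence i: "integrable lebesgue (\<lambda>x. indicator (ball c r) x *\<^sub>R w0 x)"
    using set_integrable_subset[of lebesgue "cball c r" w0 "ball c r"]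
    by (simp add: set_integrable_def ball_subset_cball)
  have "AE x in lebesgue. 0 \<le> indicator (ball c r) x *\<^sub>R w0 x"
    using eq by eventually_elim (use w_pos in \<open>auto simp: less_imp_le indicator_def\<close>)
  from nn_integral_eq_integral[OF i this]
  have "ennreal (weight_of w0 (ball c r)) = (\<integral>\<^sup>+x. ennreal (indicator (ball c r) x *\<^sub>R w0 x) \<partial>lebesgue)"
    by (simp add: weight_of_def set_lebesgue_integral_def)
  also have "\<dots> = mass (ball c r)"
    unfolding mass_def nn_integral_completion
    using eq[unfolded AE_completion_iff]
    by (intro nn_integral_cong_AE) (auto elim!: eventually_mono simp: indicator_def)
  finally show 1: "ennreal (weight_of w0 (ball c r)) = mass (ball c r)" .
  show "0 < weight_of w0 (ball c r)" if "0 < r"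
    using mass_pos[OF that, of c] unfolding 1[symmetric] by simp
qed

text \<open>The upper kernel bound, with all functions replaced by Borel representatives. The diagonal is
  excluded because the kernel of the comparison is infinite there.\<close>

lemma (in muckenhoupt_vec) frac_energy_le:
  assumes w0: "locally_integrable w0" and eq: "AE x in lebesgue. w0 x = w x"
    and k: "comparable_kernel l L w0 k" and L: "0 \<le> L" and s: "0 < s" "s < 1"
    and v': "v' \<in> borel_measurable borel" and vv': "AE x in lebesgue. v x = v' x"
  shows "frac_energy k s p v \<le> ennreal (s * (1 - s) * L) *
    (\<integral>\<^sup>+y. \<integral>\<^sup>+x. indicator {0<..} (dist x y) * diff_quotient s p v' x y * kern x y \<partial>lborel \<partial>lborel)"
proof -
  note [measurable] = v'
  let ?\<Phi> = "\<lambda>x y. indicator {0<..} (dist x y) * diff_quotient s p v' x y * kern x y"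
  have bound: "ennreal ((\<bar>v x - v y\<bar> / norm (x - y) powr s) powr p * k (x, y)) \<le> ennreal L * ?\<Phi> x y"
    if "k (x, y) \<le> L * (w0 x * w0 y / weight_of w0 (ball_between x y))" "w0 x = w x" "w0 y = w y"
       "v x = v' x" "v y = v' y" for x y
  proof (cases "x = y")
    case False
    let ?W = "weight_of w0 (ball_between x y)"
    have W: "0 < ?W" "ennreal ?W = mass (diametral_ball x y)"
      unfolding ball_between_def using False by (auto intro!: mass_eq_weight_of[OF w0 eq])
    have kern: "kern x y = ennreal (w x * w y / ?W)"
      unfolding kern_def W(2)[symmetric] using W(1) w_pos[of x] w_pos[of y]
      by (simp add: inverse_ennreal ennreal_mult[symmetric] divide_inverse)
    have "(\<bar>v x - v y\<bar> / norm (x - y) powr s) powr p * k (x, y) \<le>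
        (\<bar>v x - v y\<bar> / norm (x - y) powr s) powr p * (L * (w x * w y / ?W))"
      using that by (intro mult_left_mono) auto
    hence "ennreal ((\<bar>v x - v y\<bar> / norm (x - y) powr s) powr p * k (x, y)) \<le>
        ennreal ((\<bar>v x - v y\<bar> / norm (x - y) powr s) powr p * (L * (w x * w y / ?W)))"
      by (rule ennreal_leI)
    also have "\<dots> = ennreal L * (diff_quotient s p v' x y * kern x y)"
      using L W(1) w_pos[of x] w_pos[of y] that
      by (simp add: kern diff_quotient_def ennreal_mult[symmetric] less_imp_le mult_ac)
    finally show ?thesis using False by (simp add: mult.assoc)
  qed simp
  have "(\<integral>\<^sup>+y. (\<integral>\<^sup>+x. ennreal ((\<bar>v x - v y\<bar> / norm (x - y) powr s) powr p *
      k (x, y)) \<partial>lebesgue) \<partial>lebesgue) \<le>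
      (\<integral>\<^sup>+y. (\<integral>\<^sup>+x. ennreal L * ?\<Phi> x y \<partial>lebesgue) \<partial>lebesgue)"
  proof (rule nn_integral_mono_AE)
    show "AE y in lebesgue. (\<integral>\<^sup>+x. ennreal ((\<bar>v x - v y\<bar> / norm (x - y) powr s) powr p *
        k (x, y)) \<partial>lebesgue) \<le>
       (\<integral>\<^sup>+x. ennreal L * ?\<Phi> x y \<partial>lebesgue)"
      using kernel_bounds_AE[OF k] eq vv'
    proof eventually_elim
      case (elim y)
      have "AE x in lebesgue. ennreal ((\<bar>v x - v y\<bar> / norm (x - y) powr s) powr p * k (x, y)) \<le>
          ennreal L * ?\<Phi> x y"
        using elim(1) eq vv' by eventually_elim (intro bound, use elim in auto)
      thus ?case by (rule nn_integral_mono_AE)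
    qed
  qed
  also have "\<dots> = ennreal L * (\<integral>\<^sup>+y. \<integral>\<^sup>+x. ?\<Phi> x y \<partial>lborel \<partial>lborel)"
    unfolding nn_integral_completion by (simp add: nn_integral_cmult)
  finally have "frac_energy k s p v \<le> ennreal (s * (1 - s)) * (ennreal L *
      (\<integral>\<^sup>+y. \<integral>\<^sup>+x. ?\<Phi> x y \<partial>lborel \<partial>lborel))"
    unfolding frac_energy_def by (intro mult_left_mono) auto
  thus ?thesis using s L by (simp add: ennreal_mult mult.assoc)
qed

text \<open>The double integral is restricted to \<open>x\<close> in \<open>\<Omega>\<close> and \<open>y\<close> in a unit ball \<open>E\<close> disjoint from \<open>\<Omega>\<close>. There
  \<open>v y = 0\<close>, the distance of \<open>x\<close> and \<open>y\<close> is at most a constant \<open>D\<close>, and all the balls with diameter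
  \<open>x y\<close> lie in one big ball, so the integrand is at least a constant times \<open>|v x|^p w(x) w(y)\<close>.\<close>

lemma (in muckenhoupt_vec) fractional_poincare:
  fixes \<Omega> :: "(real^'n) set"
  assumes w0: "locally_integrable w0" and eq: "AE x in lebesgue. w0 x = w x"
    and k: "comparable_kernel l L w0 k" and l: "0 < l" and s: "0 < s" "s < 1"
    and \<Omega>: "bounded \<Omega>" "\<Omega> \<in> sets lebesgue"
  shows "\<exists>c>0. \<forall>v. v \<in> borel_measurable lebesgue \<longrightarrow> (AE x in lebesgue. x \<notin> \<Omega> \<longrightarrow> v x = 0) \<longrightarrow>
    ennreal c * (\<integral>\<^sup>+x\<in>\<Omega>. ennreal (\<bar>v x\<bar> powr p * w0 x) \<partial>lebesgue) \<le> frac_energy k s p v"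
proof -
  obtain R where R: "0 < R" "\<And>x. x \<in> \<Omega> \<Longrightarrow> norm x < R"
    using \<Omega>(1) unfolding bounded_pos by (metis less_add_one le_less_trans add_pos_pos zero_less_one)
  obtain b :: "real^'n" where b: "norm b = R + 1" using vector_choose_size[of "R + 1"] R by auto
  \<comment> \<open>A bound for the distance of a point of \<open>\<Omega>\<close> from a point of \<open>E\<close>, whose norms are below \<open>R\<close> and \<open>R + 2\<close>.\<close>
  define D where "D = 2 * R + 2"
  define W where "W = weight_of w0 (ball 0 (R + D))"
  define E where "E = ball b 1"
  define c where "c = D powr (- (s * p)) * (l / W)"
  have D: "0 < D" using R by (simp add: D_def)
  have W: "0 < W" unfolding W_def using R D by (intro mass_eq_weight_of[OF w0 eq]) auto
  have WE: "0 < weight_of w0 E" unfolding E_def by (intro mass_eq_weight_of[OF w0 eq]) auto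
  have c: "0 < c" using D W l by (simp add: c_def)
  have E: "R < norm y \<and> norm y < R + 2" if "y \<in> E" for y
  proof -
    have d: "norm (b - y) < 1" using that by (simp add: E_def dist_norm)
    have "norm b \<le> norm (b - y) + norm y" using norm_triangle_ineq[of "b - y" y] by simp
    moreover have "norm y \<le> norm b + norm (b - y)" using norm_triangle_ineq4[of b "b - y"] by simp
    ultimately show ?thesis using d b by linarith
  qed
  have bound: "c * (\<bar>v x\<bar> powr p * w0 x) * w0 y \<le> (\<bar>v x - v y\<bar> / norm (x - y) powr s) powr p * k (x, y)"
    if k: "l * (w0 x * w0 y / weight_of w0 (ball_between x y)) \<le> k (x, y)"
      and ww: "w0 x = w x" "w0 y = w y" and xy: "x \<in> \<Omega>" "y \<in> E" and v: "v y = 0" for v x y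
  proof -
    have ne: "x \<noteq> y" using R(2)[OF xy(1)] E[OF xy(2)] by auto
    have dist: "norm (x - y) \<le> D"
      using norm_triangle_ineq4[of x y] R(2)[OF xy(1)] E[OF xy(2)] by (simp add: D_def)
    have sub: "ball_between x y \<subseteq> ball 0 (R + D)"
    proof
      fix z assume "z \<in> ball_between x y"
      hence "dist z (midpoint x y) < dist x y / 2" by (simp add: ball_between_def dist_commute)
      hence "dist z x < dist x y"
        using dist_triangle[of z x "midpoint x y"] by (simp add: dist_midpoint)
      hence "norm z < norm x + D" using norm_triangle_ineq[of "z - x" x] dist by (simp add: dist_norm)
      thus "z \<in> ball 0 (R + D)" using R(2)[OF xy(1)] by simp
    qed
    let ?W = "weight_of w0 (ball_between x y)"
    have W': "0 < ?W" unfolding ball_between_def using ne by (intro mass_eq_weight_of[OF w0 eq]) auto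
    have "ennreal ?W \<le> ennreal W"
      using mass_mono[OF sub] unfolding W_def ball_between_def mass_eq_weight_of(1)[OF w0 eq] .
    hence WW: "?W \<le> W" using W by (subst (asm) ennreal_le_iff) auto
    have "l * (w x * w y) / W \<le> l * (w x * w y) / ?W"
      using l w_pos[of x] w_pos[of y] W' WW W by (intro divide_left_mono mult_nonneg_nonneg) (auto simp: less_imp_le)
    hence k': "l / W * (w x * w y) \<le> k (x, y)" using k ww by simp
    have q: "D powr (- (s * p)) * \<bar>v x\<bar> powr p \<le> (\<bar>v x - v y\<bar> / norm (x - y) powr s) powr p"
    proof -
      have "\<bar>v x\<bar> powr p / D powr (s * p) \<le> \<bar>v x\<bar> powr p / norm (x - y) powr (s * p)"
        using dist ne s p_pos D by (intro divide_left_mono powr_mono2 mult_pos_pos) auto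
      moreover have "D powr (- (s * p)) * \<bar>v x\<bar> powr p = \<bar>v x\<bar> powr p / D powr (s * p)"
        by (simp add: powr_minus_divide)
      moreover have "(\<bar>v x\<bar> / norm (x - y) powr s) powr p = \<bar>v x\<bar> powr p / norm (x - y) powr (s * p)"
        by (simp add: powr_divide powr_powr)
      ultimately show ?thesis using v by simp
    qed
    have "(D powr (- (s * p)) * \<bar>v x\<bar> powr p) * (l / W * (w x * w y)) \<le>
        (\<bar>v x - v y\<bar> / norm (x - y) powr s) powr p * k (x, y)"
      using q k' l W w_pos[of x] w_pos[of y] by (intro mult_mono) (auto simp: less_imp_le)
    thus ?thesis using ww by (simp add: c_def mult_ac)
  qed
  define c' where "c' = s * (1 - s) * c * weight_of w0 E"
  have "ennreal c' * (\<integral>\<^sup>+x\<in>\<Omega>. ennreal (\<bar>v x\<bar> powr p * w0 x) \<partial>lebesgue) \<le> frac_energy k s p v"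
    if [measurable]: "v \<in> borel_measurable lebesgue" and v0: "AE x in lebesgue. x \<notin> \<Omega> \<longrightarrow> v x = 0" for v
  proof -
    note [measurable] = locally_integrable_measurable[OF w0] \<Omega>(2)
    have [measurable]: "E \<in> sets lebesgue" by (simp add: E_def)
    let ?I = "\<integral>\<^sup>+x\<in>\<Omega>. ennreal (\<bar>v x\<bar> powr p * w0 x) \<partial>lebesgue"
    let ?J = "\<lambda>y. \<integral>\<^sup>+x. ennreal ((\<bar>v x - v y\<bar> / norm (x - y) powr s) powr p * k (x, y)) \<partial>lebesgue"
    have "(\<integral>\<^sup>+y. (ennreal c * ?I) * (ennreal (w0 y) * indicator E y) \<partial>lebesgue) \<le> (\<integral>\<^sup>+y. ?J y \<partial>lebesgue)"
    proof (rule nn_integral_mono_AE)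
      show "AE y in lebesgue. (ennreal c * ?I) * (ennreal (w0 y) * indicator E y) \<le> ?J y"
        using kernel_bounds_AE[OF k] eq v0
      proof eventually_elim
        case (elim y)
        show ?case
        proof (cases "y \<in> E")
          case True
          hence "y \<notin> \<Omega>" using E R(2) by fastforce
          hence vy: "v y = 0" using elim by blast
          have w0y: "0 < w0 y" using elim(2) w_pos by simp
          have "(\<integral>\<^sup>+x. ennreal (c * w0 y) * (ennreal (\<bar>v x\<bar> powr p * w0 x) *
              indicator \<Omega> x) \<partial>lebesgue) \<le> ?J y"
          proof (rule nn_integral_mono_AE)
            show "AE x in lebesgue. ennreal (c * w0 y) * (ennreal (\<bar>v x\<bar> powr p * w0 x) *
                indicator \<Omega> x) \<le>
               ennreal ((\<bar>v x - v y\<bar> / norm (x - y) powr s) powr p * k (x, y))"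
              using elim(1) eq
            proof eventually_elim
              case (elim x)
              show ?case
              proof (cases "x \<in> \<Omega>")
                case inside: True
                have "c * (\<bar>v x\<bar> powr p * w0 x) * w0 y \<le>
                    (\<bar>v x - v y\<bar> / norm (x - y) powr s) powr p * k (x, y)"
                  using elim \<open>w0 y = w y\<close> vy True inside by (intro bound) auto
                moreover have "0 \<le> w0 x" using elim(2) w_pos[of x] by simp
                ultimately show ?thesis using inside c w0y
                  by (simp add: ennreal_mult[symmetric] mult_ac ennreal_leI)
              qed simp
            qed
          qed
          moreover have "(\<integral>\<^sup>+x. ennreal (c * w0 y) * (ennreal (\<bar>v x\<bar> powr p * w0 x) *
              indicator \<Omega> x) \<partial>lebesgue) = ennreal (c * w0 y) * ?I"
            by (rule nn_integral_cmult) measurable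
          ultimately show ?thesis using True c w0y by (simp add: ennreal_mult mult_ac)
        qed simp
      qed
    qed
    moreover have "(\<integral>\<^sup>+y. (ennreal c * ?I) * (ennreal (w0 y) * indicator E y) \<partial>lebesgue) =
        ennreal c * ?I * ennreal (weight_of w0 E)"
    proof -
      have "(\<integral>\<^sup>+y. (ennreal c * ?I) * (ennreal (w0 y) * indicator E y) \<partial>lebesgue) =
          (ennreal c * ?I) * (\<integral>\<^sup>+y. ennreal (w0 y) * indicator E y \<partial>lebesgue)"
        by (rule nn_integral_cmult) measurable
      also have "(\<integral>\<^sup>+y. ennreal (w0 y) * indicator E y \<partial>lebesgue) = mass E"
        unfolding mass_def nn_integral_completion using eq[unfolded AE_completion_iff]
        by (intro nn_integral_cong_AE) (auto elim!: eventually_mono)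
      also have "mass E = ennreal (weight_of w0 E)"
        unfolding E_def by (rule mass_eq_weight_of(1)[OF w0 eq, symmetric])
      finally show ?thesis .
    qed
    ultimately have "ennreal (s * (1 - s)) * (ennreal c * ?I * ennreal (weight_of w0 E)) \<le>
        frac_energy k s p v"
      unfolding frac_energy_def by (intro mult_left_mono) auto
    thus ?thesis using s c WE by (simp add: c'_def ennreal_mult less_imp_le mult_ac)
  qed
  moreover have "0 < c'" using s c WE by (simp add: c'_def)
  ultimately show ?thesis by blast
qed

section \<open>The embeddings\<close>

lemma has_weak_gradient_weak_gradient:
  assumes "v \<in> sobolev w p"
  shows "has_weak_gradient v (weak_gradient v)"
proof -
  have "\<exists>g. has_weak_gradient v g" using assms by (simp add: sobolev_def)
  thus ?thesis unfolding weak_gradient_def by (rule someI_ex)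
qed

lemma powr_norm_bound:
  assumes C: "0 \<le> C" and le: "A \<le> ennreal C * B" and fin: "B < \<infinity>" and p: "1 < p"
  shows "enn2real A powr (1 / p) \<le> C powr (1 / p) * enn2real B powr (1 / p)"
proof -
  have "enn2real A \<le> C * enn2real B"
    using enn2real_mono[OF le] fin C by (simp add: enn2real_mult ennreal_mult_less_top less_top)
  hence "enn2real A powr (1 / p) \<le> (C * enn2real B) powr (1 / p)"
    using p by (intro powr_mono2) auto
  thus ?thesis using C by (simp add: powr_mult)
qed

text \<open>All three norms are \<open>p\<close>-th roots of energies, so both embeddings reduce to inequalities and
  implications between energies; finiteness keeps the conversion to reals from sending
  an infinite energy to norm zero.\<close>

lemma continuously_embedded_energyI:
  assumes p: "1 < p" and C: "0 \<le> C"
    and sub: "X \<subseteq> Y"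
    and norms: "\<And>v. nX v = enn2real (eX v) powr (1 / p)" "\<And>v. nY v = enn2real (eY v) powr (1 / p)"
    and finX: "\<And>v. v \<in> X \<Longrightarrow> eX v < \<infinity>" and finY: "\<And>v. v \<in> X \<Longrightarrow> eY v < \<infinity>"
    and le: "\<And>v. v \<in> X \<Longrightarrow> eY v \<le> ennreal C * eX v"
    and inj: "\<And>v. v \<in> X \<Longrightarrow> eY v = 0 \<Longrightarrow> eX v = 0"
  shows "continuously_embedded X nX Y nY"
  unfolding continuously_embedded_def
proof (intro conjI ballI impI exI[of _ "C powr (1 / p)"])
  fix v assume v: "v \<in> X"
  show "nY v \<le> C powr (1 / p) * nX v"
    unfolding norms by (rule powr_norm_bound[OF C le[OF v] finX[OF v] p])
  assume "nY v = 0"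
  hence "eY v = 0" using finY[OF v] by (auto simp: norms enn2real_eq_0_iff)
  thus "nX v = 0" using inj[OF v] by (simp add: norms)
qed (use sub in auto)

theorem corollary2p14:
  fixes s p l L :: real
    and w :: "real^'n \<Rightarrow> real"
    and k :: "(real^'n) \<times> (real^'n) \<Rightarrow> real"
    and \<Omega> :: "(real^'n) set"
  assumes "2 \<le> CARD('n)"
    and "0 < s" and "s < 1" and "1 < p"
    and "w \<in> Ap_weights p"
    and "0 < l" and "l \<le> L"
    and "comparable_kernel l L w k"
    and "open \<Omega>" and "bounded \<Omega>"
  shows "continuously_embedded (sobolev0 w p \<Omega>) (sobolev_norm w p)
           (frac_sobolev0 k s p \<Omega>) (frac_norm k s p)
       \<and> continuously_embedded (frac_sobolev0 k s p \<Omega>) (frac_norm k s p)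
           (Lp_weighted w p \<Omega>) (Lp_norm w p \<Omega>)"
proof -
  note s = \<open>0 < s\<close> \<open>s < 1\<close> and p = \<open>1 < p\<close> and k = \<open>comparable_kernel l L w k\<close>
  have w0: "locally_integrable w" and w_pos: "AE x in lebesgue. 0 < w x"
    using \<open>w \<in> Ap_weights p\<close> by (auto simp: Ap_weights_def weight_def)
  obtain w' K where "muckenhoupt_vec w' p K CARD('n)" and eq: "AE x in lebesgue. w x = w' x"
    using weight_borel_representative[OF p \<open>w \<in> Ap_weights p\<close>] .
  then interpret M: muckenhoupt_vec w' p K "CARD('n)" by simp
  have \<Omega>: "\<Omega> \<in> sets lebesgue" using \<open>open \<Omega>\<close> by simp
  have L: "0 \<le> L" using \<open>0 < l\<close> \<open>l \<le> L\<close> by simp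
  let ?lp = "\<lambda>v. \<integral>\<^sup>+x\<in>\<Omega>. ennreal (\<bar>v x\<bar> powr p * w x) \<partial>lebesgue"
  obtain c where c: "0 < c" and poincare: "\<And>v. v \<in> borel_measurable lebesgue \<Longrightarrow>
      (AE x in lebesgue. x \<notin> \<Omega> \<longrightarrow> v x = 0) \<Longrightarrow> ennreal c * ?lp v \<le> frac_energy k s p v"
    using M.fractional_poincare[OF w0 eq k \<open>0 < l\<close> s \<open>bounded \<Omega>\<close> \<Omega>] by blast
  obtain C where C: "0 \<le> C" and energy: "\<And>v g. has_weak_gradient v g \<Longrightarrow> v \<in> borel_measurable borel \<Longrightarrow> g \<in> borel_measurable borel \<Longrightarrow>
    (\<integral>\<^sup>+y. \<integral>\<^sup>+x. indicator {0<..} (dist x y) * diff_quotient s p v x y * M.kern x y \<partial>lborel \<partial>lborel) \<le>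
      ennreal C * (\<integral>\<^sup>+x. ennreal ((\<bar>v x\<bar> powr p + norm (g x) powr p) * w' x) \<partial>lborel)"
    using M.fractional_energy_le_sobolev_energy[OF s] by blast
  define C' where "C' = s * (1 - s) * L * C"
  have C': "0 \<le> C'" using C L s by (simp add: C'_def)
  have sobolev_bound: "frac_energy k s p v \<le> ennreal C' * sobolev_energy w p v"
    if "v \<in> sobolev w p" for v
  proof -
    have wg: "has_weak_gradient v (weak_gradient v)"
      using that by (rule has_weak_gradient_weak_gradient)
    have lv: "locally_integrable v" and lg: "locally_integrable (weak_gradient v)"
      using wg by (auto simp: has_weak_gradient_def)
    obtain v' where v': "v' \<in> borel_measurable borel" "AE x in lebesgue. v x = v' x"
      using borel_representative[OF locally_integrable_measurable[OF lv]] .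
    obtain g' where g': "g' \<in> borel_measurable borel" "AE x in lebesgue. weak_gradient v x = g' x"
      using borel_representative_vec[OF locally_integrable_measurable[OF lg]] .
    have "frac_energy k s p v \<le> ennreal (s * (1 - s) * L) *
      (\<integral>\<^sup>+y. \<integral>\<^sup>+x. indicator {0<..} (dist x y) * diff_quotient s p v' x y * M.kern x y \<partial>lborel \<partial>lborel)"
      by (rule M.frac_energy_le[OF w0 eq k L s v'])
    also have "\<dots> \<le> ennreal (s * (1 - s) * L) * (ennreal C *
        (\<integral>\<^sup>+x. ennreal ((\<bar>v' x\<bar> powr p + norm (g' x) powr p) * w' x) \<partial>lborel))"
      by (intro mult_left_mono energy has_weak_gradient_cong_AE[OF wg] v' g') auto
    also have "(\<integral>\<^sup>+x. ennreal ((\<bar>v' x\<bar> powr p + norm (g' x) powr p) * w' x) \<partial>lborel) = sobolev_energy w p v"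
    proof -
      have "AE x in lborel. ennreal ((\<bar>v' x\<bar> powr p + norm (g' x) powr p) * w' x) =
          ennreal ((\<bar>v x\<bar> powr p + norm (weak_gradient v x) powr p) * w x)"
        using v'(2) g'(2) eq unfolding AE_completion_iff by eventually_elim simp
      thus ?thesis unfolding sobolev_energy_def nn_integral_completion by (rule nn_integral_cong_AE)
    qed
    finally show ?thesis using C L s by (simp add: C'_def ennreal_mult mult.assoc)
  qed
  have loc: "locally_integrable v" if "v \<in> sobolev w p" for v
    using that by (auto simp: sobolev_def has_weak_gradient_def)
  have null: "AE x in lebesgue. v x = 0"
    if lp: "?lp v = 0" and v: "locally_integrable v" and out: "AE x in lebesgue. x \<notin> \<Omega> \<longrightarrow> v x = 0" for v
  proof -
    note [measurable] = locally_integrable_measurable[OF v] locally_integrable_measurable[OF w0] \<Omega>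
    have "AE x in lebesgue. ennreal (\<bar>v x\<bar> powr p * w x) * indicator \<Omega> x = 0"
      using lp by (subst nn_integral_0_iff_AE[symmetric]) measurable
    thus ?thesis using out w_pos
    proof eventually_elim
      case (elim x)
      show ?case
      proof (cases "x \<in> \<Omega>")
        case True
        hence "\<bar>v x\<bar> powr p * w x \<le> 0" using elim(1) by (simp add: ennreal_eq_0_iff)
        thus ?thesis using elim(3) p by (auto simp: mult_le_0_iff)
      qed (use elim in auto)
    qed
  qed
  have lp_zero: "?lp v = 0"
    if "frac_energy k s p v = 0" "locally_integrable v" "AE x in lebesgue. x \<notin> \<Omega> \<longrightarrow> v x = 0" for v
    using poincare[OF locally_integrable_measurable[OF that(2)] that(3)] that(1) c by auto
  have first: "continuously_embedded (sobolev0 w p \<Omega>) (sobolev_norm w p)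
           (frac_sobolev0 k s p \<Omega>) (frac_norm k s p)"
  proof (rule continuously_embedded_energyI[OF p C'])
    show fin: "sobolev_energy w p v < \<infinity>" if "v \<in> sobolev0 w p \<Omega>" for v
      using that by (auto simp: sobolev0_def sobolev_def)
    show le: "frac_energy k s p v \<le> ennreal C' * sobolev_energy w p v" if "v \<in> sobolev0 w p \<Omega>" for v
      using that sobolev_bound by (auto simp: sobolev0_def)
    show fin': "frac_energy k s p v < \<infinity>" if "v \<in> sobolev0 w p \<Omega>" for v
      using le[OF that] fin[OF that] by (auto simp: ennreal_mult_less_top intro: le_less_trans)
    show "sobolev0 w p \<Omega> \<subseteq> frac_sobolev0 k s p \<Omega>"
      using fin' loc by (auto simp: sobolev0_def frac_sobolev0_def frac_sobolev_def)
    show "sobolev_energy w p v = 0" if v: "v \<in> sobolev0 w p \<Omega>" and 0: "frac_energy k s p v = 0" for v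
    proof -
      have v': "v \<in> sobolev w p" "AE x in lebesgue. x \<notin> \<Omega> \<longrightarrow> v x = 0"
        using v by (auto simp: sobolev0_def)
      have v0: "AE x in lebesgue. v x = 0"
        using null[OF lp_zero] 0 loc v' by blast
      have "has_weak_gradient v (weak_gradient v)"
        using v'(1) by (rule has_weak_gradient_weak_gradient)
      from weak_gradient_of_null_function[OF this v0] v0
      have "AE x in lebesgue. ennreal ((\<bar>v x\<bar> powr p + norm (weak_gradient v x) powr p) * w x) = 0"
        by eventually_elim simp
      hence "sobolev_energy w p v = (\<integral>\<^sup>+x. 0 \<partial>(lebesgue :: (real^'n) measure))"
        unfolding sobolev_energy_def by (rule nn_integral_cong_AE)
      thus ?thesis by simp
    qed
  qed (simp_all add: sobolev_norm_def frac_norm_def)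
  have second: "continuously_embedded (frac_sobolev0 k s p \<Omega>) (frac_norm k s p)
           (Lp_weighted w p \<Omega>) (Lp_norm w p \<Omega>)"
  proof (rule continuously_embedded_energyI[OF p, of "1 / c"])
    have v: "locally_integrable v" "frac_energy k s p v < \<infinity>" "AE x in lebesgue. x \<notin> \<Omega> \<longrightarrow> v x = 0"
      if "v \<in> frac_sobolev0 k s p \<Omega>" for v
      using that by (auto simp: frac_sobolev0_def frac_sobolev_def)
    show "0 \<le> 1 / c" using c by simp
    show "frac_energy k s p v < \<infinity>" if "v \<in> frac_sobolev0 k s p \<Omega>" for v using v[OF that] by blast
    show le: "?lp v \<le> ennreal (1 / c) * frac_energy k s p v" if "v \<in> frac_sobolev0 k s p \<Omega>" for v
    proof -
      have "ennreal c * ?lp v \<le> frac_energy k s p v"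
        using poincare v[OF that] locally_integrable_measurable by blast
      hence "ennreal (1 / c) * (ennreal c * ?lp v) \<le> ennreal (1 / c) * frac_energy k s p v"
        by (rule mult_left_mono) simp
      moreover have "ennreal (1 / c) * ennreal c = 1" using c by (simp add: ennreal_mult[symmetric])
      ultimately show ?thesis by (simp add: mult.assoc[symmetric])
    qed
    show fin: "?lp v < \<infinity>" if "v \<in> frac_sobolev0 k s p \<Omega>" for v
      using le[OF that] v(2)[OF that] by (auto simp: ennreal_mult_less_top intro: le_less_trans)
    show "frac_sobolev0 k s p \<Omega> \<subseteq> Lp_weighted w p \<Omega>"
      unfolding Lp_weighted_def using fin v(1) locally_integrable_measurable
      by (auto intro: measurable_restrict_space1)
    show "frac_energy k s p v = 0" if "v \<in> frac_sobolev0 k s p \<Omega>" "?lp v = 0" for v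
    proof -
      have v0: "AE x in lebesgue. v x = 0" using null that v[OF that(1)] by blast
      have "(\<integral>\<^sup>+y. (\<integral>\<^sup>+x. ennreal ((\<bar>v x - v y\<bar> / norm (x - y) powr s) powr p * k (x, y)) \<partial>lebesgue) \<partial>lebesgue) =
          (\<integral>\<^sup>+y. 0 \<partial>(lebesgue :: (real^'n) measure))"
      proof (rule nn_integral_cong_AE)
        show "AE y in lebesgue. (\<integral>\<^sup>+x. ennreal ((\<bar>v x - v y\<bar> / norm (x - y) powr s) powr p * k (x, y)) \<partial>lebesgue) = 0"
          using v0
        proof eventually_elim
          case (elim y)
          have "AE x in lebesgue. ennreal ((\<bar>v x - v y\<bar> / norm (x - y) powr s) powr p * k (x, y)) = 0"
            using v0 by eventually_elim (simp add: elim)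
          hence "(\<integral>\<^sup>+x. ennreal ((\<bar>v x - v y\<bar> / norm (x - y) powr s) powr p * k (x, y)) \<partial>lebesgue) = (\<integral>\<^sup>+x. 0 \<partial>(lebesgue :: (real^'n) measure))"
            by (rule nn_integral_cong_AE)
          thus ?case by simp
        qed
      qed
      thus ?thesis by (simp add: frac_energy_def)
    qed
  qed (simp_all add: frac_norm_def Lp_norm_def)
  show ?thesis using first second by blast
qed

end
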